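(* Let $S$ be a Banach space with a normalized basis $(s_j)_{j=1}^\infty$ whose normalized associated coordinate functionals $(s_j^* )_{j=1}^\infty$ form a subsymmetric weak$^*$ Schauder basis of $S^*$, and assume that $S^*$ together with $(s_j^* )$ satisfies condition (C). Let $1\le p\le\infty$. Then for every bounded linear operator $T:\ell^p(S^* )\to\ell^p(S^* )$ there exist bounded linear operators $M,N:\ell^p(S^* )\to\ell^p(S^* )$ such that, for $H=T$ or for $H=\mathrm{Id}_{\ell^p(S^* )}-T$, $$ NHM = \mathrm{Id}_{\ell^p(S^* )}\qquad\text{and}\qquad \|M\|\,\|N\|\le 48K_u^7K_s^4.$$ Consequently, $\ell^p(S^* )$ is primary, i.e. for every bounded projection $Q$ on $\ell^p(S^* )$, either $Q(\ell^p(S^* ))$ or $(\mathrm{Id}-Q)(\ell^p(S^* ))$ is isomorphic to $\ell^p(S^* )$.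
   Context: Weak$^*$ Schauder basis: for a Banach space $X$ with a basis $(e_j)$, the associated coordinate functionals $(e_j^* )\subset X^*$ (so $\langle e_j^*,e_i\rangle=\delta_{ij}$) form a weak$^*$ Schauder basis of $X^*$ if every $x^*\in X^*$ satisfies $x^* = \text{weak}^*\text{-}\lim_{n\to\infty}\sum_{j=1}^n \langle x^*,e_j\rangle e_j^*$. All series in $X^*$ are understood as weak$^*$ limits of partial sums. Unconditional: there is $C\ge1$ with $\|\sum_j \gamma_j a_j e_j^*\| \le C\sup_j|\gamma_j|\,\|\sum_j a_je_j^*\|$ for all $(\gamma_j)\in\ell^\infty$ and all scalars $(a_j)$ with $\sum_j a_je_j^*\in X^*$; $K_u$ is the infimum of such $C$. Subsymmetric: $(e_j^* )$ is unconditional and, for every increasing sequence $(n_j)\subset\mathbb{N}$, the operator $S_{(n_j)}(\sum_j a_je_j^* ) = \sum_j a_j e_{n_j}^*$ is an isomorphism of $X^*$ onto the weak$^*$-closed span of $\{e_{n_j}^*\}$; $K_s = \sup\{\|S_{(n_j)}\|,\|S_{(n_j)}^{-1}\|\}$ over all increasing sequences (which is finite). Condition (C): Let $U$ be a Banach space with normalized unconditional basis $(e_j)$ whose normalized coordinate functionals $(e_j^* )$ form an unconditional weak$^*$ Schauder basis of $U^*$. For $\mathcal{A}\subset\mathbb{N}$ let $P_{\mathcal{A}}(\sum_j a_je_j^* ) = \sum_{j\in\mathcal{A}} a_je_j^*$. $U^*$ with $(e_j^* )$ satisfies condition (C) if for every infinite $\Lambda\subset\mathbb{N}$ and every $\theta>0$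 there is a sequence $(\mathcal{A}_j)_{j\ge1}$ of pairwise disjoint infinite subsets of $\Lambda$ such that for every sequence $(x_j^* )\subset U^*$ with $\|x_j^*\|\le1$ there exist scalars $(a_j)\in\ell^1$ with $\|(a_j)\|_{\ell^1}=1$ and $\|\sum_{j=1}^\infty a_jP_{\mathcal{A}_j}x_j^*\|_{U^*}\le\theta$ (the series converging weak$^*$). $\ell^p(X)$ denotes the space of sequences $(y_n)$ in $X$ with $(\|y_n\|_X)_n\in\ell^p$, normed by $\|(\|y_n\|_X)_n\|_{\ell^p}$. *)

theory Defs
  imports "HOL-Analysis.Analysis"
begin

definition wstar_topology :: "('a::real_normed_vector \<Rightarrow>\<^sub>L real) topology" where
  "wstar_topology = topology_generated_by {{f. blinfun_apply f x \<in> U} | x U. open U}"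

definition wstar_closed_span :: "('a::real_normed_vector \<Rightarrow>\<^sub>L real) set \<Rightarrow> ('a \<Rightarrow>\<^sub>L real) set" where
  "wstar_closed_span A = wstar_topology closure_of (span A)"

definition wstar_sums :: "(nat \<Rightarrow> ('a::real_normed_vector \<Rightarrow>\<^sub>L real)) \<Rightarrow> (nat \<Rightarrow> real) \<Rightarrow> ('a \<Rightarrow>\<^sub>L real) \<Rightarrow> bool" where
  "wstar_sums e a y \<longleftrightarrow> (\<forall>x. (\<lambda>n. \<Sum>j<n. a j * blinfun_apply (e j) x) \<longlonglongrightarrow> blinfun_apply y x)"

definition schauder_basis :: "(nat \<Rightarrow> 'a::real_normed_vector) \<Rightarrow> bool" where
  "schauder_basis s \<longleftrightarrow> (\<forall>x. \<exists>!a. (\<lambda>n. \<Sum>j<n. a j *\<^sub>R s j) \<longlonglongrightarrow> x)"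

definition biorthogonal :: "(nat \<Rightarrow> 'a::real_normed_vector) \<Rightarrow> (nat \<Rightarrow> ('a \<Rightarrow>\<^sub>L real)) \<Rightarrow> bool" where
  "biorthogonal s e \<longleftrightarrow> (\<forall>i j. blinfun_apply (e j) (s i) = (if i = j then 1 else 0))"

definition wstar_schauder_basis :: "(nat \<Rightarrow> 'a::real_normed_vector) \<Rightarrow> (nat \<Rightarrow> ('a \<Rightarrow>\<^sub>L real)) \<Rightarrow> bool" where
  "wstar_schauder_basis s e \<longleftrightarrow> (\<forall>y. wstar_sums e (\<lambda>j. blinfun_apply y (s j)) y)"

definition uncond_const :: "(nat \<Rightarrow> ('a::real_normed_vector \<Rightarrow>\<^sub>L real)) \<Rightarrow> real \<Rightarrow> bool" where
  "uncond_const e C \<longleftrightarrow> C \<ge> 1 \<and>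
     (\<forall>\<gamma> a y. bounded (range \<gamma>) \<longrightarrow> wstar_sums e a y \<longrightarrow>
        (\<exists>z. wstar_sums e (\<lambda>j. \<gamma> j * a j) z \<and> norm z \<le> C * (SUP j. \<bar>\<gamma> j\<bar>) * norm y))"

definition wstar_unconditional :: "(nat \<Rightarrow> ('a::real_normed_vector \<Rightarrow>\<^sub>L real)) \<Rightarrow> bool" where
  "wstar_unconditional e \<longleftrightarrow> (\<exists>C. uncond_const e C)"

definition Ku :: "(nat \<Rightarrow> ('a::real_normed_vector \<Rightarrow>\<^sub>L real)) \<Rightarrow> real" where
  "Ku e = Inf {C. uncond_const e C}"

definition spread :: "(nat \<Rightarrow> nat) \<Rightarrow> (nat \<Rightarrow> real) \<Rightarrow> nat \<Rightarrow> real" where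
  "spread n a i = (if i \<in> range n then a (inv n i) else 0)"

text \<open>For every increasing (n_j), the spreading operator S_(n_j) is defined on the whole dual,
  maps it onto the weak*-closed span of the e_(n_j), and both S and its inverse have norm \<le> C.\<close>
definition subsym_const :: "(nat \<Rightarrow> ('a::real_normed_vector \<Rightarrow>\<^sub>L real)) \<Rightarrow> real \<Rightarrow> bool" where
  "subsym_const e C \<longleftrightarrow>
     (\<forall>n. strict_mono n \<longrightarrow>
        (\<forall>a y. wstar_sums e a y \<longrightarrow>
           (\<exists>z. wstar_sums e (spread n a) z \<and> norm z \<le> C * norm y \<and> norm y \<le> C * norm z)) \<and>
        (\<forall>z \<in> wstar_closed_span (e ` range n).
           (\<exists>a y. wstar_sums e a y \<and> wstar_sums e (spread n a) z \<and> norm y \<le> C * norm z)))"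

definition wstar_subsymmetric :: "(nat \<Rightarrow> ('a::real_normed_vector \<Rightarrow>\<^sub>L real)) \<Rightarrow> bool" where
  "wstar_subsymmetric e \<longleftrightarrow> wstar_unconditional e \<and> (\<exists>C. subsym_const e C)"

text \<open>K_s: the least admissible constant, i.e. sup of the norms of all S_(n_j) and their inverses.\<close>
definition Ks :: "(nat \<Rightarrow> ('a::real_normed_vector \<Rightarrow>\<^sub>L real)) \<Rightarrow> real" where
  "Ks e = Inf {C. subsym_const e C}"

definition coord_proj :: "(nat \<Rightarrow> 'a::real_normed_vector) \<Rightarrow> (nat \<Rightarrow> ('a \<Rightarrow>\<^sub>L real)) \<Rightarrow> nat set
    \<Rightarrow> ('a \<Rightarrow>\<^sub>L real) \<Rightarrow> ('a \<Rightarrow>\<^sub>L real)" where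
  "coord_proj s e A y = (THE z. wstar_sums e (\<lambda>j. if j \<in> A then blinfun_apply y (s j) else 0) z)"

definition condition_C :: "(nat \<Rightarrow> 'a::real_normed_vector) \<Rightarrow> (nat \<Rightarrow> ('a \<Rightarrow>\<^sub>L real)) \<Rightarrow> bool" where
  "condition_C s e \<longleftrightarrow>
     (\<forall>\<Lambda>::nat set. \<forall>\<theta>::real. infinite \<Lambda> \<longrightarrow> \<theta> > 0 \<longrightarrow>
        (\<exists>A :: nat \<Rightarrow> nat set.
           (\<forall>j. infinite (A j) \<and> A j \<subseteq> \<Lambda>) \<and> (\<forall>i j. i \<noteq> j \<longrightarrow> A i \<inter> A j = {}) \<and>
           (\<forall>x :: nat \<Rightarrow> ('a \<Rightarrow>\<^sub>L real). (\<forall>j. norm (x j) \<le> 1) \<longrightarrow>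
              (\<exists>a :: nat \<Rightarrow> real. \<exists>z. summable (\<lambda>j. \<bar>a j\<bar>) \<and> (\<Sum>j. \<bar>a j\<bar>) = 1 \<and>
                  (\<forall>u. (\<lambda>m. \<Sum>j<m. a j * blinfun_apply (coord_proj s e (A j) (x j)) u)
                          \<longlonglongrightarrow> blinfun_apply z u) \<and>
                  norm z \<le> \<theta>))))"

definition lp_space :: "ereal \<Rightarrow> (nat \<Rightarrow> 'b::real_normed_vector) set" where
  "lp_space p = (if p = \<infinity> then {y. bounded (range (\<lambda>n. norm (y n)))}
                 else {y. summable (\<lambda>n. norm (y n) powr real_of_ereal p)})"

definition lp_norm :: "ereal \<Rightarrow> (nat \<Rightarrow> 'b::real_normed_vector) \<Rightarrow> real" where
  "lp_norm p y = (if p = \<infinity> then (SUP n. norm (y n))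
                  else (\<Sum>n. norm (y n) powr real_of_ereal p) powr (1 / real_of_ereal p))"

text \<open>Bounded linear operators on \<open>\<ell>^p(X)\<close> (values outside the space are irrelevant).\<close>
definition lp_bounded_linear :: "ereal \<Rightarrow> ((nat \<Rightarrow> 'b::real_normed_vector) \<Rightarrow> (nat \<Rightarrow> 'b)) \<Rightarrow> bool" where
  "lp_bounded_linear p T \<longleftrightarrow>
     (\<forall>y \<in> lp_space p. T y \<in> lp_space p) \<and>
     (\<forall>y \<in> lp_space p. \<forall>z \<in> lp_space p. T (\<lambda>n. y n + z n) = (\<lambda>n. T y n + T z n)) \<and>
     (\<forall>y \<in> lp_space p. \<forall>c::real. T (\<lambda>n. c *\<^sub>R y n) = (\<lambda>n. c *\<^sub>R T y n)) \<and>
     (\<exists>K. \<forall>y \<in> lp_space p. lp_norm p (T y) \<le> K * lp_norm p y)"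

definition lp_opnorm :: "ereal \<Rightarrow> ((nat \<Rightarrow> 'b::real_normed_vector) \<Rightarrow> (nat \<Rightarrow> 'b)) \<Rightarrow> real" where
  "lp_opnorm p T = Sup {lp_norm p (T y) | y. y \<in> lp_space p \<and> lp_norm p y \<le> 1}"

definition lp_isomorphic :: "ereal \<Rightarrow> (nat \<Rightarrow> 'b::real_normed_vector) set \<Rightarrow> (nat \<Rightarrow> 'b) set \<Rightarrow> bool" where
  "lp_isomorphic p V W \<longleftrightarrow>
     (\<exists>f g. (\<forall>y \<in> V. f y \<in> W) \<and> (\<forall>z \<in> W. g z \<in> V) \<and>
            (\<forall>y \<in> V. g (f y) = y) \<and> (\<forall>z \<in> W. f (g z) = z) \<and>
            (\<forall>y \<in> V. \<forall>y' \<in> V. f (\<lambda>n. y n + y' n) = (\<lambda>n. f y n + f y' n)) \<and>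
            (\<forall>y \<in> V. \<forall>c::real. f (\<lambda>n. c *\<^sub>R y n) = (\<lambda>n. c *\<^sub>R f y n)) \<and>
            (\<exists>K. \<forall>y \<in> V. lp_norm p (f y) \<le> K * lp_norm p y) \<and>
            (\<exists>K. \<forall>z \<in> W. lp_norm p (g z) \<le> K * lp_norm p z))"

end

theory Submission
  imports Defs
begin

text \<open>View an operator on \<open>\<ell>\<^sup>p(S\<^sup>*)\<close> as a matrix indexed by pairs (row, column). Condition (C) yields, in
  every row, an infinite set of columns along whose tails countably many given functionals become
  uniformly small; on a subset, the coordinates of the image of every unit vector also converge
  to some limit \<open>L\<close>. For the image of a unit vector at its own position, either the entry of \<open>T\<close>
  minus \<open>L\<close> or that of \<open>Id - T\<close> plus \<open>L\<close> is at least \<open>1/2\<close>; call \<open>H\<close> the operator that wins in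
  infinitely many rows. A gliding hump chooses pairs of columns \<open>\<kappa> t\<close>, \<open>\<kappa>' t\<close>: spreading to the \<open>\<kappa> t\<close>, applying \<open>H\<close> and
  reading off the difference of the coordinates \<open>\<kappa> t\<close> and \<open>\<kappa>' t\<close> is, up to a small error, a
  diagonal operator bounded below, because the limits \<open>L\<close> cancel. A Neumann series then factors the
  identity through \<open>H\<close>, and Pelczynski's decomposition method gives primarity.\<close>

text \<open>A bounded operator need not be weak* continuous, so its matrix does not determine it: a
  functional can vanish on all unit vectors without being 0. This can happen inside one row, where
  condition (C) is the remedy, and for \<open>p = \<infinity>\<close> also across infinitely many
  rows, where disjointly supported vectors play the same role. Both remedies are applied before the
  columns \<open>\<kappa> t\<close> are picked, so that the estimates hold for all vectors supported
  far out and not merely for unit vectors. The coordinates of the image of a unit vector need not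
  tend to 0 along a row, as \<open>S\<^sup>* = \<ell>\<^sup>\<infinity>\<close> shows; only
  convergence can be arranged, so a single reading per position would leave errors of fixed size. A
  diagonal entry at distance \<open>1/2\<close> from its limit leaves \<open>1/4\<close> for the
  difference of two readings, so inverting the diagonal costs 4. Taking a difference costs 2 and the
  Neumann series 2, whence the factor 16; the remaining room up to 48 pays for replacing infima by
  nearby admissible constants.\<close>

lemma dependent_seq_choice:
  fixes P :: "nat \<Rightarrow> (nat \<Rightarrow> 'b) \<Rightarrow> 'b \<Rightarrow> bool"
  assumes cong: "\<And>n f g r. (\<And>m. m < n \<Longrightarrow> f m = g m) \<Longrightarrow> P n f r = P n g r"
    and ex: "\<And>n f. (\<And>m. m < n \<Longrightarrow> P m f (f m)) \<Longrightarrow> \<exists>r. P n f r"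
  shows "\<exists>f. \<forall>n. P n f (f n)"
  using dependent_wellorder_choice[of "\<lambda>f n r. P n f r"] assms by metis

text \<open>Diagonal argument: from a decreasing sequence of sets \<open>f n\<close> with
  \<open>R n (f n)\<close>, pick increasing \<open>a n \<in> f n\<close>; from \<open>a n\<close>
  on, the range of \<open>a\<close> lies in \<open>f n\<close>. All requirements hold at once, each
  only on a tail, which is why later smallness statements speak of \<open>{m..}\<close>.\<close>

lemma pseudo_intersection:
  fixes R :: "nat \<Rightarrow> nat set \<Rightarrow> bool"
  assumes hered: "\<And>n A B. R n A \<Longrightarrow> B \<subseteq> A \<Longrightarrow> R n B"
    and shrink: "\<And>n A. infinite A \<Longrightarrow> \<exists>B\<subseteq>A. infinite B \<and> R n B"
    and inf: "infinite A"
  obtains A' where "A' \<subseteq> A" "infinite A'" "\<And>n. \<exists>m. R n (A' \<inter> {m..})"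
proof -
  have "\<exists>f. \<forall>n. infinite (f n) \<and> f n \<subseteq> A \<and> R n (f n) \<and> f (Suc n) \<subseteq> f n"
  proof -
    obtain f0 where f0: "f0 \<subseteq> A" "infinite f0" "R 0 f0"
      using shrink[OF inf] by blast
    have "\<exists>f. \<forall>n. (infinite (f n) \<and> f n \<subseteq> A \<and> R n (f n)) \<and> f (Suc n) \<subseteq> f n"
    proof (rule dependent_nat_choice)
      show "\<exists>x. infinite x \<and> x \<subseteq> A \<and> R 0 x" using f0 by blast
      fix x n assume "infinite x \<and> x \<subseteq> A \<and> R n x"
      then show "\<exists>y. (infinite y \<and> y \<subseteq> A \<and> R (Suc n) y) \<and> y \<subseteq> x"
        using shrink[of x "Suc n"] by blast
    qed
    then show ?thesis by blast
  qed
  then obtain f where f: "\<And>n. infinite (f n)" "\<And>n. f n \<subseteq> A" "\<And>n. R n (f n)" "\<And>n. f (Suc n) \<subseteq> f n"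
    by blast
  have fdec: "f n \<subseteq> f m" if "m \<le> n" for m n
    using that by (induction rule: dec_induct) (use f(4) in auto)
  have "\<exists>a. \<forall>n. a n \<in> f n \<and> a n < a (Suc n)"
  proof (rule dependent_nat_choice)
    show "\<exists>x. x \<in> f 0" using f(1)[of 0] by (metis finite.emptyI ex_in_conv)
    fix x n assume "x \<in> f n"
    obtain y where "y > x" "y \<in> f (Suc n)" using f(1)[of "Suc n"] by (meson infinite_nat_iff_unbounded)
    then show "\<exists>y. y \<in> f (Suc n) \<and> x < y" by blast
  qed
  then obtain a where a: "\<And>n. a n \<in> f n" "\<And>n. a n < a (Suc n)" by blast
  have sm: "strict_mono a" using a(2) by (simp add: strict_mono_Suc_iff)
  show ?thesis
  proof
    show "range a \<subseteq> A" using a(1) f(2) by blast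
    show "infinite (range a)" using sm by (simp add: range_inj_infinite strict_mono_imp_inj_on)
    fix n
    have "range a \<inter> {a n..} \<subseteq> f n"
    proof
      fix x assume "x \<in> range a \<inter> {a n..}"
      then obtain j where "x = a j" "a n \<le> a j" by auto
      then have "n \<le> j" using sm by (simp add: strict_mono_less_eq)
      then show "x \<in> f n" using a(1)[of j] fdec[of n j] \<open>x = a j\<close> by blast
    qed
    then show "\<exists>m. R n (range a \<inter> {m..})" using hered f(3) by blast
  qed
qed

section \<open>Vector-valued sequence spaces\<close>

text \<open>Membership in \<open>\<ell>\<^sup>p\<close> with norm at most \<open>K\<close>, expressed through finite sums only, so that no
  summability side conditions arise.\<close>

definition lp_le :: "ereal \<Rightarrow> (nat \<Rightarrow> 'b::real_normed_vector) \<Rightarrow> real \<Rightarrow> bool" where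
  "lp_le p y K \<longleftrightarrow> 0 \<le> K \<and>
     (if p = \<infinity> then \<forall>n. norm (y n) \<le> K
      else \<forall>F. finite F \<longrightarrow> (\<Sum>n\<in>F. norm (y n) powr real_of_ereal p) \<le> K powr real_of_ereal p)"

lemma real_of_ereal_ge_1: "1 \<le> p \<Longrightarrow> p \<noteq> \<infinity> \<Longrightarrow> 1 \<le> real_of_ereal p"
  by (cases p) auto

lemma lp_le_nonneg: "lp_le p y K \<Longrightarrow> 0 \<le> K"
  by (simp add: lp_le_def)

text \<open>A series of nonnegative terms is bounded by \<open>c\<close> exactly if its finite
  partial sums are; \<open>0 \<le> K\<close> is automatic on the right because the norm is
  nonnegative.\<close>

lemma lp_le_iff:
  assumes "1 \<le> p"
  shows "lp_le p y K \<longleftrightarrow> y \<in> lp_space p \<and> lp_norm p y \<le> K"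
proof (cases "p = \<infinity>")
  case True
  have "0 \<le> lp_norm p y" if "bounded (range (\<lambda>n. norm (y n)))"
    unfolding lp_norm_def using that True
    by (auto intro!: cSUP_upper2[where x = 0] bounded_imp_bdd_above)
  moreover have "lp_norm p y \<le> K \<longleftrightarrow> (\<forall>n. norm (y n) \<le> K)" if "bounded (range (\<lambda>n. norm (y n)))"
    unfolding lp_norm_def using that True
    by (auto simp: cSUP_le_iff bounded_imp_bdd_above)
  moreover have "bounded (range (\<lambda>n. norm (y n)))" if "\<forall>n. norm (y n) \<le> K"
    using that by (auto simp: bounded_iff)
  ultimately show ?thesis using True by (auto simp: lp_le_def lp_space_def)
next
  case False
  define r where "r = real_of_ereal p"
  have r: "1 \<le> r" using real_of_ereal_ge_1[OF assms False] by (simp add: r_def)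
  let ?f = "\<lambda>n. norm (y n) powr r"
  have *: "(\<forall>F. finite F \<longrightarrow> sum ?f F \<le> c) \<longleftrightarrow> summable ?f \<and> suminf ?f \<le> c" for c
  proof safe
    assume h: "\<forall>F. finite F \<longrightarrow> sum ?f F \<le> c"
    have b: "sum ?f {..<n} \<le> c" for n using h by simp
    show s: "summable ?f"
    proof (rule bounded_imp_summable)
      show "sum ?f {..n} \<le> c" for n using h by simp
    qed simp
    show "suminf ?f \<le> c" using b by (intro suminf_le_const[OF s])
  next
    fix F assume "summable ?f" "suminf ?f \<le> c" "finite (F::nat set)"
    then show "sum ?f F \<le> c" using sum_le_suminf[of ?f F] by fastforce
  qed
  have "suminf ?f \<le> K powr r \<longleftrightarrow> suminf ?f powr (1/r) \<le> K" if "summable ?f" "0 \<le> K"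
  proof -
    have S: "0 \<le> suminf ?f" using that by (intro suminf_nonneg) auto
    have e: "(suminf ?f powr (1/r)) powr r = suminf ?f" "(K powr r) powr (1/r) = K"
      using S r that by (auto simp: powr_powr)
    show ?thesis
      using powr_mono2[of "1/r" "suminf ?f" "K powr r"] powr_mono2[of r "suminf ?f powr (1/r)" K] S r e
      by auto
  qed
  then show ?thesis using * False
    by (auto simp: lp_le_def lp_space_def lp_norm_def r_def intro: order_trans[OF powr_ge_zero])
qed

lemma lp_leI: "1 \<le> p \<Longrightarrow> y \<in> lp_space p \<Longrightarrow> lp_le p y (lp_norm p y)"
  by (simp add: lp_le_iff)

lemma lp_le_dominated:
  assumes "lp_le p y K" "1 \<le> p" "0 \<le> c" "\<And>n. norm (z n) \<le> c * norm (y n)"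
  shows "lp_le p z (c * K)"
proof (cases "p = \<infinity>")
  case True
  then show ?thesis using assms
    by (auto simp: lp_le_def intro: order_trans[OF _ mult_left_mono])
next
  case False
  define r where "r = real_of_ereal p"
  have r: "1 \<le> r" using real_of_ereal_ge_1[OF assms(2) False] by (simp add: r_def)
  have K: "0 \<le> K" using assms(1) by (rule lp_le_nonneg)
  have "(\<Sum>n\<in>F. norm (z n) powr r) \<le> (c * K) powr r" if "finite F" for F
  proof -
    have "(\<Sum>n\<in>F. norm (z n) powr r) \<le> (\<Sum>n\<in>F. (c * norm (y n)) powr r)"
      using r assms(4) by (intro sum_mono powr_mono2) auto
    also have "\<dots> = c powr r * (\<Sum>n\<in>F. norm (y n) powr r)"
      using assms(3) by (simp add: powr_mult sum_distrib_left)
    also have "\<dots> \<le> c powr r * K powr r"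
      using assms(1) False that by (intro mult_left_mono) (auto simp: lp_le_def r_def)
    also have "\<dots> = (c * K) powr r" using assms(3) K by (simp add: powr_mult)
    finally show ?thesis .
  qed
  then show ?thesis using False assms(3) K by (simp add: lp_le_def r_def)
qed

lemma lp_le_mono_norm: "lp_le p y K \<Longrightarrow> 1 \<le> p \<Longrightarrow> (\<And>n. norm (z n) \<le> norm (y n)) \<Longrightarrow> lp_le p z K"
  using lp_le_dominated[of p y K 1 z] by simp

lemma lp_le_mono: "lp_le p y K \<Longrightarrow> K \<le> L \<Longrightarrow> 1 \<le> p \<Longrightarrow> lp_le p y L"
  by (auto simp: lp_le_iff)

lemma lp_le_scaleR: "lp_le p y K \<Longrightarrow> 1 \<le> p \<Longrightarrow> lp_le p (\<lambda>n. c *\<^sub>R y n) (\<bar>c\<bar> * K)"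
  by (rule lp_le_dominated[of p y]) auto

lemma lp_le_coord:
  assumes "lp_le p y K" "1 \<le> p"
  shows "norm (y n) \<le> K"
proof (cases "p = \<infinity>")
  case False
  define r where "r = real_of_ereal p"
  have r: "1 \<le> r" using real_of_ereal_ge_1[OF assms(2) False] by (simp add: r_def)
  have "(\<Sum>n\<in>{n}. norm (y n) powr r) \<le> K powr r"
    using assms False unfolding lp_le_def r_def by (metis finite.emptyI finite_insert)
  then have "norm (y n) powr r \<le> K powr r" by simp
  then show ?thesis using r assms(1) powr_mono2[of "1/r" "norm (y n) powr r" "K powr r"]
    by (simp add: powr_powr lp_le_nonneg)
qed (use assms in \<open>auto simp: lp_le_def\<close>)

lemma lp_le_reindex:
  assumes "lp_le p y K" "inj r"
  shows "lp_le p (\<lambda>n. y (r n)) K"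
proof (cases "p = \<infinity>")
  case False
  have "(\<Sum>n\<in>F. norm (y (r n)) powr real_of_ereal p) \<le> K powr real_of_ereal p" if "finite F" for F
  proof -
    have "(\<Sum>n\<in>F. norm (y (r n)) powr real_of_ereal p) = (\<Sum>n\<in>r ` F. norm (y n) powr real_of_ereal p)"
      using assms(2) by (subst sum.reindex) (auto intro: inj_on_subset)
    then show ?thesis using assms(1) False that by (simp add: lp_le_def)
  qed
  then show ?thesis using assms False by (simp add: lp_le_def)
qed (use assms in \<open>auto simp: lp_le_def\<close>)

lemma lp_le_extend:
  assumes "lp_le p (\<lambda>n. y (r n)) K" "inj r" "\<And>m. m \<notin> range r \<Longrightarrow> y m = 0"
  shows "lp_le p y K"
proof (cases "p = \<infinity>")
  case True
  have "norm (y m) \<le> K" for m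
    using assms True by (cases "m \<in> range r") (auto simp: lp_le_def)
  then show ?thesis using assms True by (simp add: lp_le_def)
next
  case False
  have "(\<Sum>n\<in>F. norm (y n) powr real_of_ereal p) \<le> K powr real_of_ereal p" if "finite F" for F
  proof -
    have "(\<Sum>n\<in>F. norm (y n) powr real_of_ereal p) = (\<Sum>n\<in>r ` (r -` F). norm (y n) powr real_of_ereal p)"
    proof (intro sum.mono_neutral_right ballI)
      fix m assume "m \<in> F - r ` (r -` F)"
      then have "m \<notin> range r" by auto
      then show "norm (y m) powr real_of_ereal p = 0" using assms(3) by simp
    qed (use that in auto)
    also have "\<dots> = (\<Sum>n\<in>r -` F. norm (y (r n)) powr real_of_ereal p)"
      using assms(2) by (subst sum.reindex) (auto intro: inj_on_subset)
    finally show ?thesis using assms(1,2) False that finite_vimageI[OF that assms(2)] by (simp add: lp_le_def)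
  qed
  then show ?thesis using assms False by (simp add: lp_le_def)
qed

text \<open>Each entry is at most \<open>K\<close>, so its \<open>r\<close>-th power is at most the
  entry times \<open>K powr (r - 1)\<close>. Error terms are estimated in this strongest norm, which
  settles all \<open>p\<close> at once.\<close>

lemma lp_le_l1:
  assumes "1 \<le> p" "\<And>F. finite F \<Longrightarrow> (\<Sum>n\<in>F. norm (y n)) \<le> K"
  shows "lp_le p y K"
proof -
  have K0: "0 \<le> K" using assms(2)[of "{}"] by simp
  have c: "norm (y n) \<le> K" for n using assms(2)[of "{n}"] by simp
  show ?thesis
  proof (cases "p = \<infinity>")
    case False
    define r where "r = real_of_ereal p"
    have r: "1 \<le> r" using real_of_ereal_ge_1[OF assms(1) False] by (simp add: r_def)
    have *: "norm (y n) powr r \<le> norm (y n) * K powr (r - 1)" for n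
    proof (cases "norm (y n) = 0")
      case nz: False
      have "norm (y n) powr r = norm (y n) * norm (y n) powr (r - 1)"
        using nz by (simp add: powr_diff)
      also have "\<dots> \<le> norm (y n) * K powr (r - 1)"
        using r c by (intro mult_left_mono powr_mono2) auto
      finally show ?thesis .
    qed (use r in auto)
    have "(\<Sum>n\<in>F. norm (y n) powr r) \<le> K powr r" if "finite F" for F
    proof -
      have "(\<Sum>n\<in>F. norm (y n) powr r) \<le> (\<Sum>n\<in>F. norm (y n)) * K powr (r - 1)"
        unfolding sum_distrib_right using * by (intro sum_mono) auto
      also have "\<dots> \<le> K * K powr (r - 1)" using assms(2)[OF that] by (intro mult_right_mono) auto
      also have "\<dots> = K powr r" using K0 r by (cases "K = 0") (auto simp: powr_diff)
      finally show ?thesis .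
    qed
    then show ?thesis using False K0 by (simp add: lp_le_def r_def)
  qed (use K0 c in \<open>auto simp: lp_le_def\<close>)
qed

lemma lp_le_zero: "1 \<le> p \<Longrightarrow> 0 \<le> K \<Longrightarrow> lp_le p (\<lambda>n. 0) K"
  by (rule lp_le_l1) auto

text \<open>Bounds on finitely many entries pass to coordinatewise limits. The Neumann series is
  summed entry by entry and gets its norm bound from here.\<close>

lemma lp_le_Fatou:
  assumes "1 \<le> p" "\<And>m::nat. lp_le p (Y m) K" "\<And>n. (\<lambda>m. Y m n) \<longlonglongrightarrow> y n"
  shows "lp_le p y K"
proof (cases "p = \<infinity>")
  case True
  have "norm (y n) \<le> K" for n
    using assms(2) True
    by (intro tendsto_upperbound[OF tendsto_norm[OF assms(3)[of n]]]) (auto simp: lp_le_def)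
  then show ?thesis using True lp_le_nonneg[OF assms(2)] by (simp add: lp_le_def)
next
  case False
  define r where "r = real_of_ereal p"
  have r: "1 \<le> r" using real_of_ereal_ge_1[OF assms(1) False] by (simp add: r_def)
  have "(\<Sum>n\<in>F. norm (y n) powr r) \<le> K powr r" if "finite F" for F
  proof (rule tendsto_upperbound)
    show "(\<lambda>m. \<Sum>n\<in>F. norm (Y m n) powr r) \<longlonglongrightarrow> (\<Sum>n\<in>F. norm (y n) powr r)"
      using r assms(3) by (intro tendsto_intros tendsto_powr') auto
    show "\<forall>\<^sub>F m in sequentially. (\<Sum>n\<in>F. norm (Y m n) powr r) \<le> K powr r"
      using assms(2) that False by (auto simp: lp_le_def r_def)
  qed simp
  then show ?thesis using False lp_le_nonneg[OF assms(2)] by (simp add: lp_le_def r_def)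
qed

text \<open>Minkowski by convexity: \<open>(y + z)/(K + L)\<close> is the convex combination of
  \<open>y/K\<close> and \<open>z/L\<close> with weights \<open>K/(K+L)\<close> and
  \<open>L/(K+L)\<close>.\<close>

lemma lp_le_add:
  assumes "lp_le p y K" "lp_le p z L" "1 \<le> p"
  shows "lp_le p (\<lambda>n. y n + z n) (K + L)"
proof -
  have aux: "lp_le p (\<lambda>n. y n + z n) (K + L)" if "lp_le p y K" "lp_le p z L" "0 < K" "0 < L" for K L
  proof (cases "p = \<infinity>")
    case True
    then show ?thesis using that by (auto simp: lp_le_def intro: norm_triangle_mono)
  next
    case False
    define r where "r = real_of_ereal p"
    have r: "1 \<le> r" using real_of_ereal_ge_1[OF assms(3) False] by (simp add: r_def)
    have cx: "((a + b) / (K + L)) powr r \<le> K/(K+L) * (a/K) powr r + L/(K+L) * (b/L) powr r"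
      if ab: "0 \<le> a" "0 \<le> b" for a b
    proof -
      \<comment> \<open>Convexity of the power is used at positive points; if one of the points is
        0, the claim reduces to \<open>t powr r \<le> t\<close> on the unit interval.\<close>
      have conv: "((1-t) * x + t * v) powr r \<le> (1-t) * x powr r + t * v powr r"
        if "0 \<le> t" "t \<le> 1" "0 \<le> x" "0 \<le> v" for t x v :: real
      proof -
        have one: "t powr r \<le> t" if "0 \<le> t" "t \<le> 1" for t
          using that powr_mono'[of 1 r t] r by (cases "t = 0") auto
        consider "0 < x" "0 < v" | "x = 0" | "v = 0" using \<open>0 \<le> x\<close> \<open>0 \<le> v\<close> by linarith
        then show ?thesis
        proof cases
          case 1
          then show ?thesis using convex_onD[OF powr_convex[OF r], of t x v] that by simp
        next
          case 2
          then show ?thesis using one[of t] that r by (simp add: powr_mult mult_right_mono)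
        next
          case 3
          then show ?thesis using one[of "1-t"] that r by (simp add: powr_mult mult_right_mono)
        qed
      qed
      have e: "(1 - L/(K+L)) = K/(K+L)" using \<open>0 < K\<close> \<open>0 < L\<close> by (simp add: field_simps)
      have e2: "K/(K+L) * (a/K) + L/(K+L) * (b/L) = (a+b)/(K+L)"
        using \<open>0 < K\<close> \<open>0 < L\<close> by (simp add: add_divide_distrib)
      have "0 \<le> L/(K+L)" "L/(K+L) \<le> 1" using \<open>0 < K\<close> \<open>0 < L\<close> by (auto simp: field_simps)
      from conv[OF this, of "a/K" "b/L"] show ?thesis using ab \<open>0 < K\<close> \<open>0 < L\<close> e e2 by simp
    qed
    have "(\<Sum>n\<in>F. norm (y n + z n) powr r) \<le> (K + L) powr r" if F: "finite F" for F
    proof -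
      have sy: "(\<Sum>n\<in>F. (norm (y n)/K) powr r) \<le> 1"
        using \<open>lp_le p y K\<close> F False \<open>0 < K\<close> unfolding lp_le_def r_def
        by (simp add: powr_divide flip: sum_divide_distrib)
      have sz: "(\<Sum>n\<in>F. (norm (z n)/L) powr r) \<le> 1"
        using \<open>lp_le p z L\<close> F False \<open>0 < L\<close> unfolding lp_le_def r_def
        by (simp add: powr_divide flip: sum_divide_distrib)
      have "(\<Sum>n\<in>F. norm (y n + z n) powr r) \<le> (\<Sum>n\<in>F. (norm (y n) + norm (z n)) powr r)"
        using r by (intro sum_mono powr_mono2 norm_triangle_ineq) auto
      also have "\<dots> = (K+L) powr r * (\<Sum>n\<in>F. ((norm (y n) + norm (z n))/(K+L)) powr r)"
        using \<open>0 < K\<close> \<open>0 < L\<close> by (simp add: powr_divide flip: sum_divide_distrib)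
      also have "\<dots> \<le> (K+L) powr r * (\<Sum>n\<in>F. K/(K+L) * (norm (y n)/K) powr r + L/(K+L) * (norm (z n)/L) powr r)"
        by (intro mult_left_mono sum_mono cx) auto
      also have "\<dots> = (K+L) powr r * (K/(K+L) * (\<Sum>n\<in>F. (norm (y n)/K) powr r) + L/(K+L) * (\<Sum>n\<in>F. (norm (z n)/L) powr r))"
        by (simp add: sum.distrib sum_distrib_left)
      also have "\<dots> \<le> (K+L) powr r * (K/(K+L) * 1 + L/(K+L) * 1)"
        using \<open>0 < K\<close> \<open>0 < L\<close> sy sz by (intro mult_left_mono add_mono) auto
      also have "\<dots> = (K+L) powr r" using \<open>0 < K\<close> \<open>0 < L\<close> by (simp flip: add_divide_distrib)
      finally show ?thesis .
    qed
    then show ?thesis using False that by (simp add: lp_le_def r_def)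
  qed
  \<comment> \<open>\<open>K\<close> or \<open>L\<close> may be 0, so both are enlarged by
    \<open>e/2\<close>, and \<open>e\<close> is removed afterwards.\<close>
  have h: "lp_le p (\<lambda>n. y n + z n) (K + L + e)" if "e > 0" for e
    using aux[of "K + e/2" "L + e/2"] lp_le_mono[OF assms(1)] lp_le_mono[OF assms(2)] assms(3) that
      lp_le_nonneg[OF assms(1)] lp_le_nonneg[OF assms(2)] by (simp add: algebra_simps)
  have "lp_norm p (\<lambda>n. y n + z n) \<le> K + L"
    by (rule field_le_epsilon) (use h lp_le_iff[OF assms(3)] in blast)
  moreover have "(\<lambda>n. y n + z n) \<in> lp_space p" using h[of 1] lp_le_iff[OF assms(3)] by force
  ultimately show ?thesis using lp_le_iff[OF assms(3)] by blast
qed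

lemma lp_le_diff: "lp_le p y K \<Longrightarrow> lp_le p z L \<Longrightarrow> 1 \<le> p \<Longrightarrow> lp_le p (\<lambda>n. y n - z n) (K + L)"
  using lp_le_add[of p y K "\<lambda>n. - z n" L] lp_le_mono_norm[of p z L "\<lambda>n. - z n"] by simp

lemma lp_le_sum:
  assumes "1 \<le> p" "finite I" "\<And>i. i \<in> I \<Longrightarrow> lp_le p (Y i) (K i)"
  shows "lp_le p (\<lambda>n. \<Sum>i\<in>I. Y i n) (\<Sum>i\<in>I. K i)"
  using assms(2,3) by (induction rule: finite_induct) (auto intro: lp_le_zero lp_le_add assms(1))

text \<open>Cauchy criterion for the series of powers. There is no analogue for
  \<open>p = \<infinity>\<close>, where the rows have to be thinned out instead.\<close>

lemma lp_le_tail_0: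
  assumes "lp_le p y K" "1 \<le> p" "p \<noteq> \<infinity>" "0 < \<epsilon>"
  obtains m where "\<And>m'. m \<le> m' \<Longrightarrow> lp_le p (\<lambda>n. if m' \<le> n then y n else 0) \<epsilon>"
proof -
  define r where "r = real_of_ereal p"
  have r: "1 \<le> r" using real_of_ereal_ge_1[OF assms(2,3)] by (simp add: r_def)
  let ?f = "\<lambda>n. norm (y n) powr r"
  have s: "summable ?f" using assms by (simp add: lp_le_iff lp_space_def r_def)
  have "0 < \<epsilon> powr r" using assms(4) by simp
  then obtain N where N: "\<And>m n. m \<ge> N \<Longrightarrow> norm (sum ?f {m..<n}) < \<epsilon> powr r"
    using s unfolding summable_Cauchy by blast
  show ?thesis
  proof
    fix m' assume m': "N \<le> m'"
    have "(\<Sum>n\<in>F. norm (if m' \<le> n then y n else 0) powr r) \<le> \<epsilon> powr r" if F: "finite F" for F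
    proof -
      obtain M where M: "F \<subseteq> {..<M}" using F finite_nat_iff_bounded by blast
      have "(\<Sum>n\<in>F. norm (if m' \<le> n then y n else 0) powr r) = (\<Sum>n\<in>F \<inter> {m'..}. ?f n)"
        using F by (subst sum.inter_restrict) (auto intro!: sum.cong)
      also have "\<dots> \<le> sum ?f {m'..<M}" using M by (intro sum_mono2) auto
      also have "\<dots> \<le> \<epsilon> powr r" using N[OF m', of M] by simp
      finally show ?thesis .
    qed
    then show "lp_le p (\<lambda>n. if m' \<le> n then y n else 0) \<epsilon>"
      using assms by (auto simp: lp_le_def r_def)
  qed
qed

lemma mem_lp_space_iff: "1 \<le> p \<Longrightarrow> y \<in> lp_space p \<longleftrightarrow> (\<exists>K. lp_le p y K)"
  by (auto simp: lp_le_iff)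

lemma lp_space_memI: "1 \<le> p \<Longrightarrow> lp_le p y K \<Longrightarrow> y \<in> lp_space p"
  by (auto simp: lp_le_iff)

lemma lp_norm_nonneg: "1 \<le> p \<Longrightarrow> y \<in> lp_space p \<Longrightarrow> 0 \<le> lp_norm p y"
  using lp_leI lp_le_nonneg by blast

lemma lp_space_add: "1 \<le> p \<Longrightarrow> y \<in> lp_space p \<Longrightarrow> z \<in> lp_space p \<Longrightarrow> (\<lambda>n. y n + z n) \<in> lp_space p"
  unfolding mem_lp_space_iff by (blast intro: lp_le_add)

lemma lp_space_diff: "1 \<le> p \<Longrightarrow> y \<in> lp_space p \<Longrightarrow> z \<in> lp_space p \<Longrightarrow> (\<lambda>n. y n - z n) \<in> lp_space p"
  unfolding mem_lp_space_iff by (blast intro: lp_le_diff)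

lemma lp_space_scaleR: "1 \<le> p \<Longrightarrow> y \<in> lp_space p \<Longrightarrow> (\<lambda>n. c *\<^sub>R y n) \<in> lp_space p"
  unfolding mem_lp_space_iff by (blast intro: lp_le_scaleR)

lemma lp_space_zero: "1 \<le> p \<Longrightarrow> (\<lambda>n. 0) \<in> lp_space p"
  by (rule lp_space_memI[OF _ lp_le_zero]) auto

lemma lp_space_sum:
  assumes "1 \<le> p" "finite I" "\<And>i. i \<in> I \<Longrightarrow> Y i \<in> lp_space p"
  shows "(\<lambda>n. \<Sum>i\<in>I. Y i n) \<in> lp_space p"
  using assms(2,3) by (induction I rule: finite_induct) (auto simp: lp_space_zero lp_space_add assms(1))

lemma lp_space_mono_norm:
  "1 \<le> p \<Longrightarrow> y \<in> lp_space p \<Longrightarrow> (\<And>n. norm (z n) \<le> norm (y n)) \<Longrightarrow> z \<in> lp_space p"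
  by (meson mem_lp_space_iff lp_le_mono_norm)

section \<open>Bounded operators with explicit constants, and the Neumann series\<close>

definition lp_op :: "ereal \<Rightarrow> ((nat \<Rightarrow> 'b::real_normed_vector) \<Rightarrow> (nat \<Rightarrow> 'b)) \<Rightarrow> real \<Rightarrow> bool" where
  "lp_op p T C \<longleftrightarrow> 0 \<le> C \<and>
     (\<forall>y K. lp_le p y K \<longrightarrow> lp_le p (T y) (C * K)) \<and>
     (\<forall>y\<in>lp_space p. \<forall>z\<in>lp_space p. T (\<lambda>n. y n + z n) = (\<lambda>n. T y n + T z n)) \<and>
     (\<forall>y\<in>lp_space p. \<forall>c. T (\<lambda>n. c *\<^sub>R y n) = (\<lambda>n. c *\<^sub>R T y n))"

lemma lp_opI:
  assumes "0 \<le> C" "\<And>y K. lp_le p y K \<Longrightarrow> lp_le p (T y) (C * K)"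
    and "\<And>y z. y \<in> lp_space p \<Longrightarrow> z \<in> lp_space p \<Longrightarrow> T (\<lambda>n. y n + z n) = (\<lambda>n. T y n + T z n)"
    and "\<And>y c. y \<in> lp_space p \<Longrightarrow> T (\<lambda>n. c *\<^sub>R y n) = (\<lambda>n. c *\<^sub>R T y n)"
  shows "lp_op p T C"
  using assms by (simp add: lp_op_def)

lemma lp_op_le: "lp_op p T C \<Longrightarrow> lp_le p y K \<Longrightarrow> lp_le p (T y) (C * K)"
  by (simp add: lp_op_def)

lemma lp_op_nonneg: "lp_op p T C \<Longrightarrow> 0 \<le> C"
  by (simp add: lp_op_def)

lemma lp_op_add: "lp_op p T C \<Longrightarrow> y \<in> lp_space p \<Longrightarrow> z \<in> lp_space p \<Longrightarrow> T (\<lambda>n. y n + z n) = (\<lambda>n. T y n + T z n)"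
  by (simp add: lp_op_def)

lemma lp_op_scaleR: "lp_op p T C \<Longrightarrow> y \<in> lp_space p \<Longrightarrow> T (\<lambda>n. c *\<^sub>R y n) = (\<lambda>n. c *\<^sub>R T y n)"
  by (simp add: lp_op_def)

lemma lp_op_mem: "lp_op p T C \<Longrightarrow> 1 \<le> p \<Longrightarrow> y \<in> lp_space p \<Longrightarrow> T y \<in> lp_space p"
  by (meson mem_lp_space_iff lp_op_le)

lemma lp_op_diff:
  assumes "lp_op p T C" "1 \<le> p" "y \<in> lp_space p" "z \<in> lp_space p"
  shows "T (\<lambda>n. y n - z n) = (\<lambda>n. T y n - T z n)"
  using lp_op_add[OF assms(1,3) lp_space_scaleR[OF assms(2,4), of "-1"]] lp_op_scaleR[OF assms(1,4), of "-1"]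
  by simp

lemma lp_op_zero: "lp_op p T C \<Longrightarrow> 1 \<le> p \<Longrightarrow> T (\<lambda>n. 0) = (\<lambda>n. 0)"
  using lp_op_scaleR[OF _ lp_space_zero, of p T C 0] by simp

lemma lp_op_sum:
  assumes "lp_op p T C" "1 \<le> p" "finite I" "\<And>i. i \<in> I \<Longrightarrow> Y i \<in> lp_space p"
  shows "T (\<lambda>n. \<Sum>i\<in>I. Y i n) = (\<lambda>n. \<Sum>i\<in>I. T (Y i) n)"
  using assms(3,4)
  by (induction rule: finite_induct)
     (auto simp: lp_op_zero[OF assms(1,2)] lp_op_add[OF assms(1)] lp_space_sum assms(2))

lemma lp_op_bounded_linear:
  assumes "lp_op p T C" "1 \<le> p"
  shows "lp_bounded_linear p T"
proof -
  have "lp_norm p (T y) \<le> C * lp_norm p y" if "y \<in> lp_space p" for y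
    using lp_op_le[OF assms(1) lp_leI[OF assms(2) that]] lp_le_iff[OF assms(2)] by blast
  then show ?thesis
    using assms lp_op_mem[OF assms] by (auto simp: lp_bounded_linear_def lp_op_def)
qed

lemma lp_bounded_linear_op:
  fixes T :: "(nat \<Rightarrow> 'b::real_normed_vector) \<Rightarrow> (nat \<Rightarrow> 'b)"
  assumes "lp_bounded_linear p T" "1 \<le> p"
  obtains C where "lp_op p T C"
proof -
  obtain K0 where K0: "\<And>y. y \<in> lp_space p \<Longrightarrow> lp_norm p (T y) \<le> K0 * lp_norm p y"
    using assms(1) unfolding lp_bounded_linear_def by blast
  have "lp_op p T (max K0 0)"
  proof (rule lp_opI)
    fix y :: "nat \<Rightarrow> 'b" and K assume y: "lp_le p y K"
    then have m: "y \<in> lp_space p" "lp_norm p y \<le> K" using lp_le_iff[OF assms(2)] by auto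
    have "lp_norm p (T y) \<le> max K0 0 * lp_norm p y"
      using K0[OF m(1)] lp_norm_nonneg[OF assms(2) m(1)] by (meson max.cobounded1 mult_right_mono order_trans)
    also have "\<dots> \<le> max K0 0 * K" using m(2) by (intro mult_left_mono) auto
    finally show "lp_le p (T y) (max K0 0 * K)"
      using lp_le_iff[OF assms(2)] m(1) assms(1) by (auto simp: lp_bounded_linear_def)
  qed (use assms(1) in \<open>auto simp: lp_bounded_linear_def\<close>)
  then show ?thesis using that by blast
qed

lemma lp_opnorm_bounds:
  assumes "lp_op p T C" "1 \<le> p"
  shows "0 \<le> lp_opnorm p T" "lp_opnorm p T \<le> C"
proof -
  have *: "lp_norm p (T y) \<le> C" if "y \<in> lp_space p" "lp_norm p y \<le> 1" for y
    using lp_op_le[OF assms(1), of y 1] lp_le_iff[OF assms(2)] that by auto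
  have z: "lp_norm p (T (\<lambda>n. 0)) \<in> {lp_norm p (T y) | y. y \<in> lp_space p \<and> lp_norm p y \<le> 1}"
    using lp_space_zero[OF assms(2)] lp_le_zero[OF assms(2), of 1] lp_le_iff[OF assms(2)] by auto
  show "lp_opnorm p T \<le> C" unfolding lp_opnorm_def
    using z * by (intro cSup_least) auto
  have "0 \<le> lp_norm p (T (\<lambda>n. 0))"
    by (intro lp_norm_nonneg lp_op_mem[OF assms(1)] lp_space_zero assms(2))
  also have "\<dots> \<le> lp_opnorm p T" unfolding lp_opnorm_def
    using * by (intro cSup_upper[OF z] bdd_aboveI[of _ C]) auto
  finally show "0 \<le> lp_opnorm p T" .
qed

lemma lp_op_compose:
  assumes "lp_op p S C" "lp_op p T D" "1 \<le> p"
  shows "lp_op p (\<lambda>y. S (T y)) (C * D)"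
proof (rule lp_opI)
  show "lp_le p (S (T y)) (C * D * K)" if "lp_le p y K" for y K
    using lp_op_le[OF assms(1) lp_op_le[OF assms(2) that]] by (simp add: mult.assoc)
qed (use assms lp_op_mem[OF assms(2,3)] in
      \<open>auto simp: lp_op_nonneg lp_op_add[OF assms(1)] lp_op_add[OF assms(2)] lp_op_scaleR[OF assms(1)] lp_op_scaleR[OF assms(2)]\<close>)

lemma lp_op_id: "1 \<le> p \<Longrightarrow> lp_op p (\<lambda>y. y) 1"
  by (rule lp_opI) auto

lemma lp_op_minus:
  assumes "lp_op p S C" "lp_op p T D" "1 \<le> p"
  shows "lp_op p (\<lambda>y n. S y n - T y n) (C + D)"
proof (rule lp_opI)
  show "lp_le p (\<lambda>n. S y n - T y n) ((C + D) * K)" if "lp_le p y K" for y K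
    using lp_le_diff[OF lp_op_le[OF assms(1) that] lp_op_le[OF assms(2) that] assms(3)]
    by (simp add: distrib_right)
qed (use assms in
      \<open>auto simp: lp_op_nonneg lp_op_add[OF assms(1)] lp_op_add[OF assms(2)] lp_op_scaleR[OF assms(1)] lp_op_scaleR[OF assms(2)]
         scaleR_diff_right\<close>)

text \<open>Neumann series with terms \<open>(-1)^m R^m\<close>, summed in each coordinate, where
  completeness of \<open>'b\<close> applies; the constant 2 is the sum of the powers of
  \<open>1/2\<close>. A left inverse is enough, because it is only composed on the left.\<close>

lemma lp_left_inverse_near_id:
  fixes R :: "(nat \<Rightarrow> 'b::banach) \<Rightarrow> (nat \<Rightarrow> 'b)"
  assumes R: "lp_op p R (1/2)" and p: "1 \<le> p"
  obtains V where "lp_op p V 2" "\<And>y. y \<in> lp_space p \<Longrightarrow> V (\<lambda>n. y n + R y n) = y"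
proof -
  have pow: "lp_op p (R ^^ m) ((1/2)^m)" for m
  proof (induction m)
    case (Suc m)
    then show ?case using lp_op_compose[OF R Suc p] by (simp add: comp_def)
  qed (use lp_op_id[OF p] in \<open>simp add: id_def\<close>)
  define V where "V y n = (\<Sum>m. (-1)^m *\<^sub>R (R ^^ m) y n)" for y n
  have bnd: "norm ((-1)^m *\<^sub>R (R ^^ m) y n) \<le> (1/2)^m * K" if "lp_le p y K" for y K m n
    using lp_le_coord[OF lp_op_le[OF pow that] p, of m n] by simp
  have summ: "summable (\<lambda>m. (-1)^m *\<^sub>R (R ^^ m) y n)" if y: "y \<in> lp_space p" for y n
  proof -
    obtain K where K: "lp_le p y K" using y p mem_lp_space_iff by blast
    have "summable (\<lambda>m. (1/2)^m * K)" by (rule summable_mult2[OF summable_geometric]) simp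
    then show ?thesis by (rule summable_comparison_test'[where N = 0]) (rule bnd[OF K])
  qed
  have V: "lp_op p V 2"
  proof (rule lp_opI)
    fix y :: "nat \<Rightarrow> 'b" and K assume y: "lp_le p y K"
    show "lp_le p (V y) (2 * K)"
    proof (rule lp_le_Fatou[OF p, where Y = "\<lambda>M n. \<Sum>m<M. (-1::real)^m *\<^sub>R (R ^^ m) y n"])
      show "(\<lambda>M. \<Sum>m<M. (-1)^m *\<^sub>R (R ^^ m) y n) \<longlonglongrightarrow> V y n" for n
        unfolding V_def by (rule summable_LIMSEQ[OF summ[OF lp_space_memI[OF p y]]])
      fix M
      have "lp_le p (\<lambda>n. (-1)^m *\<^sub>R (R ^^ m) y n) ((1/2)^m * K)" for m
        using lp_le_scaleR[OF lp_op_le[OF pow[of m] y] p, of "(-1)^m"] by simp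
      then have "lp_le p (\<lambda>n. \<Sum>m<M. (-1)^m *\<^sub>R (R ^^ m) y n) (\<Sum>m<M. (1/2)^m * K)"
        by (intro lp_le_sum p) auto
      moreover have "(\<Sum>m<M. (1/2)^m * K) \<le> 2 * K"
        using lp_le_nonneg[OF y] sum_le_suminf[of "\<lambda>m. (1/2::real)^m" "{..<M}"]
        by (auto simp: suminf_geometric simp flip: sum_distrib_right intro!: mult_right_mono)
      ultimately show "lp_le p (\<lambda>n. \<Sum>m<M. (-1)^m *\<^sub>R (R ^^ m) y n) (2 * K)" using lp_le_mono p by blast
    qed
  next
    fix y z :: "nat \<Rightarrow> 'b" assume yz: "y \<in> lp_space p" "z \<in> lp_space p"
    show "V (\<lambda>n. y n + z n) = (\<lambda>n. V y n + V z n)"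
      by (rule ext) (simp add: V_def lp_op_add[OF pow yz] suminf_add[OF summ summ] yz scaleR_add_right)
  next
    fix y :: "nat \<Rightarrow> 'b" and c assume y: "y \<in> lp_space p"
    show "V (\<lambda>n. c *\<^sub>R y n) = (\<lambda>n. c *\<^sub>R V y n)"
    proof
      fix n
      have "V (\<lambda>n. c *\<^sub>R y n) n = (\<Sum>m. c *\<^sub>R ((-1)^m *\<^sub>R (R ^^ m) y n))"
        by (simp add: V_def lp_op_scaleR[OF pow y] mult.commute)
      then show "V (\<lambda>n. c *\<^sub>R y n) n = c *\<^sub>R V y n"
        by (simp add: V_def suminf_scaleR_right[OF summ[OF y]])
    qed
  qed simp
  have "V (\<lambda>n. y n + R y n) = y" if y: "y \<in> lp_space p" for y
  proof
    fix n
    let ?a = "\<lambda>m. (-1)^m *\<^sub>R (R ^^ m) y n"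
    \<comment> \<open>Expanding \<open>R ^^ m\<close> on the sum turns the series into a telescoping
      one, of which only the term \<open>y n\<close> survives.\<close>
    have "V (\<lambda>n. y n + R y n) n = (\<Sum>m. ?a m - ?a (Suc m))"
      unfolding V_def
      by (simp add: lp_op_add[OF pow y lp_op_mem[OF R p y]] funpow_swap1 scaleR_add_right)
    also have "\<dots> = ?a 0 - 0"
      using summable_LIMSEQ_zero[OF summ[OF y], of n]
      by (intro sums_unique[symmetric] telescope_sums') auto
    finally show "V (\<lambda>n. y n + R y n) n = y n" by simp
  qed
  then show ?thesis using that V by blast
qed

section \<open>Functionals and their behaviour on far-out rows\<close>

definition lp_functional :: "ereal \<Rightarrow> ((nat \<Rightarrow> 'b::real_normed_vector) \<Rightarrow> real) \<Rightarrow> real \<Rightarrow> bool" where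
  "lp_functional p \<phi> C \<longleftrightarrow> 0 \<le> C \<and>
     (\<forall>y K. lp_le p y K \<longrightarrow> \<bar>\<phi> y\<bar> \<le> C * K) \<and>
     (\<forall>y\<in>lp_space p. \<forall>z\<in>lp_space p. \<phi> (\<lambda>n. y n + z n) = \<phi> y + \<phi> z) \<and>
     (\<forall>y\<in>lp_space p. \<forall>c. \<phi> (\<lambda>n. c *\<^sub>R y n) = c * \<phi> y)"

lemma lp_functional_bound: "lp_functional p \<phi> C \<Longrightarrow> lp_le p y K \<Longrightarrow> \<bar>\<phi> y\<bar> \<le> C * K"
  by (simp add: lp_functional_def)

lemma lp_functional_add:
  "lp_functional p \<phi> C \<Longrightarrow> y \<in> lp_space p \<Longrightarrow> z \<in> lp_space p \<Longrightarrow> \<phi> (\<lambda>n. y n + z n) = \<phi> y + \<phi> z"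
  by (simp add: lp_functional_def)

lemma lp_functional_scaleR:
  "lp_functional p \<phi> C \<Longrightarrow> y \<in> lp_space p \<Longrightarrow> \<phi> (\<lambda>n. c *\<^sub>R y n) = c * \<phi> y"
  by (simp add: lp_functional_def)

lemma lp_functional_sum:
  assumes "lp_functional p \<phi> C" "1 \<le> p" "finite I" "\<And>i. i \<in> I \<Longrightarrow> Y i \<in> lp_space p"
  shows "\<phi> (\<lambda>n. \<Sum>i\<in>I. Y i n) = (\<Sum>i\<in>I. \<phi> (Y i))"
proof -
  have z: "\<phi> (\<lambda>n. 0) = 0"
  proof -
    have "\<phi> (\<lambda>n. 0 *\<^sub>R 0) = 0 * \<phi> (\<lambda>n. 0)"
      by (rule lp_functional_scaleR[OF assms(1) lp_space_zero[OF assms(2)]])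
    then show ?thesis by simp
  qed
  show ?thesis using assms(3,4)
  proof (induction rule: finite_induct)
    case (insert i I)
    then have "\<phi> (\<lambda>n. Y i n + (\<Sum>i\<in>I. Y i n)) = \<phi> (Y i) + \<phi> (\<lambda>n. \<Sum>i\<in>I. Y i n)"
      using assms(1) lp_space_sum[OF assms(2) insert(1), of Y] by (simp add: lp_functional_def)
    with insert show ?case by simp
  qed (use z in simp)
qed

text \<open>In \<open>\<ell>\<^sup>\<infinity>\<close> a sum of unit vectors with disjoint supports has norm at most one.\<close>

lemma functional_small_on_some_block:
  fixes \<phi> :: "(nat \<Rightarrow> 'b::real_normed_vector) \<Rightarrow> real"
  assumes \<phi>: "lp_functional \<infinity> \<phi> C" and I: "infinite (I::nat set)" and \<eta>: "0 < \<eta>"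
  shows "\<exists>B\<subseteq>I. infinite B \<and> (\<forall>y. lp_le \<infinity> y 1 \<longrightarrow> (\<forall>n. n \<notin> B \<longrightarrow> y n = 0) \<longrightarrow> \<bar>\<phi> y\<bar> \<le> \<eta>)"
proof (rule ccontr)
  assume contra: "\<not> ?thesis"
  \<comment> \<open>\<open>I\<close> is cut into infinitely many disjoint infinite blocks, the rows
    of a square array laid over its enumeration.\<close>
  define B where "B j = enumerate I ` (\<lambda>l. prod_encode (j, l)) ` (UNIV::nat set)" for j :: nat
  have inj: "inj (enumerate I)" using I by (simp add: strict_mono_enumerate strict_mono_imp_inj_on)
  have B: "B j \<subseteq> I" "infinite (B j)" for j
    unfolding B_def using enumerate_in_set[OF I] inj
    by (auto simp: image_image prod_encode_eq inj_eq intro!: range_inj_infinite injI)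
  have disj: "B i \<inter> B j = {}" if "i \<noteq> j" for i j
    unfolding B_def using that inj by (auto simp: prod_encode_eq inj_eq)
  have "\<exists>y. lp_le \<infinity> y 1 \<and> (\<forall>n. n \<notin> B j \<longrightarrow> y n = 0) \<and> \<phi> y > \<eta>" for j
  proof -
    obtain y where y: "lp_le \<infinity> y 1" "\<forall>n. n \<notin> B j \<longrightarrow> y n = 0" "\<bar>\<phi> y\<bar> > \<eta>"
      using contra B[of j] by (meson not_le)
    have m: "y \<in> lp_space \<infinity>" by (rule lp_space_memI[OF _ y(1)]) simp
    have "\<phi> (\<lambda>n. (-1) *\<^sub>R y n) = -1 * \<phi> y" by (rule lp_functional_scaleR[OF \<phi> m])
    moreover have "lp_le \<infinity> (\<lambda>n. (-1) *\<^sub>R y n) 1" using y(1) by (simp add: lp_le_def)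
    ultimately show ?thesis using y
      by (cases "\<phi> y > \<eta>") (auto intro: exI[of _ y] exI[of _ "\<lambda>n. (-1) *\<^sub>R y n"])
  qed
  then obtain Y where Y: "\<And>j. lp_le \<infinity> (Y j) 1" "\<And>j n. n \<notin> B j \<Longrightarrow> Y j n = 0" "\<And>j. \<phi> (Y j) > \<eta>"
    by metis
  \<comment> \<open>\<open>J\<close> vectors from different blocks add up to a vector of norm at
    most 1 with value at least \<open>J * \<eta>\<close>, more than the bound \<open>C\<close>
    allows.\<close>
  obtain J :: nat where J: "C < real J * \<eta>" using \<eta> reals_Archimedean3 by blast
  have "norm (\<Sum>j<J. Y j n) \<le> 1" for n
  proof (cases "\<exists>j<J. n \<in> B j")
    case True
    then obtain j where j: "j < J" "n \<in> B j" by blast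
    have "(\<Sum>j<J. Y j n) = (\<Sum>j\<in>{j}. Y j n)"
      using j disj Y(2) by (intro sum.mono_neutral_right) blast+
    then show ?thesis using Y(1)[of j] by (simp add: lp_le_def)
  qed (use Y(2) in auto)
  then have "lp_le \<infinity> (\<lambda>n. \<Sum>j<J. Y j n) 1" by (simp add: lp_le_def)
  then have "\<bar>\<phi> (\<lambda>n. \<Sum>j<J. Y j n)\<bar> \<le> C" using \<phi> by (force simp: lp_functional_def)
  moreover have "\<phi> (\<lambda>n. \<Sum>j<J. Y j n) = (\<Sum>j<J. \<phi> (Y j))"
    by (intro lp_functional_sum[OF \<phi>] lp_space_memI[OF _ Y(1)]) auto
  moreover have "(\<Sum>j<J. \<phi> (Y j)) \<ge> (\<Sum>j<J. \<eta>)" using Y(3) by (intro sum_mono less_imp_le)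
  ultimately show False using J by simp
qed

text \<open>A bounded functional on \<open>\<ell>\<^sup>\<infinity>\<close> may live at infinity,
  like a Banach limit, and ignore every single row. Thinning out the rows removes this effect for
  countably many functionals; for finite \<open>p\<close> tails go to 0 in norm and no row is
  discarded.\<close>

lemma rows_with_vanishing_tails:
  fixes \<phi> :: "nat \<Rightarrow> (nat \<Rightarrow> 'b::real_normed_vector) \<Rightarrow> real"
  assumes \<phi>: "\<And>q. lp_functional p (\<phi> q) (C q)" and p: "1 \<le> p" and I: "infinite (I::nat set)"
  obtains I' where "I' \<subseteq> I" "infinite I'"
    "\<And>q y. y \<in> lp_space p \<Longrightarrow> (\<And>n. n \<notin> I' \<Longrightarrow> y n = 0) \<Longrightarrow>
        (\<lambda>m. \<phi> q (\<lambda>n. if m \<le> n then y n else 0)) \<longlonglongrightarrow> 0"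
proof (cases "p = \<infinity>")
  case False
  have "(\<lambda>m. \<phi> q (\<lambda>n. if m \<le> n then y n else 0)) \<longlonglongrightarrow> 0" if y: "y \<in> lp_space p" for q y
  proof (rule LIMSEQ_I)
    fix e :: real assume e: "0 < e"
    obtain K where K: "lp_le p y K" using y p mem_lp_space_iff by blast
    have C: "0 \<le> C q" using \<phi> by (simp add: lp_functional_def)
    have e': "0 < e / (C q + 1)" using C e by simp
    obtain N where N: "\<And>m'. N \<le> m' \<Longrightarrow> lp_le p (\<lambda>n. if m' \<le> n then y n else 0) (e / (C q + 1))"
      using lp_le_tail_0[OF K p False e'] by metis
    have "\<bar>\<phi> q (\<lambda>n. if m \<le> n then y n else 0)\<bar> < e" if "N \<le> m" for m
    proof -
      have "\<bar>\<phi> q (\<lambda>n. if m \<le> n then y n else 0)\<bar> \<le> C q * (e / (C q + 1))"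
        by (rule lp_functional_bound[OF \<phi> N[OF that]])
      also have "\<dots> < e" using C e by (simp add: field_simps)
      finally show ?thesis .
    qed
    then show "\<exists>N. \<forall>m\<ge>N. norm (\<phi> q (\<lambda>n. if m \<le> n then y n else 0) - 0) < e" by auto
  qed
  then show ?thesis using that[of I] I by auto
next
  case True
  \<comment> \<open>An index \<open>t\<close> codes a functional together with a tolerance, so one
    diagonal argument serves all pairs.\<close>
  define R where "R t B \<longleftrightarrow> (\<forall>y. lp_le p y 1 \<longrightarrow> (\<forall>n. n \<notin> B \<longrightarrow> y n = 0) \<longrightarrow>
     \<bar>\<phi> (fst (prod_decode t)) y\<bar> \<le> 1 / (1 + real (snd (prod_decode t))))" for t B
  obtain I' where I': "I' \<subseteq> I" "infinite I'" "\<And>t. \<exists>m. R t (I' \<inter> {m..})"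
  proof (rule pseudo_intersection[of R I])
    show "R t B" if "R t A" "B \<subseteq> A" for t A B using that unfolding R_def by blast
    show "\<exists>B\<subseteq>A. infinite B \<and> R t B" if "infinite A" for t A
      using functional_small_on_some_block[of "\<phi> (fst (prod_decode t))" _ A "1 / (1 + real (snd (prod_decode t)))"]
        \<phi> that True unfolding R_def by force
  qed (use I in auto)
  have "(\<lambda>m. \<phi> q (\<lambda>n. if m \<le> n then y n else 0)) \<longlonglongrightarrow> 0"
    if y: "y \<in> lp_space p" "\<And>n. n \<notin> I' \<Longrightarrow> y n = 0" for q y
  proof (rule LIMSEQ_I)
    fix e :: real assume e: "0 < e"
    obtain K0 where "lp_le p y K0" using y p mem_lp_space_iff by blast
    then have K: "lp_le p y (K0 + 1)" "0 < K0 + 1" using lp_le_mono[OF _ _ p] lp_le_nonneg by fastforce+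
    define K where "K = K0 + 1"
    obtain j :: nat where j: "K / e < j" using reals_Archimedean2 by blast
    obtain N where N: "R (prod_encode (q, j)) (I' \<inter> {N..})" using I'(3) by blast
    have "\<bar>\<phi> q (\<lambda>n. if m \<le> n then y n else 0)\<bar> < e" if "N \<le> m" for m
    proof -
      define z where "z = (\<lambda>n. if m \<le> n then y n else 0)"
      have zK: "lp_le p z K" unfolding z_def K_def using lp_le_mono_norm[OF K(1) p, of "\<lambda>n. if m \<le> n then y n else 0"] by simp
      have "lp_le p (\<lambda>n. (1/K) *\<^sub>R z n) 1"
        using lp_le_scaleR[OF zK p, of "1/K"] K(2) by (simp add: K_def)
      then have "\<bar>\<phi> q (\<lambda>n. (1/K) *\<^sub>R z n)\<bar> \<le> 1 / (1 + real j)"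
        using N y(2) \<open>N \<le> m\<close> unfolding R_def by (simp add: z_def) 
      moreover have "\<phi> q (\<lambda>n. (1/K) *\<^sub>R z n) = (1/K) * \<phi> q z"
        by (rule lp_functional_scaleR[OF \<phi> lp_space_memI[OF p zK]])
      ultimately have "\<bar>\<phi> q z\<bar> / K \<le> 1 / (1 + real j)" using K(2) by (simp add: K_def abs_mult)
      then have "\<bar>\<phi> q z\<bar> \<le> K / (1 + real j)" using K(2) by (simp add: K_def field_simps)
      also have "\<dots> < e" using j e K(2) by (simp add: K_def field_simps)
      finally show ?thesis by (simp add: z_def)
    qed
    then show "\<exists>N. \<forall>m\<ge>N. norm (\<phi> q (\<lambda>n. if m \<le> n then y n else 0) - 0) < e" by auto
  qed
  then show ?thesis using that I' by blast
qed

section \<open>Subsymmetric weak* bases\<close>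

lemma eventually_mem_openin_topology_generated_by:
  assumes "openin (topology_generated_by B) U" "z \<in> U"
    and "\<And>b. b \<in> B \<Longrightarrow> z \<in> b \<Longrightarrow> \<forall>\<^sub>F n in F. x n \<in> b"
  shows "\<forall>\<^sub>F n in F. x n \<in> U"
proof -
  have "generate_topology_on B U" using assms(1) by (simp add: openin_topology_generated_by_iff)
  then show ?thesis using assms(2)
  proof (induction rule: generate_topology_on.induct)
    case (Int a b)
    then show ?case by (auto intro: eventually_conj)
  next
    case (UN K)
    then obtain k where "k \<in> K" "z \<in> k" by blast
    then show ?case using UN by (blast intro: eventually_mono)
  qed (use assms(3) in auto)
qed

text \<open>Eventual membership has to be checked on the subbasis only. Subsymmetry speaks of a
  topological closure while expansions give sequential limits; this connects the two.\<close>

lemma wstar_limit_in_closure: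
  assumes "\<And>n. x n \<in> A" "\<And>u. (\<lambda>n. blinfun_apply (x n) u) \<longlonglongrightarrow> blinfun_apply z u"
  shows "z \<in> wstar_topology closure_of A"
  unfolding in_closure_of
proof (intro conjI allI impI)
  have "z \<in> {f. blinfun_apply f 0 \<in> UNIV}" by simp
  then show "z \<in> topspace wstar_topology"
    unfolding wstar_topology_def topology_generated_by_topspace by blast
  fix T assume T: "z \<in> T \<and> openin wstar_topology T"
  have "\<forall>\<^sub>F n in sequentially. x n \<in> T"
  proof (rule eventually_mem_openin_topology_generated_by)
    fix b assume "b \<in> {{f. blinfun_apply f u \<in> U} | u U. open U}" "z \<in> b"
    then obtain u U where "b = {f. blinfun_apply f u \<in> U}" "open U" "blinfun_apply z u \<in> U" by blast
    then show "\<forall>\<^sub>F n in sequentially. x n \<in> b"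
      using topological_tendstoD[OF assms(2)] by auto
  qed (use T in \<open>auto simp: wstar_topology_def\<close>)
  then obtain n where "x n \<in> T" by (auto simp: eventually_sequentially)
  then show "\<exists>y. y \<in> A \<and> y \<in> T" using assms(1) by blast
qed

text \<open>\<open>Cu\<close> and \<open>Cs\<close> are arbitrary admissible constants instead of
  the infima \<open>Ku\<close> and \<open>Ks\<close>, so attainment of the infima never has to be
  discussed.\<close>

locale subsymmetric_wstar_basis =
  fixes s :: "nat \<Rightarrow> 'a::banach" and e :: "nat \<Rightarrow> ('a \<Rightarrow>\<^sub>L real)" and Cu Cs :: real
  assumes biorth: "biorthogonal s e"
    and s_norm: "\<And>j. norm (s j) = 1"
    and e_norm: "\<And>j. norm (e j) = 1"
    and wbasis: "wstar_schauder_basis s e"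
    and uncond: "uncond_const e Cu"
    and subsym: "subsym_const e Cs"
begin

lemma e_s: "blinfun_apply (e j) (s i) = (if i = j then 1 else 0)"
  using biorth by (simp add: biorthogonal_def)

lemma Cu_ge_1: "1 \<le> Cu"
  using uncond by (simp add: uncond_const_def)

lemma wstar_sums_coords: "wstar_sums e (\<lambda>j. blinfun_apply y (s j)) y"
  using wbasis by (simp add: wstar_schauder_basis_def)

lemma wstar_sums_coord:
  assumes "wstar_sums e a y"
  shows "blinfun_apply y (s j) = a j"
proof -
  have "(\<Sum>i<n. a i * blinfun_apply (e i) (s j)) = a j" if "j < n" for n
    using that by (simp add: e_s if_distrib[of "(*) _"] sum.delta' cong: if_cong)
  then have "(\<lambda>n. \<Sum>i<n. a i * blinfun_apply (e i) (s j)) \<longlonglongrightarrow> a j"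
    by (intro tendsto_eventually eventually_sequentiallyI[of "Suc j"]) auto
  then show ?thesis using assms LIMSEQ_unique unfolding wstar_sums_def by blast
qed

text \<open>A functional is the weak* limit of its expansion, so its values on the
  \<open>s j\<close> determine it. Identities in the dual are checked this way, coordinate by
  coordinate.\<close>

lemma coord_eqI:
  fixes y z :: "'a \<Rightarrow>\<^sub>L real"
  assumes "\<And>j. blinfun_apply y (s j) = blinfun_apply z (s j)"
  shows "y = z"
proof (rule blinfun_eqI)
  fix u
  show "blinfun_apply y u = blinfun_apply z u"
  proof (rule LIMSEQ_unique)
    show "(\<lambda>n. \<Sum>j<n. blinfun_apply y (s j) * blinfun_apply (e j) u) \<longlonglongrightarrow> blinfun_apply y u"
      using wstar_sums_coords[of y] by (simp add: wstar_sums_def)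
    show "(\<lambda>n. \<Sum>j<n. blinfun_apply y (s j) * blinfun_apply (e j) u) \<longlonglongrightarrow> blinfun_apply z u"
      using wstar_sums_coords[of z] by (simp add: wstar_sums_def assms)
  qed
qed

lemma wstar_sums_iff: "wstar_sums e a y \<longleftrightarrow> (\<forall>j. blinfun_apply y (s j) = a j)"
  using wstar_sums_coord wstar_sums_coords[of y] by (metis ext)

lemma coord_le_norm: "\<bar>blinfun_apply y (s j)\<bar> \<le> norm y"
  using norm_blinfun[of y "s j"] s_norm by simp

text \<open>Every \<open>e j\<close> has norm 1, so the \<open>\<ell>\<^sup>1\<close> norm of the
  coordinates dominates the dual norm. This is crude, but the errors it is applied to decay
  geometrically.\<close>

lemma norm_le_sum_coords:
  fixes y :: "'a \<Rightarrow>\<^sub>L real"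
  assumes "\<And>m. (\<Sum>j<m. \<bar>blinfun_apply y (s j)\<bar>) \<le> B"
  shows "norm y \<le> B"
proof (rule norm_blinfun_bound)
  show "0 \<le> B" using assms[of 0] by simp
  fix u
  show "norm (blinfun_apply y u) \<le> B * norm u"
  proof (rule tendsto_upperbound[OF tendsto_norm])
    show "(\<lambda>n. \<Sum>j<n. blinfun_apply y (s j) * blinfun_apply (e j) u) \<longlonglongrightarrow> blinfun_apply y u"
      using wstar_sums_coords[of y] by (simp add: wstar_sums_def)
    show "\<forall>\<^sub>F n in sequentially. norm (\<Sum>j<n. blinfun_apply y (s j) * blinfun_apply (e j) u) \<le> B * norm u"
    proof (intro always_eventually allI)
      fix n
      have "norm (\<Sum>j<n. blinfun_apply y (s j) * blinfun_apply (e j) u)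
          \<le> (\<Sum>j<n. \<bar>blinfun_apply y (s j)\<bar> * norm u)"
      proof (rule sum_norm_le)
        fix j
        have "\<bar>blinfun_apply (e j) u\<bar> \<le> norm u" using norm_blinfun[of "e j" u] e_norm by simp
        then show "norm (blinfun_apply y (s j) * blinfun_apply (e j) u) \<le> \<bar>blinfun_apply y (s j)\<bar> * norm u"
          by (simp add: abs_mult mult_left_mono)
      qed
      also have "\<dots> \<le> B * norm u" using assms by (simp add: mult_right_mono flip: sum_distrib_right)
      finally show "norm (\<Sum>j<n. blinfun_apply y (s j) * blinfun_apply (e j) u) \<le> B * norm u" .
    qed
  qed simp
qed

text \<open>Not every sequence consists of coordinates; each use rests on a functional supplied by
  unconditionality or subsymmetry.\<close>

definition from_coords :: "(nat \<Rightarrow> real) \<Rightarrow> ('a \<Rightarrow>\<^sub>L real)" where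
  "from_coords a = (THE y. \<forall>j. blinfun_apply y (s j) = a j)"

lemma from_coords_eq: "(\<And>j. blinfun_apply y (s j) = a j) \<Longrightarrow> from_coords a = y"
  unfolding from_coords_def by (rule the_equality) (auto intro: coord_eqI)

definition diag :: "(nat \<Rightarrow> real) \<Rightarrow> ('a \<Rightarrow>\<^sub>L real) \<Rightarrow> ('a \<Rightarrow>\<^sub>L real)" where
  "diag \<gamma> y = from_coords (\<lambda>j. \<gamma> j * blinfun_apply y (s j))"

lemma diag:
  assumes "\<And>j. \<bar>\<gamma> j\<bar> \<le> c"
  shows diag_coord: "blinfun_apply (diag \<gamma> y) (s j) = \<gamma> j * blinfun_apply y (s j)"
    and norm_diag: "norm (diag \<gamma> y) \<le> Cu * c * norm y"
proof -
  have "bounded (range \<gamma>)" using assms by (auto simp: bounded_iff)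
  then obtain z where z: "wstar_sums e (\<lambda>j. \<gamma> j * blinfun_apply y (s j)) z"
      "norm z \<le> Cu * (SUP j. \<bar>\<gamma> j\<bar>) * norm y"
    using uncond wstar_sums_coords[of y] unfolding uncond_const_def by blast
  have zc: "blinfun_apply z (s j) = \<gamma> j * blinfun_apply y (s j)" for j
    using wstar_sums_coord[OF z(1)] .
  then have d: "diag \<gamma> y = z" unfolding diag_def by (rule from_coords_eq)
  then show "blinfun_apply (diag \<gamma> y) (s j) = \<gamma> j * blinfun_apply y (s j)" using zc by simp
  have "(SUP j. \<bar>\<gamma> j\<bar>) \<le> c" using assms by (intro cSUP_least) auto
  then have "Cu * (SUP j. \<bar>\<gamma> j\<bar>) * norm y \<le> Cu * c * norm y"
    using Cu_ge_1 by (intro mult_right_mono mult_left_mono) auto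
  then show "norm (diag \<gamma> y) \<le> Cu * c * norm y" using z(2) d by simp
qed

definition res :: "nat set \<Rightarrow> ('a \<Rightarrow>\<^sub>L real) \<Rightarrow> ('a \<Rightarrow>\<^sub>L real)" where
  "res A = diag (\<lambda>j. if j \<in> A then 1 else 0)"

lemma res_coord: "blinfun_apply (res A y) (s j) = (if j \<in> A then blinfun_apply y (s j) else 0)"
  unfolding res_def by (subst diag_coord[where c = 1]) auto

lemma norm_res: "norm (res A y) \<le> Cu * norm y"
  unfolding res_def by (rule order_trans[OF norm_diag[where c = 1]]) auto

lemma coord_proj_eq_res: "coord_proj s e A y = res A y"
  unfolding coord_proj_def wstar_sums_iff
  by (rule the_equality) (auto simp: res_coord intro: coord_eqI)

definition spr :: "(nat \<Rightarrow> nat) \<Rightarrow> ('a \<Rightarrow>\<^sub>L real) \<Rightarrow> ('a \<Rightarrow>\<^sub>L real)" where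
  "spr n y = from_coords (spread n (\<lambda>j. blinfun_apply y (s j)))"

lemma spr:
  assumes "strict_mono n"
  shows spr_coord: "blinfun_apply (spr n y) (s (n j)) = blinfun_apply y (s j)"
    and spr_coord_outside: "i \<notin> range n \<Longrightarrow> blinfun_apply (spr n y) (s i) = 0"
    and norm_spr: "norm (spr n y) \<le> Cs * norm y"
proof -
  obtain z where z: "wstar_sums e (spread n (\<lambda>j. blinfun_apply y (s j))) z" "norm z \<le> Cs * norm y"
    using subsym assms wstar_sums_coords[of y] unfolding subsym_const_def by blast
  have "blinfun_apply z (s j) = spread n (\<lambda>j. blinfun_apply y (s j)) j" for j
    using wstar_sums_coord[OF z(1)] .
  moreover from this have "spr n y = z" unfolding spr_def by (rule from_coords_eq)
  ultimately show "blinfun_apply (spr n y) (s (n j)) = blinfun_apply y (s j)"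
    "i \<notin> range n \<Longrightarrow> blinfun_apply (spr n y) (s i) = 0" "norm (spr n y) \<le> Cs * norm y"
    using z(2) strict_mono_imp_inj_on[OF assms] by (auto simp: spread_def)
qed

text \<open>\<open>subsym_const\<close> imposes no lower bound by itself, but spreading along the
  identity fixes \<open>e 0\<close>.\<close>

lemma Cs_ge_1: "1 \<le> Cs"
proof -
  have "norm (spr id (e 0)) = norm (e 0)"
    by (rule arg_cong[where f = norm], rule coord_eqI) (use spr_coord[of id "e 0"] in \<open>simp add: strict_mono_def\<close>)
  then show ?thesis using norm_spr[of id "e 0"] e_norm by (simp add: strict_mono_def)
qed

text \<open>The inverse of spreading, preceded by the projection onto the coordinates in
  \<open>range n\<close>, so that it acts on the whole dual.\<close>

definition squeeze :: "(nat \<Rightarrow> nat) \<Rightarrow> ('a \<Rightarrow>\<^sub>L real) \<Rightarrow> ('a \<Rightarrow>\<^sub>L real)" where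
  "squeeze n y = from_coords (\<lambda>j. blinfun_apply y (s (n j)))"

text \<open>Subsymmetry inverts the spreading, at cost \<open>Cs\<close>, only on the weak* closed
  span. Projecting first costs \<open>Cu\<close>, and the partial sums of its expansion put the
  projected functional into that span.\<close>

lemma squeeze:
  assumes n: "strict_mono n"
  shows squeeze_coord: "blinfun_apply (squeeze n y) (s j) = blinfun_apply y (s (n j))"
    and norm_squeeze: "norm (squeeze n y) \<le> Cs * Cu * norm y"
proof -
  let ?z = "res (range n) y"
  have "?z \<in> wstar_closed_span (e ` range n)"
    unfolding wstar_closed_span_def
  proof (rule wstar_limit_in_closure)
    show "(\<Sum>j<m. blinfun_apply ?z (s j) *\<^sub>R e j) \<in> span (e ` range n)" for m
    proof (rule span_sum)
      fix j
      show "blinfun_apply ?z (s j) *\<^sub>R e j \<in> span (e ` range n)"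
      proof (cases "j \<in> range n")
        case True
        then show ?thesis by (intro span_scale span_base imageI)
      qed (simp add: res_coord span_zero)
    qed
    show "(\<lambda>m. blinfun_apply (\<Sum>j<m. blinfun_apply ?z (s j) *\<^sub>R e j) u) \<longlonglongrightarrow> blinfun_apply ?z u" for u
      using wstar_sums_coords[of ?z] unfolding wstar_sums_def
      by (simp add: blinfun.sum_left blinfun.scaleR_left)
  qed
  then obtain a w where w: "wstar_sums e a w" "wstar_sums e (spread n a) ?z" "norm w \<le> Cs * norm ?z"
    using subsym n unfolding subsym_const_def by blast
  have wc: "blinfun_apply w (s j) = blinfun_apply y (s (n j))" for j
    using wstar_sums_coord[OF w(1), of j] wstar_sums_coord[OF w(2), of "n j"] strict_mono_imp_inj_on[OF n]
    by (simp add: res_coord spread_def)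
  then have "squeeze n y = w" unfolding squeeze_def by (rule from_coords_eq)
  moreover have "Cs * norm ?z \<le> Cs * (Cu * norm y)" using Cs_ge_1 norm_res by (intro mult_left_mono) auto
  ultimately show "blinfun_apply (squeeze n y) (s j) = blinfun_apply y (s (n j))"
    "norm (squeeze n y) \<le> Cs * Cu * norm y" using wc w(3) by (auto simp: mult.assoc)
qed

text \<open>Suppose each set given by condition (C) carried a normalised vector on which
  \<open>f\<close> exceeds \<open>\<eta>\<close>. Some combination of them with coefficients of
  \<open>\<ell>\<^sup>1\<close> norm 1 is tiny. Unconditionality makes the coefficients nonnegative,
  the supports being disjoint, and then \<open>f\<close> of the combination is still at least
  \<open>\<eta>\<close>.\<close>

lemma functional_small_on_subset:
  fixes f :: "('a \<Rightarrow>\<^sub>L real) \<Rightarrow> real"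
  assumes C: "condition_C s e" and f: "bounded_linear f" and A: "infinite A" and \<eta>: "0 < \<eta>"
  obtains A' where "A' \<subseteq> A" "infinite A'"
    "\<And>x. (\<And>j. j \<notin> A' \<Longrightarrow> blinfun_apply x (s j) = 0) \<Longrightarrow> \<bar>f x\<bar> \<le> \<eta> * norm x"
proof -
  interpret f: bounded_linear f by (rule f)
  obtain K where K: "0 < K" "\<And>x. norm (f x) \<le> norm x * K" using f.pos_bounded by blast
  \<comment> \<open>With \<open>K\<close> bounding \<open>f\<close> and \<open>Cu\<close> paid for
    changing signs, \<open>f w\<close> is at most
    \<open>Cu * \<theta> * K = \<eta> / 2\<close>.\<close>
  define \<theta> where "\<theta> = \<eta> / (2 * Cu * K)"
  have \<theta>: "0 < \<theta>" using K(1) Cu_ge_1 \<eta> by (simp add: \<theta>_def)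
  obtain B :: "nat \<Rightarrow> nat set" where B0: "(\<forall>j. infinite (B j) \<and> B j \<subseteq> A) \<and> (\<forall>i j. i \<noteq> j \<longrightarrow> B i \<inter> B j = {}) \<and>
      (\<forall>x :: nat \<Rightarrow> ('a \<Rightarrow>\<^sub>L real). (\<forall>j. norm (x j) \<le> 1) \<longrightarrow>
              (\<exists>a :: nat \<Rightarrow> real. \<exists>z. summable (\<lambda>j. \<bar>a j\<bar>) \<and> (\<Sum>j. \<bar>a j\<bar>) = 1 \<and>
                  (\<forall>u. (\<lambda>m. \<Sum>j<m. a j * blinfun_apply (coord_proj s e (B j) (x j)) u)
                          \<longlonglongrightarrow> blinfun_apply z u) \<and> norm z \<le> \<theta>))"
    using C[unfolded condition_C_def, THEN spec, THEN spec, THEN mp, THEN mp, OF A \<theta>] by (elim exE)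
  have B: "\<And>j. infinite (B j)" "\<And>j. B j \<subseteq> A" "\<And>i j. i \<noteq> j \<Longrightarrow> B i \<inter> B j = {}"
    using B0[THEN conjunct1] B0[THEN conjunct2, THEN conjunct1] by blast+
  note BC = B0[THEN conjunct2, THEN conjunct2, THEN spec, THEN mp]
  have "\<exists>j. \<forall>x. (\<forall>k. k \<notin> B j \<longrightarrow> blinfun_apply x (s k) = 0) \<longrightarrow> \<bar>f x\<bar> \<le> \<eta> * norm x"
  proof (rule ccontr)
    assume "\<not> ?thesis"
    then have "\<forall>j. \<exists>x. (\<forall>k. k \<notin> B j \<longrightarrow> blinfun_apply x (s k) = 0) \<and> \<eta> * norm x < \<bar>f x\<bar>"
      by (meson not_le)
    then obtain x0 where x0: "\<And>j k. k \<notin> B j \<Longrightarrow> blinfun_apply (x0 j) (s k) = 0"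
      "\<And>j. \<eta> * norm (x0 j) < \<bar>f (x0 j)\<bar>" by metis
    have nz: "x0 j \<noteq> 0" for j using x0(2)[of j] f.zero by auto
    define x where "x j = (sgn (f (x0 j)) / norm (x0 j)) *\<^sub>R x0 j" for j
    have xs: "blinfun_apply (x j) (s k) = 0" if "k \<notin> B j" for j k
      using x0(1)[OF that] by (simp add: x_def blinfun.scaleR_left)
    have xn: "norm (x j) \<le> 1" for j using nz[of j] by (simp add: x_def abs_sgn_eq)
    have fx: "\<eta> < f (x j)" for j
    proof -
      have "f (x j) = \<bar>f (x0 j)\<bar> / norm (x0 j)" by (simp add: x_def f.scaleR sgn_mult_self_eq abs_sgn)
      then show ?thesis using x0(2)[of j] nz[of j] by (simp add: pos_less_divide_eq)
    qed
    have res_x: "coord_proj s e (B j) (x j) = x j" for j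
      unfolding coord_proj_eq_res using xs by (intro coord_eqI) (simp add: res_coord)
    obtain a z where a: "summable (\<lambda>j. \<bar>a j\<bar>)" "(\<Sum>j. \<bar>a j\<bar>) = 1"
      and z: "\<And>u. (\<lambda>m. \<Sum>j<m. a j * blinfun_apply (x j) u) \<longlonglongrightarrow> blinfun_apply z u" "norm z \<le> \<theta>"
      using BC[of x] xn unfolding res_x by blast
    \<comment> \<open>The multiplier carries the sign of \<open>a i\<close> on \<open>B i\<close>;
      disjointness makes it well defined, and it turns \<open>a j\<close> into
      \<open>\<bar>a j\<bar>\<close>.\<close>
    define \<gamma> where "\<gamma> k = (if \<exists>i. k \<in> B i then sgn (a (THE i. k \<in> B i)) else 0)" for k
    have \<gamma>: "\<gamma> k = sgn (a i)" if "k \<in> B i" for k i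
    proof -
      have "(THE i. k \<in> B i) = i" using that B(3) by (intro the_equality) blast+
      then show ?thesis using that unfolding \<gamma>_def by auto
    qed
    have \<gamma>1: "\<bar>\<gamma> k\<bar> \<le> 1" for k by (auto simp: \<gamma>_def abs_sgn_eq)
    \<comment> \<open>Condition (C) yields weak* convergence, which \<open>f\<close> need not
      respect; absolute summability of \<open>a\<close> makes this series converge in norm.\<close>
    have sx: "summable (\<lambda>j. \<bar>a j\<bar> *\<^sub>R x j)"
      by (rule summable_comparison_test'[OF a(1), where N = 0]) (use xn in \<open>auto intro: mult_left_le\<close>)
    define w where "w = (\<Sum>j. \<bar>a j\<bar> *\<^sub>R x j)"
    have "w = diag \<gamma> z"
    proof (rule coord_eqI)
      fix k
      have wk: "(\<lambda>j. \<bar>a j\<bar> * blinfun_apply (x j) (s k)) sums blinfun_apply w (s k)"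
        using bounded_linear.sums[OF blinfun.bounded_linear_left[of "s k"] summable_sums[OF sx]]
        by (simp add: w_def blinfun.scaleR_left)
      have zk: "(\<lambda>j. a j * blinfun_apply (x j) (s k)) sums blinfun_apply z (s k)"
        using z(1) by (simp add: sums_def)
      have "(\<lambda>j. \<gamma> k * (a j * blinfun_apply (x j) (s k))) sums (\<gamma> k * blinfun_apply z (s k))"
        by (rule sums_mult[OF zk])
      moreover have "\<gamma> k * (a j * blinfun_apply (x j) (s k)) = \<bar>a j\<bar> * blinfun_apply (x j) (s k)" for j
        using xs[of k j] \<gamma>[of k j] by (cases "k \<in> B j") (auto simp: sgn_if)
      ultimately have "(\<lambda>j. \<bar>a j\<bar> * blinfun_apply (x j) (s k)) sums (\<gamma> k * blinfun_apply z (s k))" by (simp only:)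
      then show "blinfun_apply w (s k) = blinfun_apply (diag \<gamma> z) (s k)"
        using sums_unique2[OF wk] diag_coord[of \<gamma> 1, OF \<gamma>1, of z] by simp
    qed
    then have "norm w \<le> Cu * norm z"
      using norm_diag[of \<gamma> 1, OF \<gamma>1, of z] by simp
    also have "\<dots> \<le> Cu * \<theta>" using z(2) Cu_ge_1 by (intro mult_left_mono) auto
    finally have "norm w \<le> Cu * \<theta>" .
    have "f w \<le> norm w * K" using K(2)[of w] by simp
    also have "\<dots> \<le> (Cu * \<theta>) * K" using \<open>norm w \<le> Cu * \<theta>\<close> K(1) by (intro mult_right_mono) auto
    also have "\<dots> < \<eta>" using K(1) Cu_ge_1 \<eta> by (simp add: \<theta>_def)
    finally have "f w < \<eta>" .
    moreover have "\<eta> \<le> f w"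
    proof -
      have fw: "(\<lambda>j. \<bar>a j\<bar> * f (x j)) sums f w"
        using f.sums[OF summable_sums[OF sx]] by (simp add: w_def f.scaleR)
      have \<eta>s: "(\<lambda>j. \<bar>a j\<bar> * \<eta>) sums (1 * \<eta>)"
        using sums_mult2[OF summable_sums[OF a(1)]] a(2) by metis
      have "\<bar>a j\<bar> * \<eta> \<le> \<bar>a j\<bar> * f (x j)" for j
        using fx[of j] by (intro mult_left_mono) auto
      from sums_le[OF this \<eta>s fw] have "1 * \<eta> \<le> f w" .
      then show ?thesis by simp
    qed
    ultimately show False by simp
  qed
  then show ?thesis using that B(1,2) by metis
qed

end

section \<open>Geometric weights, vectors living in one row, linearity of the coordinate
  operators\<close>

lemma sum_half_powers_le: "finite F \<Longrightarrow> (\<Sum>n\<in>F. (1/2::real)^(n+1)) \<le> 1"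
proof -
  assume F: "finite F"
  have s: "(\<lambda>n. (1/2::real)^(n+1)) sums 1" using power_half_series by simp
  show ?thesis using sum_le_suminf[OF sums_summable[OF s] F] sums_unique[OF s] by simp
qed

lemma strict_mono_prod_encode: "strict_mono (\<lambda>l. prod_encode (i, l))"
  by (rule strict_monoI_Suc) (simp add: prod_encode_def)

definition single :: "nat \<Rightarrow> 'b::real_normed_vector \<Rightarrow> nat \<Rightarrow> 'b" where
  "single i x n = (if n = i then x else 0)"

lemma lp_le_single: "1 \<le> p \<Longrightarrow> lp_le p (single i x) (norm x)"
proof (rule lp_le_l1)
  fix F :: "nat set" assume "finite F"
  then show "(\<Sum>n\<in>F. norm (single i x n)) \<le> norm x"
    by (simp add: single_def if_distrib sum.delta' cong: if_cong)
qed

lemma single_mem: "1 \<le> p \<Longrightarrow> single i x \<in> lp_space p"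
  by (rule lp_space_memI[OF _ lp_le_single])

lemma single_add: "single i (x + y) = (\<lambda>n. single i x n + single i y n)"
  by (auto simp: single_def)

lemma single_scaleR: "single i (c *\<^sub>R x) = (\<lambda>n. c *\<^sub>R single i x n)"
  by (auto simp: single_def)

lemma single_zero: "single i 0 = (\<lambda>n. 0)"
  by (auto simp: single_def)

context subsymmetric_wstar_basis
begin

lemma diag_add:
  assumes "\<And>j. \<bar>\<gamma> j\<bar> \<le> c"
  shows "diag \<gamma> (x + y) = diag \<gamma> x + diag \<gamma> y"
  by (rule coord_eqI) (simp add: diag_coord[of \<gamma> c, OF assms] blinfun.add_left distrib_left)

lemma diag_scaleR:
  assumes "\<And>j. \<bar>\<gamma> j\<bar> \<le> c"
  shows "diag \<gamma> (r *\<^sub>R x) = r *\<^sub>R diag \<gamma> x"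
  by (rule coord_eqI) (simp add: diag_coord[of \<gamma> c, OF assms] blinfun.scaleR_left)

lemma squeeze_add: "strict_mono n \<Longrightarrow> squeeze n (x + y) = squeeze n x + squeeze n y"
  by (rule coord_eqI) (simp add: squeeze_coord blinfun.add_left)

lemma squeeze_scaleR: "strict_mono n \<Longrightarrow> squeeze n (r *\<^sub>R x) = r *\<^sub>R squeeze n x"
  by (rule coord_eqI) (simp add: squeeze_coord blinfun.scaleR_left)

lemma eq_sprI:
  assumes "strict_mono n" "\<And>j. blinfun_apply z (s (n j)) = blinfun_apply y (s j)"
    "\<And>i. i \<notin> range n \<Longrightarrow> blinfun_apply z (s i) = 0"
  shows "spr n y = z"
proof (rule coord_eqI)
  fix i
  show "blinfun_apply (spr n y) (s i) = blinfun_apply z (s i)"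
    by (cases "i \<in> range n") (auto simp: spr_coord[OF assms(1)] spr_coord_outside[OF assms(1)] assms(2,3))
qed

lemma spr_add: "strict_mono n \<Longrightarrow> spr n (x + y) = spr n x + spr n y"
  by (rule eq_sprI) (simp_all add: spr_coord spr_coord_outside blinfun.add_left)

lemma spr_scaleR: "strict_mono n \<Longrightarrow> spr n (r *\<^sub>R x) = r *\<^sub>R spr n x"
  by (rule eq_sprI) (simp_all add: spr_coord spr_coord_outside blinfun.scaleR_left)

lemma spr_zero: "strict_mono n \<Longrightarrow> spr n 0 = 0"
  by (rule eq_sprI) simp_all

lemma spr_e: "strict_mono n \<Longrightarrow> spr n (e l) = e (n l)"
  by (rule eq_sprI) (auto simp: e_s strict_mono_eq)

definition supported :: "('a \<Rightarrow>\<^sub>L real) \<Rightarrow> nat set \<Rightarrow> bool" where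
  "supported x A \<longleftrightarrow> (\<forall>j. j \<notin> A \<longrightarrow> blinfun_apply x (s j) = 0)"

lemma supported_mono: "supported x A \<Longrightarrow> A \<subseteq> B \<Longrightarrow> supported x B"
  unfolding supported_def by blast

section \<open>Matrix entries and the gliding hump\<close>

lemma lp_functional_entry:
  assumes H: "lp_op p H C" and p: "1 \<le> p"
  shows "lp_functional p (\<lambda>w. blinfun_apply (H w a) (s k)) C"
  unfolding lp_functional_def
proof (intro conjI allI impI ballI)
  show "0 \<le> C" using H by (rule lp_op_nonneg)
  fix y :: "nat \<Rightarrow> ('a \<Rightarrow>\<^sub>L real)" and K assume "lp_le p y K"
  then have "norm (H y a) \<le> C * K" using lp_le_coord[OF lp_op_le[OF H] p] by blast
  then show "\<bar>blinfun_apply (H y a) (s k)\<bar> \<le> C * K" using coord_le_norm order_trans by blast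
qed (use H in \<open>simp_all add: lp_op_add[OF H] lp_op_scaleR[OF H] blinfun.add_left blinfun.scaleR_left\<close>)

text \<open>The rows \<open>\<rho> i\<close>, with columns in \<open>A i\<close>, on which \<open>H\<close> can be diagonalised. Subtracting two
  far-out coordinates of the same row almost cancels the images of the unit vectors chosen before, while
  a diagonal entry survives because it stays away from the limit along its row.\<close>

definition humps :: "ereal \<Rightarrow> ((nat \<Rightarrow> ('a \<Rightarrow>\<^sub>L real)) \<Rightarrow> nat \<Rightarrow> ('a \<Rightarrow>\<^sub>L real)) \<Rightarrow> (nat \<Rightarrow> nat) \<Rightarrow> (nat \<Rightarrow> nat set)
    \<Rightarrow> (nat \<Rightarrow> nat \<Rightarrow> nat \<Rightarrow> real) \<Rightarrow> bool" where
  "humps p H \<rho> A L \<longleftrightarrow> inj \<rho> \<and> (\<forall>i. infinite (A i)) \<and>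
     (\<forall>i a k. \<forall>\<epsilon>>0. \<forall>\<^sub>F m in sequentially. \<forall>x. supported x (A i \<inter> {m..}) \<longrightarrow>
          \<bar>blinfun_apply (H (single (\<rho> i) x) a) (s k)\<bar> \<le> \<epsilon> * norm x) \<and>
     (\<forall>i i' j. \<forall>\<epsilon>>0. \<forall>\<^sub>F k in sequentially. k \<in> A i \<longrightarrow>
          \<bar>blinfun_apply (H (single (\<rho> i') (e j)) (\<rho> i)) (s k) - L i i' j\<bar> < \<epsilon>) \<and>
     (\<forall>i. \<forall>k\<in>A i. 1/2 \<le> blinfun_apply (H (single (\<rho> i) (e k)) (\<rho> i)) (s k) - L i i k) \<and>
     (\<forall>y\<in>lp_space p. (\<forall>n. n \<notin> range \<rho> \<longrightarrow> y n = 0) \<longrightarrow> (\<forall>a k.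
          (\<lambda>m. blinfun_apply (H (\<lambda>n. if m \<le> n then y n else 0) a) (s k)) \<longlonglongrightarrow> 0))"

lemma humpsD:
  assumes "humps p H \<rho> A L"
  shows humps_inj: "inj \<rho>" and humps_infinite: "infinite (A i)"
    and humps_small: "0 < \<epsilon> \<Longrightarrow> \<forall>\<^sub>F m in sequentially. \<forall>x. supported x (A i \<inter> {m..}) \<longrightarrow>
          \<bar>blinfun_apply (H (single (\<rho> i) x) a) (s k)\<bar> \<le> \<epsilon> * norm x"
    and humps_lim: "0 < \<epsilon> \<Longrightarrow> \<forall>\<^sub>F k in sequentially. k \<in> A i \<longrightarrow>
          \<bar>blinfun_apply (H (single (\<rho> i') (e j)) (\<rho> i)) (s k) - L i i' j\<bar> < \<epsilon>"
    and humps_diag_large: "k \<in> A i \<Longrightarrow> 1/2 \<le> blinfun_apply (H (single (\<rho> i) (e k)) (\<rho> i)) (s k) - L i i k"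
    and humps_tail: "y \<in> lp_space p \<Longrightarrow> (\<And>n. n \<notin> range \<rho> \<Longrightarrow> y n = 0) \<Longrightarrow>
          (\<lambda>m. blinfun_apply (H (\<lambda>n. if m \<le> n then y n else 0) a) (s k)) \<longlonglongrightarrow> 0"
  using assms unfolding humps_def by (blast, blast, blast, blast, blast, blast)

abbreviation row :: "nat \<Rightarrow> nat" where "row t \<equiv> fst (prod_decode t)"
abbreviation column :: "nat \<Rightarrow> nat" where "column t \<equiv> snd (prod_decode t)"

definition entry_diff where
  "entry_diff H a k k' w = blinfun_apply (H w a) (s k) - blinfun_apply (H w a) (s k')"

text \<open>Positions (row, column) are enumerated by \<open>prod_encode\<close>, and only finitely
  many earlier stages constrain stage \<open>t\<close>, so all demands are met by large columns.
  Smallness at the earlier readings is required for every \<open>x\<close> supported from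
  \<open>\<kappa> t\<close> on, because unit vectors do not determine \<open>H\<close>.\<close>

lemma gliding_hump:
  assumes h: "humps p H \<rho> A L" and \<epsilon>: "\<And>t n. 0 < \<epsilon> t n" and \<delta>: "\<And>t. 0 < \<delta> t"
  obtains \<kappa> \<kappa>' :: "nat \<Rightarrow> nat" where
    "strict_mono \<kappa>" "strict_mono \<kappa>'" "\<And>t. \<kappa> t \<in> A (row t)"
    "\<And>u t x. u < t \<Longrightarrow> supported x (A (row t) \<inter> {\<kappa> t..}) \<Longrightarrow>
       \<bar>entry_diff H (\<rho> (row u)) (\<kappa> u) (\<kappa>' u) (single (\<rho> (row t)) x)\<bar> \<le> \<epsilon> u (row t) * norm x"
    "\<And>u t. u < t \<Longrightarrow> \<bar>entry_diff H (\<rho> (row t)) (\<kappa> t) (\<kappa>' t) (single (\<rho> (row u)) (e (\<kappa> u)))\<bar> \<le> \<delta> t"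
    "\<And>t. 1/4 \<le> entry_diff H (\<rho> (row t)) (\<kappa> t) (\<kappa>' t) (single (\<rho> (row t)) (e (\<kappa> t)))"
proof -
  define P where "P t f r \<longleftrightarrow> fst r \<in> A (row t) \<and>
      (\<forall>u<t. fst (f u) < fst r) \<and> (\<forall>u<t. snd (f u) < snd r) \<and>
      (\<forall>u<t. \<forall>x. supported x (A (row t) \<inter> {fst r..}) \<longrightarrow>
         \<bar>entry_diff H (\<rho> (row u)) (fst (f u)) (snd (f u)) (single (\<rho> (row t)) x)\<bar> \<le> \<epsilon> u (row t) * norm x) \<and>
      (\<forall>u<t. \<bar>entry_diff H (\<rho> (row t)) (fst r) (snd r) (single (\<rho> (row u)) (e (fst (f u))))\<bar> \<le> \<delta> t) \<and>
      1/4 \<le> entry_diff H (\<rho> (row t)) (fst r) (snd r) (single (\<rho> (row t)) (e (fst r)))"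
    for t and f :: "nat \<Rightarrow> nat \<times> nat" and r :: "nat \<times> nat"
  \<comment> \<open>Each new pair is compared with all earlier pairs, so the choice must see the
    whole past and not just the preceding stage.\<close>
  have "\<exists>f. \<forall>t. P t f (f t)"
  proof (rule dependent_seq_choice)
    fix t and f g :: "nat \<Rightarrow> nat \<times> nat" and r assume "\<And>m. m < t \<Longrightarrow> f m = g m"
    then show "P t f r = P t g r" by (simp add: P_def)
  next
    fix t and f :: "nat \<Rightarrow> nat \<times> nat"
    let ?i = "row t"
    have ev1: "\<forall>\<^sub>F m in sequentially. \<forall>u\<in>{..<t}. \<forall>x. supported x (A ?i \<inter> {m..}) \<longrightarrow>
         \<bar>entry_diff H (\<rho> (row u)) (fst (f u)) (snd (f u)) (single (\<rho> ?i) x)\<bar> \<le> \<epsilon> u ?i * norm x"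
    proof (intro eventually_ball_finite ballI)
      fix u
      have "0 < \<epsilon> u ?i / 2" using \<epsilon> by simp
      from humps_small[OF h this, of ?i "\<rho> (row u)" "fst (f u)"] humps_small[OF h this, of ?i "\<rho> (row u)" "snd (f u)"]
      show "\<forall>\<^sub>F m in sequentially. \<forall>x. supported x (A ?i \<inter> {m..}) \<longrightarrow>
         \<bar>entry_diff H (\<rho> (row u)) (fst (f u)) (snd (f u)) (single (\<rho> ?i) x)\<bar> \<le> \<epsilon> u ?i * norm x"
      proof eventually_elim
        case (elim m)
        show ?case
        proof (intro allI impI)
          fix x assume "supported x (A ?i \<inter> {m..})"
          with elim have "\<bar>blinfun_apply (H (single (\<rho> ?i) x) (\<rho> (row u))) (s (fst (f u)))\<bar> \<le> \<epsilon> u ?i / 2 * norm x"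
            "\<bar>blinfun_apply (H (single (\<rho> ?i) x) (\<rho> (row u))) (s (snd (f u)))\<bar> \<le> \<epsilon> u ?i / 2 * norm x" by blast+
          then show "\<bar>entry_diff H (\<rho> (row u)) (fst (f u)) (snd (f u)) (single (\<rho> ?i) x)\<bar> \<le> \<epsilon> u ?i * norm x"
            unfolding entry_diff_def by simp
        qed
      qed
    qed simp
    \<comment> \<open>Both new columns will read a value within \<open>\<delta> t / 2\<close> of the
      same limit, so their difference is below \<open>\<delta> t\<close>.\<close>
    have ev2: "\<forall>\<^sub>F k in sequentially. \<forall>u\<in>{..<t}. k \<in> A ?i \<longrightarrow>
        \<bar>blinfun_apply (H (single (\<rho> (row u)) (e (fst (f u)))) (\<rho> ?i)) (s k) - L ?i (row u) (fst (f u))\<bar> < \<delta> t / 2"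
      using \<delta>[of t] by (intro eventually_ball_finite ballI humps_lim[OF h]) auto
    have ev3: "\<forall>\<^sub>F k in sequentially. \<forall>u\<in>{..<t}. fst (f u) < k \<and> snd (f u) < k"
      by (intro eventually_ball_finite ballI eventually_conj eventually_gt_at_top) simp
    have pick: "\<exists>k\<in>A ?i. Q k" if Q: "\<forall>\<^sub>F k in sequentially. Q k" for Q
    proof -
      obtain m where "\<And>k. m \<le> k \<Longrightarrow> Q k" using Q unfolding eventually_sequentially by blast
      moreover obtain k where "m \<le> k" "k \<in> A ?i"
        using humps_infinite[OF h] infinite_nat_iff_unbounded_le by blast
      ultimately show ?thesis by blast
    qed
    obtain k where k: "k \<in> A ?i"
      "\<forall>u\<in>{..<t}. \<forall>x. supported x (A ?i \<inter> {k..}) \<longrightarrow>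
         \<bar>entry_diff H (\<rho> (row u)) (fst (f u)) (snd (f u)) (single (\<rho> ?i) x)\<bar> \<le> \<epsilon> u ?i * norm x"
      "\<forall>u\<in>{..<t}. k \<in> A ?i \<longrightarrow>
        \<bar>blinfun_apply (H (single (\<rho> (row u)) (e (fst (f u)))) (\<rho> ?i)) (s k) - L ?i (row u) (fst (f u))\<bar> < \<delta> t / 2"
      "\<forall>u\<in>{..<t}. fst (f u) < k \<and> snd (f u) < k"
      using pick[OF eventually_conj[OF ev1 eventually_conj[OF ev2 ev3]]] by blast
    \<comment> \<open>\<open>k'\<close> is chosen after \<open>k\<close>, since the limit to be
      approached now belongs to the image of \<open>e k\<close>; the tolerance \<open>1/4\<close>
      leaves \<open>1/2 - 1/4\<close> on the diagonal.\<close>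
    have ev4: "\<forall>\<^sub>F k' in sequentially. k' \<in> A ?i \<longrightarrow>
        \<bar>blinfun_apply (H (single (\<rho> ?i) (e k)) (\<rho> ?i)) (s k') - L ?i ?i k\<bar> < 1/4"
      by (rule humps_lim[OF h]) simp
    obtain k' where k': "k' \<in> A ?i"
      "\<forall>u\<in>{..<t}. k' \<in> A ?i \<longrightarrow>
        \<bar>blinfun_apply (H (single (\<rho> (row u)) (e (fst (f u)))) (\<rho> ?i)) (s k') - L ?i (row u) (fst (f u))\<bar> < \<delta> t / 2"
      "\<forall>u\<in>{..<t}. fst (f u) < k' \<and> snd (f u) < k'"
      "k' \<in> A ?i \<longrightarrow> \<bar>blinfun_apply (H (single (\<rho> ?i) (e k)) (\<rho> ?i)) (s k') - L ?i ?i k\<bar> < 1/4"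
      using pick[OF eventually_conj[OF ev2 eventually_conj[OF ev3 ev4]]] by blast
    have "\<bar>entry_diff H (\<rho> ?i) k k' (single (\<rho> (row u)) (e (fst (f u))))\<bar> \<le> \<delta> t" if "u < t" for u
    proof -
      have "\<bar>blinfun_apply (H (single (\<rho> (row u)) (e (fst (f u)))) (\<rho> ?i)) (s k) - L ?i (row u) (fst (f u))\<bar> < \<delta> t / 2"
        "\<bar>blinfun_apply (H (single (\<rho> (row u)) (e (fst (f u)))) (\<rho> ?i)) (s k') - L ?i (row u) (fst (f u))\<bar> < \<delta> t / 2"
        using k(1,3) k'(1,2) that by auto
      then show ?thesis unfolding entry_diff_def by linarith
    qed
    moreover have "1/4 \<le> entry_diff H (\<rho> ?i) k k' (single (\<rho> ?i) (e k))"
    proof -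
      have "\<bar>blinfun_apply (H (single (\<rho> ?i) (e k)) (\<rho> ?i)) (s k') - L ?i ?i k\<bar> < 1/4" using k'(1,4) by blast
      with humps_diag_large[OF h k(1)] show ?thesis unfolding entry_diff_def by linarith
    qed
    ultimately have "P t f (k, k')" using k k' unfolding P_def by simp
    then show "\<exists>r. P t f r" ..
  qed
  then obtain f where f: "\<And>t. P t f (f t)" by blast
  show ?thesis
  proof (rule that[of "\<lambda>t. fst (f t)" "\<lambda>t. snd (f t)"])
    show "strict_mono (\<lambda>t. fst (f t))" "strict_mono (\<lambda>t. snd (f t))"
      using f by (auto simp: P_def strict_mono_def)
  qed (use f in \<open>simp_all add: P_def\<close>)
qed

lemma lp_functional_entry_diff:
  assumes H: "lp_op p H C" and p: "1 \<le> p"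
  shows "lp_functional p (entry_diff H a k k') (C + C)"
  unfolding lp_functional_def
proof (intro conjI allI impI ballI)
  note f = lp_functional_entry[OF H p, of a]
  show "0 \<le> C + C" using H by (simp add: lp_op_nonneg)
  fix y :: "nat \<Rightarrow> ('a \<Rightarrow>\<^sub>L real)" and K assume "lp_le p y K"
  then show "\<bar>entry_diff H a k k' y\<bar> \<le> (C + C) * K"
    using lp_functional_bound[OF f, of y K k] lp_functional_bound[OF f, of y K k']
    unfolding entry_diff_def by (simp add: distrib_right)
qed (use H in \<open>simp_all add: entry_diff_def lp_op_add[OF H] lp_op_scaleR[OF H] blinfun.add_left blinfun.scaleR_left
       right_diff_distrib\<close>)

section \<open>Factoring the identity through \<open>H\<close>\<close>

definition place :: "(nat \<Rightarrow> nat) \<Rightarrow> (nat \<Rightarrow> nat) \<Rightarrow> (nat \<Rightarrow> ('a \<Rightarrow>\<^sub>L real)) \<Rightarrow> nat \<Rightarrow> ('a \<Rightarrow>\<^sub>L real)" where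
  "place \<rho> \<kappa> y n = (if n \<in> range \<rho> then spr (\<lambda>l. \<kappa> (prod_encode (inv \<rho> n, l))) (y (inv \<rho> n)) else 0)"

lemma place_row: "inj \<rho> \<Longrightarrow> place \<rho> \<kappa> y (\<rho> i) = spr (\<lambda>l. \<kappa> (prod_encode (i, l))) (y i)"
  by (simp add: place_def)

lemma strict_mono_row: "strict_mono \<kappa> \<Longrightarrow> strict_mono (\<lambda>l. \<kappa> (prod_encode (i, l)))"
  using strict_mono_prod_encode[of i] by (auto simp: strict_mono_def)

lemma lp_op_place:
  assumes "inj \<rho>" "strict_mono \<kappa>" "1 \<le> p"
  shows "lp_op p (place \<rho> \<kappa>) Cs"
proof (rule lp_opI)
  show "0 \<le> Cs" using Cs_ge_1 by simp
  fix y :: "nat \<Rightarrow> ('a \<Rightarrow>\<^sub>L real)" and K assume y: "lp_le p y K"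
  show "lp_le p (place \<rho> \<kappa> y) (Cs * K)"
  proof (rule lp_le_extend[OF _ assms(1)])
    show "lp_le p (\<lambda>n. place \<rho> \<kappa> y (\<rho> n)) (Cs * K)"
      by (rule lp_le_dominated[OF y assms(3)])
         (use Cs_ge_1 in \<open>auto simp: place_row assms(1) intro: norm_spr strict_mono_row assms(2)\<close>)
  qed (simp add: place_def)
qed (auto simp: place_def spr_add spr_scaleR strict_mono_row assms(2))

lemma place_single_e:
  assumes "inj \<rho>" "strict_mono \<kappa>"
  shows "place \<rho> \<kappa> (single i (e l)) = single (\<rho> i) (e (\<kappa> (prod_encode (i, l))))"
  by (rule ext) (auto simp: place_def single_def spr_zero spr_e strict_mono_row assms)

text \<open>Approximate left inverse of \<open>H\<close> after \<open>place \<rho> \<kappa>\<close>: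
  each position is read as a difference of two columns and normalised by its diagonal entry
  \<open>d\<close>.\<close>

definition unplace where
  "unplace \<rho> \<kappa> \<kappa>' d y i =
     diag (\<lambda>l. inverse (d (prod_encode (i, l))))
       (squeeze (\<lambda>l. \<kappa> (prod_encode (i, l))) (y (\<rho> i)) - squeeze (\<lambda>l. \<kappa>' (prod_encode (i, l))) (y (\<rho> i)))"

lemma inverse_le_4: "1/4 \<le> (x::real) \<Longrightarrow> \<bar>inverse x\<bar> \<le> 4"
  by (simp add: field_simps)

lemma unplace_coord:
  assumes "strict_mono \<kappa>" "strict_mono \<kappa>'" "\<And>t. 1/4 \<le> d t"
  shows "blinfun_apply (unplace \<rho> \<kappa> \<kappa>' d (H w) i) (s l)
     = entry_diff H (\<rho> i) (\<kappa> (prod_encode (i, l))) (\<kappa>' (prod_encode (i, l))) w / d (prod_encode (i, l))"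
proof -
  have b: "\<bar>inverse (d (prod_encode (i, l)))\<bar> \<le> 4" for l by (intro inverse_le_4 assms(3))
  show ?thesis unfolding unplace_def
    by (simp add: diag_coord[of _ 4, OF b] blinfun.diff_left squeeze_coord strict_mono_row assms(1,2)
        entry_diff_def divide_inverse mult.commute)
qed

text \<open>The inverse diagonal is bounded by 4, acting as a multiplier costs \<open>Cu\<close>,
  and the two squeezes together cost \<open>2 * Cs * Cu\<close>.\<close>

lemma lp_op_unplace:
  assumes "inj \<rho>" "strict_mono \<kappa>" "strict_mono \<kappa>'" "\<And>t. 1/4 \<le> d t" "1 \<le> p"
  shows "lp_op p (unplace \<rho> \<kappa> \<kappa>' d) (8 * Cu^2 * Cs)"
proof (rule lp_opI)
  note sm = strict_mono_row[OF assms(2)] strict_mono_row[OF assms(3)]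
  have b: "\<bar>inverse (d (prod_encode (i, l)))\<bar> \<le> 4" for i l by (intro inverse_le_4 assms(4))
  show "0 \<le> 8 * Cu^2 * Cs" using Cs_ge_1 by simp
  {
    fix y :: "nat \<Rightarrow> ('a \<Rightarrow>\<^sub>L real)" and K assume y: "lp_le p y K"
    show "lp_le p (unplace \<rho> \<kappa> \<kappa>' d y) (8 * Cu^2 * Cs * K)"
    proof (rule lp_le_dominated[OF lp_le_reindex[OF y assms(1)] assms(5)])
      show "0 \<le> 8 * Cu^2 * Cs" using Cs_ge_1 by simp
      fix i
      let ?a = "squeeze (\<lambda>l. \<kappa> (prod_encode (i, l))) (y (\<rho> i))" and ?b = "squeeze (\<lambda>l. \<kappa>' (prod_encode (i, l))) (y (\<rho> i))"
      have "norm (unplace \<rho> \<kappa> \<kappa>' d y i) \<le> Cu * 4 * norm (?a - ?b)"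
        unfolding unplace_def by (rule norm_diag[OF b])
      also have "norm (?a - ?b) \<le> Cs * Cu * norm (y (\<rho> i)) + Cs * Cu * norm (y (\<rho> i))"
        by (rule order_trans[OF norm_triangle_ineq4 add_mono[OF norm_squeeze[OF sm(1)] norm_squeeze[OF sm(2)]]])
      finally show "norm (unplace \<rho> \<kappa> \<kappa>' d y i) \<le> 8 * Cu^2 * Cs * norm (y (\<rho> i))"
        using Cu_ge_1 by (simp add: power2_eq_square algebra_simps)
    qed
  next
    fix y z :: "nat \<Rightarrow> ('a \<Rightarrow>\<^sub>L real)"
    show "unplace \<rho> \<kappa> \<kappa>' d (\<lambda>n. y n + z n) = (\<lambda>n. unplace \<rho> \<kappa> \<kappa>' d y n + unplace \<rho> \<kappa> \<kappa>' d z n)"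
      by (rule ext) (simp add: unplace_def squeeze_add sm add_diff_add diag_add[of _ 4, OF b])
  next
    fix y :: "nat \<Rightarrow> ('a \<Rightarrow>\<^sub>L real)" and c
    show "unplace \<rho> \<kappa> \<kappa>' d (\<lambda>n. c *\<^sub>R y n) = (\<lambda>n. c *\<^sub>R unplace \<rho> \<kappa> \<kappa>' d y n)"
      by (rule ext) (simp add: unplace_def squeeze_scaleR sm diag_scaleR[of _ 4, OF b] flip: scaleR_diff_right)
  }
qed

text \<open>For \<open>p = \<infinity>\<close> a functional need not be the sum of its values on the
  rows. The hypothesis on tails restores this for the vector \<open>w\<close>, and letting
  \<open>m\<close> grow gives the bound.\<close>

lemma functional_le_sum_rows:
  assumes \<phi>: "lp_functional p \<phi> C" and p: "1 \<le> p" and w: "w \<in> lp_space p"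
    and tail: "(\<lambda>m. \<phi> (\<lambda>n. if m \<le> n then w n else 0)) \<longlonglongrightarrow> 0"
    and B: "\<And>m. (\<Sum>n<m. \<bar>\<phi> (single n (w n))\<bar>) \<le> B"
  shows "\<bar>\<phi> w\<bar> \<le> B"
proof -
  have "\<bar>\<phi> w\<bar> \<le> B + \<bar>\<phi> (\<lambda>n. if m \<le> n then w n else 0)\<bar>" for m
  proof -
    let ?t = "\<lambda>n. if m \<le> n then w n else 0"
    have wt: "w = (\<lambda>n. (\<Sum>i<m. single i (w i) n) + ?t n)"
      by (rule ext) (simp add: single_def sum.delta')
    have "\<phi> (\<lambda>n. (\<Sum>i<m. single i (w i) n) + ?t n) = \<phi> (\<lambda>n. \<Sum>i<m. single i (w i) n) + \<phi> ?t"
      by (intro lp_functional_add[OF \<phi>] lp_space_sum single_mem p lp_space_mono_norm[OF p w]) auto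
    also have "\<phi> (\<lambda>n. \<Sum>i<m. single i (w i) n) = (\<Sum>i<m. \<phi> (single i (w i)))"
      by (intro lp_functional_sum[OF \<phi> p] single_mem p) auto
    finally have "\<phi> w = (\<Sum>i<m. \<phi> (single i (w i))) + \<phi> ?t" using wt by simp
    moreover have "\<bar>\<Sum>i<m. \<phi> (single i (w i))\<bar> \<le> B" by (rule order_trans[OF sum_abs B])
    ultimately show ?thesis by linarith
  qed
  moreover have "(\<lambda>m. B + \<bar>\<phi> (\<lambda>n. if m \<le> n then w n else 0)\<bar>) \<longlonglongrightarrow> B + \<bar>0\<bar>"
    by (intro tendsto_intros tail)
  ultimately show ?thesis
    by (intro tendsto_lowerbound[of _ "B" sequentially "\<bar>\<phi> w\<bar>"]) (auto intro: always_eventually)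
qed

text \<open>Small matrix entries alone would not control the norm of the error \<open>R\<close>.
  Instead every coordinate of \<open>R y\<close> is bounded, for a whole vector \<open>y\<close>, by
  a geometric weight in row and column; summing the weights gives norm at most \<open>1/2\<close>
  whatever \<open>p\<close> is.\<close>

lemma factorization_of_identity:
  assumes H: "lp_op p H C" and p: "1 \<le> p" and h: "humps p H \<rho> A L"
  obtains M N where "lp_op p M Cs" "lp_op p N (16 * Cu^2 * Cs)"
    "\<And>y. y \<in> lp_space p \<Longrightarrow> N (H (M y)) = y"
proof -
  \<comment> \<open>With the exponent 6, the error \<open>2 * \<eta> t * K\<close> times 4 for the
    inverse diagonal is exactly \<open>K/2 * (1/2)^(i+1) * (1/2)^(l+1)\<close> at position
    \<open>(i, l)\<close>.\<close>
  define \<eta> :: "nat \<Rightarrow> real" where "\<eta> t = (1/2)^(row t + column t + 6)" for t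
  have \<eta>_pos: "0 < \<eta> t" for t by (simp add: \<eta>_def)
  have inj: "inj \<rho>" by (rule humps_inj[OF h])
  \<comment> \<open>Dividing by \<open>Cs * Cu\<close> pays for spreading \<open>y\<close> and for
    cutting off its first positions; the power of \<open>1/2\<close> makes the contributions of the
    rows summable.\<close>
  define \<epsilon> where "\<epsilon> t i = \<eta> t * (1/2)^(\<rho> i+1) / (Cs * Cu)" for t i
  have \<epsilon>_pos: "0 < \<epsilon> t n" for t n using Cs_ge_1 Cu_ge_1 \<eta>_pos by (simp add: \<epsilon>_def)
  \<comment> \<open>There are \<open>t\<close> unit vectors before stage \<open>t\<close>; dividing
    by \<open>1 + t\<close> keeps their total contribution below \<open>\<eta> t\<close>.\<close>
  have \<delta>_pos: "0 < \<eta> t / (1 + real t)" for t using \<eta>_pos by (simp add: add_pos_nonneg)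
  obtain \<kappa> \<kappa>' where \<kappa>: "strict_mono \<kappa>" "strict_mono \<kappa>'" "\<And>t. \<kappa> t \<in> A (row t)"
    and after: "\<And>u t x. u < t \<Longrightarrow> supported x (A (row t) \<inter> {\<kappa> t..}) \<Longrightarrow>
       \<bar>entry_diff H (\<rho> (row u)) (\<kappa> u) (\<kappa>' u) (single (\<rho> (row t)) x)\<bar> \<le> \<epsilon> u (row t) * norm x"
    and before: "\<And>u t. u < t \<Longrightarrow> \<bar>entry_diff H (\<rho> (row t)) (\<kappa> t) (\<kappa>' t) (single (\<rho> (row u)) (e (\<kappa> u)))\<bar>
       \<le> \<eta> t / (1 + real t)"
    and diagonal: "\<And>t. 1/4 \<le> entry_diff H (\<rho> (row t)) (\<kappa> t) (\<kappa>' t) (single (\<rho> (row t)) (e (\<kappa> t)))"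
    by (rule gliding_hump[where \<epsilon> = \<epsilon> and \<delta> = "\<lambda>t. \<eta> t / (1 + real t)", OF h \<epsilon>_pos \<delta>_pos]) (rule that)
  define \<phi> where "\<phi> t = entry_diff H (\<rho> (row t)) (\<kappa> t) (\<kappa>' t)" for t
  have \<phi>: "lp_functional p (\<phi> t) (C + C)" for t
    unfolding \<phi>_def by (rule lp_functional_entry_diff[OF H p])
  define E where "E t = single (\<rho> (row t)) (e (\<kappa> t))" for t
  define d where "d t = \<phi> t (E t)" for t
  have d: "1/4 \<le> d t" for t using diagonal[of t] by (simp add: d_def \<phi>_def E_def)
  define M where "M = place \<rho> \<kappa>"
  define N0 where "N0 = unplace \<rho> \<kappa> \<kappa>' d"
  have M: "lp_op p M Cs" unfolding M_def by (rule lp_op_place[OF inj \<kappa>(1) p])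
  have N0: "lp_op p N0 (8 * Cu^2 * Cs)" unfolding N0_def by (rule lp_op_unplace[OF inj \<kappa>(1,2) d p])
  have N0_coord: "blinfun_apply (N0 (H w) i) (s l) = \<phi> (prod_encode (i, l)) w / d (prod_encode (i, l))" for w i l
    unfolding N0_def by (subst unplace_coord[where H = H and w = w, OF \<kappa>(1,2) d]) (simp add: \<phi>_def)

  \<comment> \<open>If \<open>y\<close> vanishes at all positions up to \<open>t\<close>, each row
    of \<open>M y\<close> begins at a column picked after stage \<open>t\<close>, so
    \<open>after\<close> applies to the entire row.\<close>
  have high: "\<bar>\<phi> t (M y)\<bar> \<le> \<eta> t * K"
    if y: "lp_le p y (Cu * K)" and K: "0 \<le> K" and y0: "\<And>u. u \<le> t \<Longrightarrow> blinfun_apply (y (row u)) (s (column u)) = 0" for t y K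
  proof (rule functional_le_sum_rows[OF \<phi> p])
    have m: "M y \<in> lp_space p" by (rule lp_space_memI[OF p lp_op_le[OF M y]])
    then show "M y \<in> lp_space p" .
    have "M y n = 0" if "n \<notin> range \<rho>" for n using that by (simp add: M_def place_def)
    from tendsto_diff[OF humps_tail[OF h m this] humps_tail[OF h m this]]
    show "(\<lambda>k. \<phi> t (\<lambda>n. if k \<le> n then M y n else 0)) \<longlonglongrightarrow> 0"
      unfolding \<phi>_def entry_diff_def by simp
    have rowb: "\<bar>\<phi> t (single n (M y n))\<bar> \<le> \<eta> t * K * (1/2)^(n+1)" for n
    proof (cases "n \<in> range \<rho>")
      case False
      then have "single n (M y n) = (\<lambda>n. 0)" by (simp add: M_def place_def single_zero)
      then have "\<phi> t (single n (M y n)) = 0"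
        using lp_functional_bound[OF \<phi> lp_le_zero[OF p order_refl], of t] by simp
      then show ?thesis using K \<eta>_pos[of t] by simp
    next
      case True
      then obtain i where i: "n = \<rho> i" by blast
      let ?\<kappa> = "\<lambda>l. \<kappa> (prod_encode (i, l))"
      have sm: "strict_mono ?\<kappa>" by (rule strict_mono_row[OF \<kappa>(1)])
      have Mi: "M y n = spr ?\<kappa> (y i)" using i inj by (simp add: M_def place_row)
      \<comment> \<open>\<open>l0\<close> will be the first place of row \<open>i\<close> enumerated
        after \<open>t\<close>; at all places before it \<open>y\<close> is 0.\<close>
      have "\<exists>l. t < prod_encode (i, l)" using le_prod_encode_2 by (metis less_eq_Suc_le)
      then obtain l0 where l0: "t < prod_encode (i, l0)" "\<And>l. l < l0 \<Longrightarrow> prod_encode (i, l) \<le> t"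
        using exists_least_iff[of "\<lambda>l. t < prod_encode (i, l)"] by (auto simp: not_less)
      define u where "u = prod_encode (i, l0)"
      have u: "t < u" "row u = i" using l0 by (simp_all add: u_def)
      have "supported (M y n) (A (row u) \<inter> {\<kappa> u..})"
        unfolding supported_def
      proof (intro allI impI)
        fix j assume j: "j \<notin> A (row u) \<inter> {\<kappa> u..}"
        show "blinfun_apply (M y n) (s j) = 0"
        proof (cases "j \<in> range ?\<kappa>")
          case True
          then obtain l where l: "j = ?\<kappa> l" by blast
          have "j \<in> A i" using \<kappa>(3)[of "prod_encode (i, l)"] by (simp add: l)
          then have "?\<kappa> l < ?\<kappa> l0" using j l u(2) by (simp add: u_def)
          then have "l < l0" using strict_mono_less[OF sm] by blast
          then have "prod_encode (i, l) \<le> t" by (rule l0(2))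
          then have "blinfun_apply (y i) (s l) = 0" using y0[of "prod_encode (i, l)"] by simp
          then show ?thesis unfolding Mi l by (simp add: spr_coord[OF sm])
        qed (simp add: Mi spr_coord_outside[OF sm])
      qed
      from after[OF u(1) this] have "\<bar>\<phi> t (single n (M y n))\<bar> \<le> \<epsilon> t i * norm (M y n)"
        using u(2) i by (simp add: \<phi>_def)
      also have "norm (M y n) \<le> Cs * norm (y i)" unfolding Mi by (rule norm_spr[OF sm])
      also have "\<dots> \<le> Cs * (Cu * K)" using lp_le_coord[OF y p] Cs_ge_1 by (intro mult_left_mono) auto
      finally have "\<bar>\<phi> t (single n (M y n))\<bar> \<le> \<epsilon> t i * (Cs * (Cu * K))" using \<epsilon>_pos[of t i] by simp
      also have "\<dots> = \<eta> t * K * (1/2)^(n+1)" using Cs_ge_1 Cu_ge_1 by (simp add: \<epsilon>_def i)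
      finally show ?thesis .
    qed
    fix m
    have "(\<Sum>n<m. \<bar>\<phi> t (single n (M y n))\<bar>) \<le> (\<Sum>n<m. \<eta> t * K * (1/2)^(n+1))" by (intro sum_mono rowb)
    also have "\<dots> = \<eta> t * K * (\<Sum>n<m. (1/2)^(n+1))" by (simp add: sum_distrib_left)
    also have "\<dots> \<le> \<eta> t * K * 1" using K \<eta>_pos[of t] by (intro mult_left_mono sum_half_powers_le) auto
    finally show "(\<Sum>n<m. \<bar>\<phi> t (single n (M y n))\<bar>) \<le> \<eta> t * K" by simp
  qed

  \<comment> \<open>The positions up to \<open>t\<close> form a finite combination of unit vectors:
    those before \<open>t\<close> contribute at most \<open>\<eta> t * K\<close>, and
    \<open>t\<close> itself gives the diagonal term. The remainder starts after \<open>t\<close> and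
    costs another \<open>\<eta> t * K\<close> by \<open>high\<close>.\<close>
  have entry: "\<bar>\<phi> t (M y) - d t * blinfun_apply (y (row t)) (s (column t))\<bar> \<le> 2 * \<eta> t * K"
    if y: "lp_le p y K" for t y K
  proof -
    have K: "0 \<le> K" by (rule lp_le_nonneg[OF y])
    define c where "c u = blinfun_apply (y (row u)) (s (column u))" for u
    have c: "\<bar>c u\<bar> \<le> K" for u unfolding c_def using coord_le_norm lp_le_coord[OF y p] order_trans by blast
    define y1 where "y1 = (\<lambda>n. \<Sum>u\<le>t. (c u *\<^sub>R single (row u) (e (column u)) n))"
    define y2 where "y2 i = diag (\<lambda>l. if t < prod_encode (i, l) then 1 else 0) (y i)" for i
    have b1: "\<bar>if t < prod_encode (i, l) then 1 else 0 :: real\<bar> \<le> 1" for i l by simp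
    have y2c: "blinfun_apply (y2 i) (s l) = (if t < prod_encode (i, l) then blinfun_apply (y i) (s l) else 0)" for i l
      unfolding y2_def by (subst diag_coord[of _ 1, OF b1]) simp
    have ind: "blinfun_apply (single (row u) (e (column u)) i) (s l) = (if u = prod_encode (i, l) then 1 else 0)" for u i l
      by (auto simp: single_def e_s)
    have split: "y = (\<lambda>i. y1 i + y2 i)"
    proof (intro ext coord_eqI)
      fix i l
      have "blinfun_apply (y1 i) (s l) = (\<Sum>u\<le>t. c u * (if u = prod_encode (i, l) then 1 else 0))"
        unfolding y1_def by (simp add: blinfun.sum_left blinfun.scaleR_left ind)
      also have "\<dots> = (\<Sum>u\<le>t. if u = prod_encode (i, l) then c u else 0)"
        by (intro sum.cong) auto
      finally have "blinfun_apply (y1 i) (s l) = (\<Sum>u\<le>t. if u = prod_encode (i, l) then c u else 0)" .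
      then show "blinfun_apply (y i) (s l) = blinfun_apply (y1 i + y2 i) (s l)"
        by (simp add: blinfun.add_left y2c c_def)
    qed
    have mem: "(\<lambda>n. c u *\<^sub>R single (row u) (e (column u)) n) \<in> lp_space p" for u
      by (intro lp_space_scaleR single_mem p)
    have y2: "lp_le p y2 (Cu * K)"
      by (rule lp_le_dominated[OF y p]) (use Cu_ge_1 norm_diag[of _ 1, OF b1] in \<open>simp_all add: y2_def\<close>)
    have m1: "y1 \<in> lp_space p" unfolding y1_def by (intro lp_space_sum mem p) simp
    have m2: "y2 \<in> lp_space p" by (rule lp_space_memI[OF p y2])
    have ME: "M (single (row u) (e (column u))) = E u" for u
      unfolding M_def E_def by (subst place_single_e[OF inj \<kappa>(1)]) simp
    have "M y1 = (\<lambda>n. \<Sum>u\<le>t. c u *\<^sub>R E u n)"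
      unfolding y1_def by (subst lp_op_sum[OF M p]) (auto simp: mem lp_op_scaleR[OF M single_mem[OF p]] ME)
    moreover have "\<phi> t (\<lambda>n. \<Sum>u\<le>t. c u *\<^sub>R E u n) = (\<Sum>u\<le>t. \<phi> t (\<lambda>n. c u *\<^sub>R E u n))"
      unfolding E_def by (intro lp_functional_sum[OF \<phi> p] lp_space_scaleR single_mem p) simp
    moreover have "\<phi> t (\<lambda>n. c u *\<^sub>R E u n) = c u * \<phi> t (E u)" for u
      unfolding E_def by (intro lp_functional_scaleR[OF \<phi>] single_mem p)
    ultimately have "\<phi> t (M y1) = (\<Sum>u\<le>t. c u * \<phi> t (E u))" by simp
    also have "\<dots> = (\<Sum>u<t. c u * \<phi> t (E u)) + d t * c t"
      by (simp add: d_def lessThan_Suc_atMost[symmetric])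
    finally have low: "\<phi> t (M y1) = (\<Sum>u<t. c u * \<phi> t (E u)) + d t * c t" .
    have "\<bar>\<Sum>u<t. c u * \<phi> t (E u)\<bar> \<le> (\<Sum>u<t. K * (\<eta> t / (1 + real t)))"
    proof (rule order_trans[OF sum_abs sum_mono])
      fix u assume "u \<in> {..<t}"
      then have "\<bar>\<phi> t (E u)\<bar> \<le> \<eta> t / (1 + real t)" using before[of u t] by (simp add: \<phi>_def E_def)
      then show "\<bar>c u * \<phi> t (E u)\<bar> \<le> K * (\<eta> t / (1 + real t))"
        unfolding abs_mult using c K by (intro mult_mono) auto
    qed
    also have "\<dots> = K * \<eta> t * (real t / (1 + real t))" by simp
    also have "\<dots> \<le> K * \<eta> t * 1" using K \<eta>_pos[of t] by (intro mult_left_mono) auto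
    finally have b: "\<bar>\<Sum>u<t. c u * \<phi> t (E u)\<bar> \<le> \<eta> t * K" by (simp add: mult.commute)
    have "\<bar>\<phi> t (M y2)\<bar> \<le> \<eta> t * K"
      by (rule high[OF y2 K]) (simp add: y2c)
    moreover have "\<phi> t (M y) = \<phi> t (M y1) + \<phi> t (M y2)"
      unfolding split lp_op_add[OF M m1 m2]
      by (intro lp_functional_add[OF \<phi>] lp_op_mem[OF M p] m1 m2)
    ultimately have "\<bar>\<phi> t (M y) - d t * c t\<bar> \<le> 2 * \<eta> t * K" using b low by linarith
    then show ?thesis by (simp add: c_def)
  qed

  define R where "R y = (\<lambda>n. N0 (H (M y)) n - y n)" for y
  \<comment> \<open>This constant depends on the norm of \<open>H\<close>; it only serves to obtain
    linearity, and the bound \<open>1/2\<close> comes from the coordinates.\<close>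
  have "lp_op p (\<lambda>y n. N0 (H (M y)) n - y n) (8 * Cu^2 * Cs * (C * Cs) + 1)"
    by (rule lp_op_minus[OF lp_op_compose[OF N0 lp_op_compose[OF H M p] p] lp_op_id[OF p] p])
  then have R0: "lp_op p R (8 * Cu^2 * Cs * (C * Cs) + 1)" unfolding R_def .
  have R: "lp_op p R (1/2)"
  proof (rule lp_opI)
    fix y :: "nat \<Rightarrow> ('a \<Rightarrow>\<^sub>L real)" and K assume y: "lp_le p y K"
    have K: "0 \<le> K" by (rule lp_le_nonneg[OF y])
    have coord: "\<bar>blinfun_apply (R y i) (s l)\<bar> \<le> K / 2 * (1/2)^(i+1) * (1/2)^(l+1)" for i l
    proof -
      let ?t = "prod_encode (i, l)"
      have dt: "0 < d ?t" using d[of ?t] by simp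
      have "blinfun_apply (R y i) (s l) = (\<phi> ?t (M y) - d ?t * blinfun_apply (y i) (s l)) / d ?t"
        unfolding R_def using dt by (simp add: blinfun.diff_left N0_coord field_simps)
      then have "\<bar>blinfun_apply (R y i) (s l)\<bar> = \<bar>\<phi> ?t (M y) - d ?t * blinfun_apply (y i) (s l)\<bar> * inverse (d ?t)"
        using dt by (simp add: divide_inverse abs_mult)
      also have "\<dots> \<le> (2 * \<eta> ?t * K) * 4"
        using entry[OF y, of ?t] inverse_le_4[OF d, of ?t] dt K \<eta>_pos[of ?t] by (intro mult_mono) auto
      also have "\<dots> = K / 2 * (1/2)^(i+1) * (1/2)^(l+1)" by (simp add: \<eta>_def power_add power_divide)
      finally show ?thesis .
    qed
    have rowR: "norm (R y i) \<le> K / 2 * (1/2)^(i+1)" for i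
    proof (rule norm_le_sum_coords)
      fix m
      have "(\<Sum>l<m. \<bar>blinfun_apply (R y i) (s l)\<bar>) \<le> K / 2 * (1/2)^(i+1) * (\<Sum>l<m. (1/2)^(l+1))"
        unfolding sum_distrib_left by (intro sum_mono coord)
      also have "\<dots> \<le> K / 2 * (1/2)^(i+1) * 1" using K by (intro mult_left_mono sum_half_powers_le) auto
      finally show "(\<Sum>l<m. \<bar>blinfun_apply (R y i) (s l)\<bar>) \<le> K / 2 * (1/2)^(i+1)" by simp
    qed
    show "lp_le p (R y) (1/2 * K)"
    proof (rule lp_le_l1[OF p])
      fix F :: "nat set" assume F: "finite F"
      have "(\<Sum>n\<in>F. norm (R y n)) \<le> K / 2 * (\<Sum>n\<in>F. (1/2)^(n+1))"
        unfolding sum_distrib_left by (intro sum_mono rowR)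
      also have "\<dots> \<le> K / 2 * 1" using K F by (intro mult_left_mono sum_half_powers_le) auto
      finally show "(\<Sum>n\<in>F. norm (R y n)) \<le> 1/2 * K" by simp
    qed
  qed (use R0 in \<open>auto simp: lp_op_add[OF R0] lp_op_scaleR[OF R0]\<close>)
  obtain V where V: "lp_op p V 2" "\<And>y. y \<in> lp_space p \<Longrightarrow> V (\<lambda>n. y n + R y n) = y"
    using lp_left_inverse_near_id[OF R p] by blast
  show ?thesis
  proof (rule that[OF M])
    show "lp_op p (\<lambda>y. V (N0 y)) (16 * Cu^2 * Cs)"
      using lp_op_compose[OF V(1) N0 p] by (simp add: mult.assoc)
    show "V (N0 (H (M y))) = y" if "y \<in> lp_space p" for y
      using V(2)[OF that] by (simp add: R_def)
  qed
qed

end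

section \<open>Choosing columns and rows\<close>

lemma abs_diff_less_of_halves: "\<bar>a - l\<bar> < h/2 \<Longrightarrow> \<bar>b - l\<bar> < h/2 \<Longrightarrow> \<bar>a - b\<bar> < (h::real)"
  by linarith

text \<open>Bolzano-Weierstrass for countably many bounded sequences, joined by the diagonal
  argument. The requirement is small oscillation, which subsets inherit without any limit being
  named; completeness produces \<open>L\<close> afterwards.\<close>

lemma convergent_along_subset:
  fixes f :: "nat \<Rightarrow> nat \<Rightarrow> real"
  assumes bnd: "\<And>t k. \<bar>f t k\<bar> \<le> B t" and A: "infinite A"
  obtains A' L where "A' \<subseteq> A" "infinite A'"
    "\<And>t \<epsilon>. 0 < \<epsilon> \<Longrightarrow> \<forall>\<^sub>F k in sequentially. k \<in> A' \<longrightarrow> \<bar>f t k - L t\<bar> < \<epsilon>"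
proof -
  define R where "R q S \<longleftrightarrow> (\<forall>k\<in>S. \<forall>l\<in>S. \<bar>f (fst (prod_decode q)) k - f (fst (prod_decode q)) l\<bar>
      < 1 / (1 + real (snd (prod_decode q))))" for q S
  obtain A' where A': "A' \<subseteq> A" "infinite A'" "\<And>q. \<exists>m. R q (A' \<inter> {m..})"
  proof (rule pseudo_intersection[of R A])
    show "R q T" if "R q S" "T \<subseteq> S" for q S T using that unfolding R_def by blast
    fix q and S :: "nat set" assume S: "infinite S"
    let ?t = "fst (prod_decode q)" and ?\<eta> = "1 / (1 + real (snd (prod_decode q)))"
    have "bounded (range (\<lambda>n. f ?t (enumerate S n)))" using bnd by (auto simp: bounded_iff)
    then obtain l r where r: "strict_mono r" "((\<lambda>n. f ?t (enumerate S n)) \<circ> r) \<longlonglongrightarrow> l"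
      using bounded_imp_convergent_subsequence by blast
    have "0 < ?\<eta> / 2" by simp
    then have "\<exists>N. \<forall>n\<ge>N. \<bar>f ?t (enumerate S (r n)) - l\<bar> < ?\<eta> / 2"
      using LIMSEQ_D[OF r(2), of "?\<eta> / 2"] by simp
    then obtain N where N: "\<And>n. N \<le> n \<Longrightarrow> \<bar>f ?t (enumerate S (r n)) - l\<bar> < ?\<eta> / 2" by blast
    define T where "T = range (\<lambda>n. enumerate S (r (N + n)))"
    have "strict_mono (\<lambda>n. enumerate S (r (N + n)))"
      using strict_mono_enumerate[OF S] r(1) by (simp add: strict_mono_def)
    then have "infinite T" unfolding T_def by (simp add: range_inj_infinite strict_mono_imp_inj_on)
    moreover have "T \<subseteq> S" unfolding T_def using enumerate_in_set[OF S] by blast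
    moreover have "R q T" unfolding R_def
    proof (intro ballI)
      fix k k' assume "k \<in> T" "k' \<in> T"
      then obtain n n' where "k = enumerate S (r (N + n))" "k' = enumerate S (r (N + n'))" unfolding T_def by blast
      then have "\<bar>f ?t k - l\<bar> < ?\<eta> / 2" "\<bar>f ?t k' - l\<bar> < ?\<eta> / 2" using N[of "N + n"] N[of "N + n'"] by auto
      then show "\<bar>f ?t k - f ?t k'\<bar> < ?\<eta>" by (rule abs_diff_less_of_halves)
    qed
    ultimately show "\<exists>T\<subseteq>S. infinite T \<and> R q T" by blast
  qed (use A in auto)
  have close: "\<exists>m. \<forall>k\<in>A'. \<forall>l\<in>A'. m \<le> k \<longrightarrow> m \<le> l \<longrightarrow> \<bar>f t k - f t l\<bar> < \<epsilon>" if \<epsilon>: "0 < \<epsilon>" for t \<epsilon>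
  proof -
    obtain j :: nat where "1 / \<epsilon> < real j" using reals_Archimedean2 by blast
    then have j: "1 / (1 + real j) < \<epsilon>" using \<epsilon> by (simp add: field_simps)
    obtain m where "R (prod_encode (t, j)) (A' \<inter> {m..})" using A'(3) by blast
    then have "\<bar>f t k - f t l\<bar> < 1 / (1 + real j)" if "k \<in> A'" "l \<in> A'" "m \<le> k" "m \<le> l" for k l
      using that by (simp add: R_def)
    then show ?thesis using j less_trans by blast
  qed
  have en: "n \<le> enumerate A' n" "enumerate A' n \<in> A'" for n
    using le_enumerate[OF A'(2)] enumerate_in_set[OF A'(2)] by auto
  have "\<exists>L. (\<lambda>n. f t (enumerate A' n)) \<longlonglongrightarrow> L" for t
  proof -
    have "Cauchy (\<lambda>n. f t (enumerate A' n))"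
      unfolding Cauchy_def dist_real_def using close[of _ t] en order_trans by metis
    then show ?thesis by (simp add: Cauchy_convergent_iff convergent_def)
  qed
  then obtain L where L: "\<And>t. (\<lambda>n. f t (enumerate A' n)) \<longlonglongrightarrow> L t" by metis
  show ?thesis
  proof (rule that[OF A'(1,2)])
    fix t and \<epsilon> :: real assume "0 < \<epsilon>"
    then have "0 < \<epsilon> / 2" by simp
    then obtain m where m: "\<forall>k\<in>A'. \<forall>l\<in>A'. m \<le> k \<longrightarrow> m \<le> l \<longrightarrow> \<bar>f t k - f t l\<bar> < \<epsilon> / 2"
      using close by blast
    obtain N where N: "\<And>n. N \<le> n \<Longrightarrow> \<bar>f t (enumerate A' n) - L t\<bar> < \<epsilon> / 2"
      using LIMSEQ_D[OF L \<open>0 < \<epsilon> / 2\<close>] by auto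
    let ?l = "enumerate A' (max m N)"
    have l: "m \<le> ?l" "?l \<in> A'" "\<bar>f t ?l - L t\<bar> < \<epsilon> / 2" using en[of "max m N"] N by auto
    have "\<bar>f t k - L t\<bar> < \<epsilon>" if "k \<in> A'" "m \<le> k" for k
    proof -
      have "\<bar>f t k - f t ?l\<bar> < \<epsilon> / 2" using m that l by blast
      then show ?thesis using l(3) by linarith
    qed
    then show "\<forall>\<^sub>F k in sequentially. k \<in> A' \<longrightarrow> \<bar>f t k - L t\<bar> < \<epsilon>"
      unfolding eventually_sequentially by blast
  qed
qed

context subsymmetric_wstar_basis
begin

text \<open>For a fixed row the coordinates of \<open>T (single i x)\<close> are countably many
  bounded functionals of \<open>x\<close>. Condition (C) makes each of them small on a subset, and
  the diagonal argument treats them together.\<close>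

lemma columns_with_small_tails:
  assumes C: "condition_C s e" and T: "lp_op p T K" and p: "1 \<le> p" and A: "infinite A"
  obtains A' where "A' \<subseteq> A" "infinite A'"
    "\<And>a k \<epsilon>. 0 < \<epsilon> \<Longrightarrow> \<forall>\<^sub>F m in sequentially. \<forall>x. supported x (A' \<inter> {m..}) \<longrightarrow>
        \<bar>blinfun_apply (T (single i x) a) (s k)\<bar> \<le> \<epsilon> * norm x"
proof -
  define g where "g a k x = blinfun_apply (T (single i x) a) (s k)" for a k x
  have bl: "bounded_linear (g a k)" for a k
  proof (rule bounded_linear_intro)
    note f = lp_functional_entry[OF T p, of a k]
    show "g a k (x + y) = g a k x + g a k y" for x y
      unfolding g_def single_add by (rule lp_functional_add[OF f single_mem[OF p] single_mem[OF p]])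
    show "g a k (r *\<^sub>R x) = r *\<^sub>R g a k x" for r x
      unfolding g_def single_scaleR by (simp add: lp_functional_scaleR[OF f single_mem[OF p]])
    show "norm (g a k x) \<le> norm x * K" for x
      unfolding g_def using lp_functional_bound[OF f lp_le_single[OF p]] by (simp add: mult.commute)
  qed
  \<comment> \<open>\<open>q\<close> codes a coordinate \<open>(a, k)\<close> together with a
    tolerance.\<close>
  define R where "R q S \<longleftrightarrow> (\<forall>x. supported x S \<longrightarrow>
      \<bar>g (row (row q)) (column (row q)) x\<bar> \<le> 1 / (1 + real (column q)) * norm x)" for q S
  obtain A' where A': "A' \<subseteq> A" "infinite A'" "\<And>q. \<exists>m. R q (A' \<inter> {m..})"
  proof (rule pseudo_intersection[of R A])
    show "R q S'" if "R q S" "S' \<subseteq> S" for q S S'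
      using that supported_mono unfolding R_def by blast
    fix q and S :: "nat set" assume S: "infinite S"
    have "0 < 1 / (1 + real (column q))" by simp
    from functional_small_on_subset[OF C bl S this] obtain S' where "S' \<subseteq> S" "infinite S'"
      "\<And>x. (\<And>j. j \<notin> S' \<Longrightarrow> blinfun_apply x (s j) = 0) \<Longrightarrow>
        \<bar>g (row (row q)) (column (row q)) x\<bar> \<le> 1 / (1 + real (column q)) * norm x" by blast
    then show "\<exists>S'\<subseteq>S. infinite S' \<and> R q S'" unfolding R_def supported_def by blast
  qed (use A in auto)
  show ?thesis
  proof (rule that[OF A'(1,2)])
    fix a k and \<epsilon> :: real assume \<epsilon>: "0 < \<epsilon>"
    obtain j :: nat where "1 / \<epsilon> < real j" using reals_Archimedean2 by blast
    then have j: "1 / (1 + real j) \<le> \<epsilon>" using \<epsilon> by (simp add: field_simps)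
    obtain m where m: "R (prod_encode (prod_encode (a, k), j)) (A' \<inter> {m..})" using A'(3) by blast
    have "\<bar>g a k x\<bar> \<le> \<epsilon> * norm x" if "supported x (A' \<inter> {m'..})" "m \<le> m'" for x m'
    proof -
      have "supported x (A' \<inter> {m..})" by (rule supported_mono[OF that(1)]) (use that(2) in auto)
      then have "\<bar>g a k x\<bar> \<le> 1 / (1 + real j) * norm x" using m unfolding R_def by simp
      also have "\<dots> \<le> \<epsilon> * norm x" using j by (intro mult_right_mono) auto
      finally show ?thesis .
    qed
    then show "\<forall>\<^sub>F m in sequentially. \<forall>x. supported x (A' \<inter> {m..}) \<longrightarrow>
        \<bar>blinfun_apply (T (single i x) a) (s k)\<bar> \<le> \<epsilon> * norm x"
      unfolding eventually_sequentially g_def by blast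
  qed
qed

text \<open>The part of \<open>humps\<close> that concerns one row and holds for \<open>T\<close>
  and its complement alike. The lower bound on the diagonal is kept apart, since it decides between
  the two.\<close>

definition good_columns where
  "good_columns T i A L \<longleftrightarrow> infinite A \<and>
     (\<forall>a k. \<forall>\<epsilon>>0. \<forall>\<^sub>F m in sequentially. \<forall>x. supported x (A \<inter> {m..}) \<longrightarrow>
        \<bar>blinfun_apply (T (single i x) a) (s k)\<bar> \<le> \<epsilon> * norm x) \<and>
     (\<forall>i' j. \<forall>\<epsilon>>0. \<forall>\<^sub>F k in sequentially. k \<in> A \<longrightarrow>
        \<bar>blinfun_apply (T (single i' (e j)) i) (s k) - L i' j\<bar> < \<epsilon>)"

lemma good_columns_subset:
  assumes "good_columns T i A L" "B \<subseteq> A" "infinite B"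
  shows "good_columns T i B L"
  unfolding good_columns_def
proof (intro conjI allI impI)
  show "infinite B" by fact
next
  fix a k and \<epsilon> :: real assume "0 < \<epsilon>"
  then have "\<forall>\<^sub>F m in sequentially. \<forall>x. supported x (A \<inter> {m..}) \<longrightarrow>
        \<bar>blinfun_apply (T (single i x) a) (s k)\<bar> \<le> \<epsilon> * norm x"
    using assms(1) unfolding good_columns_def by blast
  then show "\<forall>\<^sub>F m in sequentially. \<forall>x. supported x (B \<inter> {m..}) \<longrightarrow>
        \<bar>blinfun_apply (T (single i x) a) (s k)\<bar> \<le> \<epsilon> * norm x"
  proof eventually_elim
    case (elim m)
    then show ?case using supported_mono[of _ "B \<inter> {m..}" "A \<inter> {m..}"] assms(2) by blast
  qed
next
  fix i' j and \<epsilon> :: real assume "0 < \<epsilon>"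
  then have "\<forall>\<^sub>F k in sequentially. k \<in> A \<longrightarrow> \<bar>blinfun_apply (T (single i' (e j)) i) (s k) - L i' j\<bar> < \<epsilon>"
    using assms(1) unfolding good_columns_def by blast
  then show "\<forall>\<^sub>F k in sequentially. k \<in> B \<longrightarrow> \<bar>blinfun_apply (T (single i' (e j)) i) (s k) - L i' j\<bar> < \<epsilon>"
    by eventually_elim (use assms(2) in blast)
qed

text \<open>Smaller sets of columns inherit every requirement, so the set may be thinned repeatedly;
  the last time by a pigeonhole on the diagonal entries minus their limits.\<close>

lemma good_columns_exist:
  assumes C: "condition_C s e" and T: "lp_op p T K" and p: "1 \<le> p"
  shows "\<exists>A L. good_columns T i A L \<and>
    ((\<forall>k\<in>A. 1/2 \<le> blinfun_apply (T (single i (e k)) i) (s k) - L i k) \<or>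
     (\<forall>k\<in>A. blinfun_apply (T (single i (e k)) i) (s k) - L i k \<le> 1/2))"
proof -
  obtain A1 where "A1 \<subseteq> UNIV" and A1: "infinite A1"
    "\<And>a k \<epsilon>. 0 < \<epsilon> \<Longrightarrow> \<forall>\<^sub>F m in sequentially. \<forall>x. supported x (A1 \<inter> {m..}) \<longrightarrow>
        \<bar>blinfun_apply (T (single i x) a) (s k)\<bar> \<le> \<epsilon> * norm x"
    by (rule columns_with_small_tails[OF C T p infinite_UNIV_nat, where i = i]) (rule that)
  define f where "f q k = blinfun_apply (T (single (row q) (e (column q))) i) (s k)" for q k
  have fb: "\<bar>f q k\<bar> \<le> K" for q k
    unfolding f_def
    using lp_functional_bound[OF lp_functional_entry[OF T p] lp_le_single[OF p, of "row q" "e (column q)"]]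
    by (simp add: e_norm)
  obtain A2 L where A2: "A2 \<subseteq> A1" "infinite A2"
    "\<And>q \<epsilon>. 0 < \<epsilon> \<Longrightarrow> \<forall>\<^sub>F k in sequentially. k \<in> A2 \<longrightarrow> \<bar>f q k - L q\<bar> < \<epsilon>"
    by (rule convergent_along_subset[OF fb A1(1)]) (rule that)
  define L' where "L' i' j = L (prod_encode (i', j))" for i' j
  have g2: "good_columns T i A2 L'"
    unfolding good_columns_def
  proof (intro conjI allI impI)
    show "infinite A2" by fact
  next
    fix a k and \<epsilon> :: real assume "0 < \<epsilon>"
    from A1(2)[OF this, of a k] show "\<forall>\<^sub>F m in sequentially. \<forall>x. supported x (A2 \<inter> {m..}) \<longrightarrow>
        \<bar>blinfun_apply (T (single i x) a) (s k)\<bar> \<le> \<epsilon> * norm x"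
    proof eventually_elim
      case (elim m)
      then show ?case using supported_mono[of _ "A2 \<inter> {m..}" "A1 \<inter> {m..}"] A2(1) by blast
    qed
  next
    fix i' j and \<epsilon> :: real assume "0 < \<epsilon>"
    from A2(3)[OF this, of "prod_encode (i', j)"]
    show "\<forall>\<^sub>F k in sequentially. k \<in> A2 \<longrightarrow> \<bar>blinfun_apply (T (single i' (e j)) i) (s k) - L' i' j\<bar> < \<epsilon>"
      by (simp add: f_def L'_def)
  qed
  let ?D = "\<lambda>k. blinfun_apply (T (single i (e k)) i) (s k) - L' i k"
  have "A2 \<subseteq> {k\<in>A2. 1/2 \<le> ?D k} \<union> {k\<in>A2. ?D k \<le> 1/2}" by auto
  then have "infinite {k\<in>A2. 1/2 \<le> ?D k} \<or> infinite {k\<in>A2. ?D k \<le> 1/2}"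
    using A2(2) finite_subset unfolding finite_Un[symmetric] de_Morgan_conj[symmetric] by blast
  then show ?thesis
  proof
    assume "infinite {k\<in>A2. 1/2 \<le> ?D k}"
    from good_columns_subset[OF g2 _ this] show ?thesis by blast
  next
    assume "infinite {k\<in>A2. ?D k \<le> 1/2}"
    from good_columns_subset[OF g2 _ this] show ?thesis by blast
  qed
qed

text \<open>The identity is invisible far out: a fixed coordinate \<open>k\<close> vanishes on
  vectors supported after \<open>k\<close>, and \<open>e j\<close> has no coordinate beyond
  \<open>j\<close>. Tails stay small and every limit just changes sign.\<close>

lemma good_columns_id_minus:
  assumes "good_columns T i A L"
  shows "good_columns (\<lambda>y n. y n - T y n) i A (\<lambda>i' j. - L i' j)"
  unfolding good_columns_def
proof (intro conjI allI impI)
  show "infinite A" using assms by (simp add: good_columns_def)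
next
  fix a k and \<epsilon> :: real assume "0 < \<epsilon>"
  then have "\<forall>\<^sub>F m in sequentially. \<forall>x. supported x (A \<inter> {m..}) \<longrightarrow>
        \<bar>blinfun_apply (T (single i x) a) (s k)\<bar> \<le> \<epsilon> * norm x"
    using assms unfolding good_columns_def by blast
  with eventually_gt_at_top[of k] show "\<forall>\<^sub>F m in sequentially. \<forall>x. supported x (A \<inter> {m..}) \<longrightarrow>
        \<bar>blinfun_apply (single i x a - T (single i x) a) (s k)\<bar> \<le> \<epsilon> * norm x"
  proof eventually_elim
    case (elim m)
    show ?case
    proof (intro allI impI)
      fix x assume x: "supported x (A \<inter> {m..})"
      then have "blinfun_apply (single i x a) (s k) = 0"
        using elim(1) by (simp add: single_def supported_def)
      then show "\<bar>blinfun_apply (single i x a - T (single i x) a) (s k)\<bar> \<le> \<epsilon> * norm x"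
        using elim(2) x by (simp add: blinfun.diff_left)
    qed
  qed
next
  fix i' j and \<epsilon> :: real assume "0 < \<epsilon>"
  then have "\<forall>\<^sub>F k in sequentially. k \<in> A \<longrightarrow> \<bar>blinfun_apply (T (single i' (e j)) i) (s k) - L i' j\<bar> < \<epsilon>"
    using assms unfolding good_columns_def by blast
  with eventually_gt_at_top[of j]
  show "\<forall>\<^sub>F k in sequentially. k \<in> A \<longrightarrow>
      \<bar>blinfun_apply (single i' (e j) i - T (single i' (e j)) i) (s k) - - L i' j\<bar> < \<epsilon>"
  proof eventually_elim
    case (elim k)
    then have "blinfun_apply (single i' (e j) i) (s k) = 0" by (simp add: single_def e_s)
    then show ?case using elim(2) by (simp add: blinfun.diff_left abs_minus_commute)
  qed
qed

text \<open>Thinning \<open>I\<close> to rows on whose tails all coordinate functionals vanish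
  supplies the last clause of \<open>humps\<close>; the surviving rows are renumbered by
  \<open>\<rho>\<close>.\<close>

lemma humpsI:
  fixes T :: "(nat \<Rightarrow> ('a \<Rightarrow>\<^sub>L real)) \<Rightarrow> nat \<Rightarrow> ('a \<Rightarrow>\<^sub>L real)"
  assumes T: "lp_op p T K" and p: "1 \<le> p" and I: "infinite I"
    and good: "\<And>i. i \<in> I \<Longrightarrow> good_columns T i (A i) (L i)"
    and diag: "\<And>i k. i \<in> I \<Longrightarrow> k \<in> A i \<Longrightarrow> 1/2 \<le> blinfun_apply (T (single i (e k)) i) (s k) - L i i k"
  shows "\<exists>\<rho> A L. humps p T \<rho> A L"
proof -
  obtain I' where I': "I' \<subseteq> I" "infinite I'"
    and tail: "\<And>q y. y \<in> lp_space p \<Longrightarrow> (\<And>n. n \<notin> I' \<Longrightarrow> y n = 0) \<Longrightarrow>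
       (\<lambda>m. blinfun_apply (T (\<lambda>n. if m \<le> n then y n else 0) (row q)) (s (column q))) \<longlonglongrightarrow> 0"
  proof (rule rows_with_vanishing_tails[of p "\<lambda>q w. blinfun_apply (T w (row q)) (s (column q))" "\<lambda>q. K",
        OF lp_functional_entry[OF T p] p I], goal_cases)
    case (1 I')
    show ?case by (rule 1(1)[OF 1(2,3)]) (fact 1(4))
  qed
  define \<rho> where "\<rho> = enumerate I'"
  have \<rho>: "inj \<rho>" "range \<rho> = I'"
    unfolding \<rho>_def using strict_mono_enumerate[OF I'(2)] range_enumerate[OF I'(2)]
    by (auto simp: strict_mono_imp_inj_on)
  have \<rho>I: "\<rho> i \<in> I" for i using \<rho>(2) I'(1) by blast
  have "humps p T \<rho> (\<lambda>i. A (\<rho> i)) (\<lambda>i i' j. L (\<rho> i) (\<rho> i') j)"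
    unfolding humps_def
  proof (intro conjI allI impI ballI)
    fix y :: "nat \<Rightarrow> ('a \<Rightarrow>\<^sub>L real)" and a k
    assume "y \<in> lp_space p" "\<forall>n. n \<notin> range \<rho> \<longrightarrow> y n = 0"
    then show "(\<lambda>m. blinfun_apply (T (\<lambda>n. if m \<le> n then y n else 0) a) (s k)) \<longlonglongrightarrow> 0"
      using tail[of y "prod_encode (a, k)"] \<rho>(2) by simp
  qed (use \<rho>(1) good[OF \<rho>I] diag[OF \<rho>I] in \<open>auto simp: good_columns_def\<close>)
  then show ?thesis by blast
qed

text \<open>Let \<open>D\<close> be a diagonal entry of \<open>T\<close> minus its limit. For
  \<open>Id - T\<close> the same quantity is \<open>1 - D\<close>, so \<open>1/2\<close> is the
  threshold at which the two sides swap. If \<open>D \<ge> 1/2\<close> throughout only finitely many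
  rows, then \<open>D \<le> 1/2\<close> throughout infinitely many.\<close>

lemma factorization_through_operator_or_complement:
  fixes T :: "(nat \<Rightarrow> ('a \<Rightarrow>\<^sub>L real)) \<Rightarrow> nat \<Rightarrow> ('a \<Rightarrow>\<^sub>L real)"
  assumes C: "condition_C s e" and T: "lp_op p T K" and p: "1 \<le> p"
  shows "\<exists>H\<in>{T, \<lambda>y n. y n - T y n}. \<exists>M N. lp_op p M Cs \<and> lp_op p N (16 * Cu^2 * Cs) \<and>
    (\<forall>y\<in>lp_space p. N (H (M y)) = y)"
proof -
  obtain A L where good: "\<And>i. good_columns T i (A i) (L i)"
    and dich: "\<And>i. (\<forall>k\<in>A i. 1/2 \<le> blinfun_apply (T (single i (e k)) i) (s k) - L i i k) \<or>
     (\<forall>k\<in>A i. blinfun_apply (T (single i (e k)) i) (s k) - L i i k \<le> 1/2)"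
    using good_columns_exist[OF C T p] by metis
  let ?I = "{i. \<forall>k\<in>A i. 1/2 \<le> blinfun_apply (T (single i (e k)) i) (s k) - L i i k}"
  show ?thesis
  proof (cases "infinite ?I")
    case True
    have "\<exists>\<rho> A L. humps p T \<rho> A L" by (rule humpsI[OF T p True good]) auto
    then obtain \<rho> A L where "humps p T \<rho> A L" by blast
    then obtain M N where "lp_op p M Cs" "lp_op p N (16 * Cu^2 * Cs)" "\<And>y. y \<in> lp_space p \<Longrightarrow> N (T (M y)) = y"
      by (rule factorization_of_identity[OF T p]) (rule that)
    then show ?thesis by (intro bexI[of _ T] exI[of _ M] exI[of _ N]) auto
  next
    case False
    then have "finite ?I" by blast
    then have inf: "infinite (- ?I)" using finite_compl infinite_UNIV_nat by blast
    let ?H = "\<lambda>y n. y n - T y n"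
    have H: "lp_op p ?H (1 + K)" by (rule lp_op_minus[OF lp_op_id[OF p] T p])
    have "\<exists>\<rho> A L. humps p ?H \<rho> A L"
    proof (rule humpsI[OF H p inf good_columns_id_minus[OF good]])
      fix i k assume "i \<in> - ?I" "k \<in> A i"
      then have "blinfun_apply (T (single i (e k)) i) (s k) - L i i k \<le> 1/2" using dich[of i] by auto
      then show "1/2 \<le> blinfun_apply (single i (e k) i - T (single i (e k)) i) (s k) - - L i i k"
        by (simp add: blinfun.diff_left single_def e_s)
    qed
    then obtain \<rho> A L where "humps p ?H \<rho> A L" by blast
    then obtain M N where "lp_op p M Cs" "lp_op p N (16 * Cu^2 * Cs)" "\<And>y. y \<in> lp_space p \<Longrightarrow> N (?H (M y)) = y"
      by (rule factorization_of_identity[OF H p]) (rule that)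
    then show ?thesis by (intro bexI[of _ ?H] exI[of _ M] exI[of _ N]) auto
  qed
qed

end

section \<open>Decomposition\<close>

text \<open>A sequence is read as a sequence of blocks through \<open>prod_encode\<close>; this is
  the isometry of \<open>E = \<ell>\<^sup>p(X)\<close> with
  \<open>\<ell>\<^sup>p(E)\<close>.\<close>

definition blk :: "nat \<Rightarrow> (nat \<Rightarrow> 'b) \<Rightarrow> nat \<Rightarrow> 'b" where
  "blk n u i = u (prod_encode (n, i))"

definition blockwise :: "((nat \<Rightarrow> 'b) \<Rightarrow> nat \<Rightarrow> 'b) \<Rightarrow> (nat \<Rightarrow> 'b) \<Rightarrow> nat \<Rightarrow> 'b" where
  "blockwise T u t = T (blk (fst (prod_decode t)) u) (snd (prod_decode t))"

text \<open>Realises \<open>E \<oplus> E \<cong> E\<close>: a new block goes in front and all others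
  move up by one.\<close>

definition push :: "(nat \<Rightarrow> 'b) \<Rightarrow> (nat \<Rightarrow> 'b) \<Rightarrow> nat \<Rightarrow> 'b" where
  "push v u t = (case fst (prod_decode t) of 0 \<Rightarrow> v (snd (prod_decode t))
     | Suc n \<Rightarrow> u (prod_encode (n, snd (prod_decode t))))"

definition pop :: "(nat \<Rightarrow> 'b) \<Rightarrow> nat \<Rightarrow> 'b" where
  "pop u t = u (prod_encode (Suc (fst (prod_decode t)), snd (prod_decode t)))"

lemma blk_blockwise: "blk n (blockwise T u) = T (blk n u)"
  by (rule ext) (simp add: blk_def blockwise_def)

lemma blk_push: "blk 0 (push v u) = v" "blk (Suc n) (push v u) = blk n u"
  by (rule ext; simp add: blk_def push_def)+

lemma blk_pop: "blk n (pop u) = blk (Suc n) u"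
  by (rule ext) (simp add: blk_def pop_def)

lemma blk_eqI: "(\<And>n. blk n u = blk n v) \<Longrightarrow> u = v"
  by (rule ext) (metis blk_def prod_decode_inverse prod.collapse)

lemma pop_push: "pop (push v u) = u"
  by (rule blk_eqI) (simp add: blk_pop blk_push)

lemma push_pop: "push (blk 0 u) (pop u) = u"
proof (rule blk_eqI)
  show "blk n (push (blk 0 u) (pop u)) = blk n u" for n by (cases n) (simp_all add: blk_push blk_pop)
qed

lemma blk_add: "blk n (\<lambda>t. u t + v t) = (\<lambda>i. blk n u i + blk n v i)"
  by (rule ext) (simp add: blk_def)

lemma blk_diff: "blk n (\<lambda>t. u t - v t) = (\<lambda>i. blk n u i - blk n v i)"
  by (rule ext) (simp add: blk_def)

lemma blk_scaleR: "blk n (\<lambda>t. c *\<^sub>R u t) = (\<lambda>i. c *\<^sub>R blk n u i)"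
  by (rule ext) (simp add: blk_def)

lemma inj_prod_encode_row: "inj (\<lambda>i. prod_encode (n, i))"
  by (rule injI) (simp add: prod_encode_eq)

lemma lp_le_blk: "lp_le p u K \<Longrightarrow> lp_le p (blk n u) K"
  unfolding blk_def[abs_def] by (rule lp_le_reindex[OF _ inj_prod_encode_row])

lemma blk_mem: "1 \<le> p \<Longrightarrow> u \<in> lp_space p \<Longrightarrow> blk n u \<in> lp_space p"
  unfolding mem_lp_space_iff using lp_le_blk by blast

lemma lp_op_blk: "1 \<le> p \<Longrightarrow> lp_op p (blk n) 1"
  by (rule lp_opI) (simp_all add: lp_le_blk blk_add blk_scaleR)

lemma lp_op_pop: "1 \<le> p \<Longrightarrow> lp_op p pop 1"
proof (rule lp_opI)
  have inj: "inj (\<lambda>t. prod_encode (Suc (fst (prod_decode t)), snd (prod_decode t)))"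
    by (rule injI) (metis Pair_inject Suc_inject prod_decode_inverse prod_encode_eq prod.collapse)
  show "lp_le p (pop y) (1 * K)" if "lp_le p y K" for y :: "nat \<Rightarrow> 'b::real_normed_vector" and K
    using lp_le_reindex[OF that inj] by (simp add: pop_def[abs_def])
qed (auto simp: pop_def)

text \<open>\<open>push\<close> is a sum of two isometric embeddings onto disjoint sets of indices;
  adding the constants is crude, but an isomorphism only asks for some constant.\<close>

lemma lp_op_push:
  assumes "lp_op p S C" "lp_op p T D" "1 \<le> p"
  shows "lp_op p (\<lambda>y. push (S y) (T y)) (C + D)"
proof (rule lp_opI)
  show "0 \<le> C + D" using assms by (simp add: lp_op_nonneg)
  fix y :: "nat \<Rightarrow> 'a" and K assume y: "lp_le p y K"
  have push0: "push v u = (\<lambda>t. push v (\<lambda>_. 0) t + push (\<lambda>_. 0) u t)" for u v :: "nat \<Rightarrow> 'a"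
    by (rule ext) (simp add: push_def split: nat.split)
  have "lp_le p (push v (\<lambda>_. 0)) L" if "lp_le p v L" for v :: "nat \<Rightarrow> 'a" and L
  proof (rule lp_le_extend[OF _ inj_prod_encode_row])
    show "lp_le p (\<lambda>n. push v (\<lambda>_. 0) (prod_encode (0, n))) L" using that by (simp add: push_def)
    show "push v (\<lambda>_. 0) m = 0" if "m \<notin> range (\<lambda>i. prod_encode (0, i))" for m
    proof -
      obtain n i where m: "m = prod_encode (n, i)" by (metis prod_decode_inverse prod.collapse)
      then show ?thesis using that by (cases n) (auto simp: push_def)
    qed
  qed
  moreover have "lp_le p (push (\<lambda>_. 0) u) L" if "lp_le p u L" for u :: "nat \<Rightarrow> 'a" and L
  proof (rule lp_le_extend)
    let ?r = "\<lambda>t. prod_encode (Suc (fst (prod_decode t)), snd (prod_decode t))"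
    show "inj ?r" by (rule injI) (metis Pair_inject Suc_inject prod_decode_inverse prod_encode_eq prod.collapse)
    show "lp_le p (\<lambda>n. push (\<lambda>_. 0) u (?r n)) L" using that by (simp add: push_def)
    show "push (\<lambda>_. 0) u m = 0" if "m \<notin> range ?r" for m
    proof (cases "fst (prod_decode m)")
      case (Suc n)
      have "m = ?r (prod_encode (n, snd (prod_decode m)))"
        using Suc by (simp flip: Suc)
      then show ?thesis using that by blast
    qed (simp add: push_def)
  qed
  ultimately show "lp_le p (push (S y) (T y)) ((C + D) * K)"
    unfolding push0[of "S y" "T y"] distrib_right
    using lp_op_le[OF assms(1) y] lp_op_le[OF assms(2) y] by (intro lp_le_add assms(3)) blast+
qed (use assms in \<open>auto simp: push_def lp_op_add[OF assms(1)] lp_op_add[OF assms(2)] lp_op_scaleR[OF assms(1)]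
       lp_op_scaleR[OF assms(2)] split: nat.split\<close>)

lemma lp_op_plus:
  assumes "lp_op p S C" "lp_op p T D" "1 \<le> p"
  shows "lp_op p (\<lambda>y n. S y n + T y n) (C + D)"
proof (rule lp_opI)
  show "lp_le p (\<lambda>n. S y n + T y n) ((C + D) * K)" if "lp_le p y K" for y K
    using lp_le_add[OF lp_op_le[OF assms(1) that] lp_op_le[OF assms(2) that] assms(3)]
    by (simp add: distrib_right)
qed (use assms in
      \<open>auto simp: lp_op_nonneg lp_op_add[OF assms(1)] lp_op_add[OF assms(2)] lp_op_scaleR[OF assms(1)] lp_op_scaleR[OF assms(2)]
         scaleR_add_right\<close>)

text \<open>One half of Fubini for nonnegative terms: finite rectangles obey the hypothesis, and the
  inner limits pass through the finite outer sum.\<close>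

lemma sum_blocks_le:
  fixes a :: "nat \<Rightarrow> real"
  assumes "\<And>t. 0 \<le> a t" and "\<And>G. finite G \<Longrightarrow> sum a G \<le> S"
  shows "summable (\<lambda>i. a (prod_encode (n, i)))"
    and "(\<Sum>n<m. \<Sum>i. a (prod_encode (n, i))) \<le> S"
proof -
  have part: "(\<Sum>n<m. \<Sum>i<k. a (prod_encode (n, i))) \<le> S" for m k
  proof -
    have "(\<Sum>n<m. \<Sum>i<k. a (prod_encode (n, i))) = (\<Sum>x\<in>{..<m} \<times> {..<k}. a (prod_encode x))"
      by (simp add: sum.cartesian_product)
    also have "\<dots> = sum a (prod_encode ` ({..<m} \<times> {..<k}))"
      by (simp add: sum.reindex inj_prod_encode)
    also have "\<dots> \<le> S" by (intro assms(2)) simp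
    finally show ?thesis .
  qed
  show s: "summable (\<lambda>i. a (prod_encode (n, i)))" for n
  proof (rule bounded_imp_summable)
    fix k
    have "(\<Sum>i\<le>k. a (prod_encode (n, i))) = sum a ((\<lambda>i. prod_encode (n, i)) ` {..k})"
      using inj_prod_encode_row by (subst sum.reindex) (auto intro: inj_on_subset)
    also have "\<dots> \<le> S" by (intro assms(2)) simp
    finally show "(\<Sum>i\<le>k. a (prod_encode (n, i))) \<le> S" .
  qed (use assms(1) in auto)
  have "(\<lambda>k. \<Sum>n<m. \<Sum>i<k. a (prod_encode (n, i))) \<longlonglongrightarrow> (\<Sum>n<m. \<Sum>i. a (prod_encode (n, i)))"
    by (intro tendsto_sum summable_LIMSEQ s)
  then show "(\<Sum>n<m. \<Sum>i. a (prod_encode (n, i))) \<le> S"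
    by (rule tendsto_upperbound) (simp_all add: part)
qed

text \<open>For finite \<open>p\<close> each block is estimated with its own norm
  \<open>L n powr (1/r)\<close>, since a common bound \<open>K\<close> could not be summed over the
  blocks; the \<open>r\<close>-th powers then add up.\<close>

lemma lp_op_blockwise:
  fixes T :: "(nat \<Rightarrow> 'b::real_normed_vector) \<Rightarrow> nat \<Rightarrow> 'b"
  assumes T: "lp_op p T C" and p: "1 \<le> p"
  shows "lp_op p (blockwise T) C"
proof (rule lp_opI)
  show C: "0 \<le> C" using T by (rule lp_op_nonneg)
  fix u :: "nat \<Rightarrow> 'b" and K assume u: "lp_le p u K"
  have K: "0 \<le> K" using u by (rule lp_le_nonneg)
  show "lp_le p (blockwise T u) (C * K)"
  proof (cases "p = \<infinity>")
    case True
    have "norm (blockwise T u t) \<le> C * K" for t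
      unfolding blockwise_def by (rule lp_le_coord[OF lp_op_le[OF T lp_le_blk[OF u]] p])
    then show ?thesis using True C K by (simp add: lp_le_def)
  next
    case False
    define r where "r = real_of_ereal p"
    have r: "1 \<le> r" using real_of_ereal_ge_1[OF p False] by (simp add: r_def)
    define a where "a t = norm (u t) powr r" for t
    have aK: "sum a G \<le> K powr r" if "finite G" for G
      using u False that by (simp add: lp_le_def a_def r_def)
    have s: "summable (\<lambda>i. a (prod_encode (n, i)))" for n
      by (rule sum_blocks_le(1)[where S = "K powr r"]) (auto simp: a_def[abs_def] aK[unfolded a_def[abs_def]])
    have S: "(\<Sum>n<m. \<Sum>i. a (prod_encode (n, i))) \<le> K powr r" for m
      by (rule sum_blocks_le(2)) (auto simp: a_def[abs_def] aK[unfolded a_def[abs_def]])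
    define L where "L n = (\<Sum>i. a (prod_encode (n, i)))" for n
    have L0: "0 \<le> L n" for n unfolding L_def by (intro suminf_nonneg s) (simp add: a_def)
    have blkL: "lp_le p (blk n u) (L n powr (1/r))" for n
    proof -
      have "(\<Sum>i\<in>F. norm (blk n u i) powr r) \<le> L n" if "finite F" for F
        unfolding L_def blk_def a_def[symmetric] using that by (intro sum_le_suminf s) (auto simp: a_def)
      then show ?thesis using False r L0 by (simp add: lp_le_def r_def[symmetric] powr_powr)
    qed
    have rowb: "(\<Sum>i<k. norm (blockwise T u (prod_encode (n, i))) powr r) \<le> C powr r * L n" for n k
    proof -
      have "lp_le p (T (blk n u)) (C * L n powr (1/r))" by (rule lp_op_le[OF T blkL])
      then have "(\<Sum>i<k. norm (T (blk n u) i) powr r) \<le> (C * L n powr (1/r)) powr r"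
        using False by (simp add: lp_le_def r_def)
      also have "\<dots> = C powr r * L n" using C L0 r by (simp add: powr_mult powr_powr)
      finally show ?thesis by (simp add: blockwise_def)
    qed
    have "(\<Sum>t\<in>F. norm (blockwise T u t) powr r) \<le> (C * K) powr r" if F: "finite F" for F
    proof -
      let ?g = "\<lambda>t. norm (blockwise T u t) powr r"
      obtain N where N: "F \<subseteq> {..<N}" using F finite_nat_iff_bounded by blast
      \<comment> \<open>A code is at least as large as both its components, so a finite set below
        \<open>N\<close> fits into an \<open>N\<close> by \<open>N\<close> square of
        positions.\<close>
      have sub: "F \<subseteq> prod_encode ` ({..<N} \<times> {..<N})"
      proof
        fix t assume "t \<in> F"
        then have "t < N" using N by blast
        moreover obtain n i where t: "t = prod_encode (n, i)" by (metis prod_decode_inverse prod.collapse)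
        ultimately show "t \<in> prod_encode ` ({..<N} \<times> {..<N})"
          using le_prod_encode_1[of n i] le_prod_encode_2[of i n] by auto
      qed
      have "sum ?g F \<le> sum ?g (prod_encode ` ({..<N} \<times> {..<N}))" by (rule sum_mono2) (use sub in auto)
      also have "\<dots> = (\<Sum>n<N. \<Sum>i<N. ?g (prod_encode (n, i)))"
        by (simp add: sum.reindex inj_prod_encode sum.cartesian_product)
      also have "\<dots> \<le> (\<Sum>n<N. C powr r * L n)" by (intro sum_mono rowb)
      also have "\<dots> \<le> C powr r * K powr r"
        using S[of N] by (simp add: L_def mult_left_mono flip: sum_distrib_left)
      also have "\<dots> = (C * K) powr r" using C K by (simp add: powr_mult)
      finally show ?thesis .
    qed
    then show ?thesis using False C K by (simp add: lp_le_def r_def)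
  qed
next
  fix y z :: "nat \<Rightarrow> 'b" assume "y \<in> lp_space p" "z \<in> lp_space p"
  then show "blockwise T (\<lambda>n. y n + z n) = (\<lambda>n. blockwise T y n + blockwise T z n)"
    by (intro ext) (simp add: blockwise_def blk_add lp_op_add[OF T] blk_mem[OF p])
next
  fix y :: "nat \<Rightarrow> 'b" and c assume "y \<in> lp_space p"
  then show "blockwise T (\<lambda>n. c *\<^sub>R y n) = (\<lambda>n. c *\<^sub>R blockwise T y n)"
    by (intro ext) (simp add: blockwise_def blk_scaleR lp_op_scaleR[OF T] blk_mem[OF p])
qed

text \<open>Pelczynski's decomposition, with the isomorphism written out. For \<open>V = H(E)\<close>, \<open>E = \<ell>\<^sup>p(X)\<close>
  and \<open>W = {w \<in> V. N w = 0}\<close> it is the composition of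
  \<open>V \<cong> W \<oplus> E\<close>, \<open>v \<mapsto> (v - H M N v, N v)\<close>, of \<open>E \<cong> E \<oplus> E\<close>, which splits off the first block,
  of \<open>W \<oplus> E \<cong> V\<close>, and of the isomorphism \<open>V \<oplus> E \<cong> E\<close> that shifts the \<open>V\<close>-components of the blocks
  and is inverted by the block maps \<open>e \<mapsto> H (blk 0 e)\<close> and \<open>unabsorb H\<close>.\<close>

definition absorb where
  "absorb H v u = (\<lambda>t. push v (blockwise H u) t + (u t - blockwise H u t))"

definition unabsorb where
  "unabsorb H y = (\<lambda>t. blockwise H (pop y) t + (y t - blockwise H y t))"

text \<open>Adding an element of the kernel does not change the value of \<open>H\<close>, so
  \<open>H\<close> separates range part and kernel part in every block. \<open>absorb\<close> moves
  the range parts up by one block and leaves the kernel parts in place, which can be undone block by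
  block.\<close>

lemma idempotent_absorb:
  fixes H :: "(nat \<Rightarrow> 'a::real_normed_vector) \<Rightarrow> nat \<Rightarrow> 'a"
  assumes H: "lp_op p H C" and p: "1 \<le> p" and idem: "\<And>y. y \<in> lp_space p \<Longrightarrow> H (H y) = H y"
  shows blk_0_absorb: "v \<in> lp_space p \<Longrightarrow> H v = v \<Longrightarrow> u \<in> lp_space p \<Longrightarrow> H (blk 0 (absorb H v u)) = v"
    and unabsorb_absorb: "v \<in> lp_space p \<Longrightarrow> H v = v \<Longrightarrow> u \<in> lp_space p \<Longrightarrow> unabsorb H (absorb H v u) = u"
    and absorb_unabsorb: "y \<in> lp_space p \<Longrightarrow> absorb H (H (blk 0 y)) (unabsorb H y) = y"
proof -
  have mem: "H x \<in> lp_space p" if "x \<in> lp_space p" for x by (rule lp_op_mem[OF H p that])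
  have split: "H (\<lambda>i. H x i + (y i - H y i)) = H x" if "x \<in> lp_space p" "y \<in> lp_space p" for x y
    by (simp add: lp_op_add[OF H] lp_op_diff[OF H p] mem that lp_space_diff[OF p] idem)
  have blk0: "blk 0 (absorb H v u) = (\<lambda>i. v i + (blk 0 u i - H (blk 0 u) i))" for v u
    by (simp add: absorb_def blk_add blk_diff blk_push blk_blockwise)
  have blkS: "blk (Suc n) (absorb H v u) = (\<lambda>i. H (blk n u) i + (blk (Suc n) u i - H (blk (Suc n) u) i))" for v u n
    by (simp add: absorb_def blk_add blk_diff blk_push blk_blockwise)
  have blkU: "blk n (unabsorb H y) = (\<lambda>i. H (blk (Suc n) y) i + (blk n y i - H (blk n y) i))" for n y
    by (simp add: unabsorb_def blk_add blk_diff blk_blockwise blk_pop)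
  {
    fix v u :: "nat \<Rightarrow> 'a" assume v: "v \<in> lp_space p" "H v = v" and u: "u \<in> lp_space p"
    show 0: "H (blk 0 (absorb H v u)) = v"
      using split[OF v(1) blk_mem[OF p u, of 0]] by (simp add: blk0 v(2))
    have S: "H (blk (Suc n) (absorb H v u)) = H (blk n u)" for n
      unfolding blkS by (rule split[OF blk_mem[OF p u] blk_mem[OF p u]])
    show "unabsorb H (absorb H v u) = u"
    proof (rule blk_eqI)
      fix n
      show "blk n (unabsorb H (absorb H v u)) = blk n u"
      proof (cases n)
        case 0
        then show ?thesis unfolding blkU S using \<open>H (blk 0 (absorb H v u)) = v\<close> by (simp add: blk0)
      next
        case (Suc m)
        then show ?thesis unfolding blkU S Suc by (simp add: blkS)
      qed
    qed
  next
    fix y :: "nat \<Rightarrow> 'a" assume y: "y \<in> lp_space p"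
    have S: "H (blk n (unabsorb H y)) = H (blk (Suc n) y)" for n
      unfolding blkU by (rule split[OF blk_mem[OF p y] blk_mem[OF p y]])
    show "absorb H (H (blk 0 y)) (unabsorb H y) = y"
    proof (rule blk_eqI)
      fix n
      show "blk n (absorb H (H (blk 0 y)) (unabsorb H y)) = blk n y"
      proof (cases n)
        case 0
        then show ?thesis unfolding 0 blk0 S by (simp add: blkU)
      next
        case (Suc m)
        then show ?thesis unfolding Suc blkS S by (simp add: blkU)
      qed
    qed
  }
qed

text \<open>\<open>J\<close> embeds the whole space into the range of \<open>H\<close>, with left
  inverse \<open>N\<close>. The embedded copy gives up its first block as \<open>f2\<close> and
  closes the gap in \<open>f1\<close>, which stays in the range; \<open>absorb\<close> then fuses
  the two into the whole space.\<close>

lemma idempotent_range_isomorphic: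
  fixes H :: "(nat \<Rightarrow> 'a::real_normed_vector) \<Rightarrow> nat \<Rightarrow> 'a"
  assumes H: "lp_op p H C" and M: "lp_op p M D" and N: "lp_op p N F" and p: "1 \<le> p"
    and idem: "\<And>y. y \<in> lp_space p \<Longrightarrow> H (H y) = H y"
    and NHM: "\<And>y. y \<in> lp_space p \<Longrightarrow> N (H (M y)) = y"
  shows "lp_isomorphic p (H ` lp_space p) (lp_space p)"
proof -
  define J where "J y = H (M y)" for y
  have J: "lp_op p J (C * D)" unfolding J_def by (rule lp_op_compose[OF H M p])
  have NJ: "N (J y) = y" if "y \<in> lp_space p" for y using NHM that by (simp add: J_def)
  have HJ: "H (J y) = J y" if "y \<in> lp_space p" for y using idem lp_op_mem[OF M p that] by (simp add: J_def)
  have b0: "lp_op p (blk 0) 1" and pop: "lp_op p pop 1" by (rule lp_op_blk[OF p], rule lp_op_pop[OF p])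
  have Hb: "lp_op p (blockwise H) C" by (rule lp_op_blockwise[OF H p])
  note comp = lp_op_compose[OF _ _ p]
  \<comment> \<open>The component of \<open>v\<close> in the kernel of \<open>N\<close>,
    complementary to the embedded copy.\<close>
  define proj where "proj v = (\<lambda>n. v n - J (N v) n)" for v
  define f1 where "f1 v = (\<lambda>n. J (pop (N v)) n + proj v n)" for v
  define f2 where "f2 v = blk 0 (N v)" for v
  define f where "f v = absorb H (f1 v) (f2 v)" for v
  define g1 where "g1 y = H (blk 0 y)" for y
  define g2 where "g2 y = push (unabsorb H y) (N (g1 y))" for y
  define g where "g y = (\<lambda>n. J (g2 y) n + proj (g1 y) n)" for y
  have proj: "\<exists>K. lp_op p proj K"
    using lp_op_minus[OF lp_op_id[OF p] comp[OF J N] p] unfolding proj_def by blast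
  have f1: "\<exists>K. lp_op p f1 K"
    using lp_op_plus[OF comp[OF J comp[OF pop N]] _ p] proj unfolding f1_def by blast
  have f2: "\<exists>K. lp_op p f2 K" using comp[OF b0 N] unfolding f2_def by blast
  have f: "\<exists>K. lp_op p f K"
  proof -
    obtain K1 K2 where K: "lp_op p f1 K1" "lp_op p f2 K2" using f1 f2 by blast
    from lp_op_plus[OF lp_op_push[OF K(1) comp[OF Hb K(2)] p] lp_op_minus[OF K(2) comp[OF Hb K(2)] p] p]
    show ?thesis unfolding f_def absorb_def by blast
  qed
  have g1: "\<exists>K. lp_op p g1 K" using comp[OF H b0] unfolding g1_def by blast
  have un: "\<exists>K. lp_op p (unabsorb H) K"
    using lp_op_plus[OF comp[OF Hb pop] lp_op_minus[OF lp_op_id[OF p] Hb p] p]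
    unfolding unabsorb_def[abs_def] by blast
  have g2: "\<exists>K. lp_op p g2 K"
    using lp_op_push[OF _ comp[OF N] p] un g1 unfolding g2_def by blast
  have g: "\<exists>K. lp_op p g K"
  proof -
    obtain K1 K2 K3 where K: "lp_op p g1 K1" "lp_op p g2 K2" "lp_op p proj K3" using g1 g2 proj by blast
    from lp_op_plus[OF comp[OF J K(2)] comp[OF K(3) K(1)] p] show ?thesis unfolding g_def by blast
  qed
  have mem: "J y \<in> lp_space p" "N y \<in> lp_space p" "pop y \<in> lp_space p" "blk 0 y \<in> lp_space p"
    "proj y \<in> lp_space p" "H y \<in> lp_space p" "f1 y \<in> lp_space p" "f2 y \<in> lp_space p" "f y \<in> lp_space p"
    "g1 y \<in> lp_space p" "g2 y \<in> lp_space p" "g y \<in> lp_space p" "unabsorb H y \<in> lp_space p"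
    if "y \<in> lp_space p" for y
    using that J N pop b0 proj H f1 f2 f g1 g2 g un lp_op_mem[OF _ p] by blast+
  have Hproj: "H (proj v) = proj v" if "v \<in> lp_space p" "H v = v" for v
    using that unfolding proj_def by (simp add: lp_op_diff[OF H p] mem HJ)
  have Nproj: "N (proj v) = (\<lambda>n. 0)" if "v \<in> lp_space p" for v
    using that unfolding proj_def by (simp add: lp_op_diff[OF N p] mem NJ)
  have Hf1: "H (f1 v) = f1 v" if "v \<in> lp_space p" "H v = v" for v
    using that unfolding f1_def by (simp add: lp_op_add[OF H] mem HJ Hproj)
  have Nf1: "N (f1 v) = pop (N v)" if "v \<in> lp_space p" for v
    using that unfolding f1_def by (simp add: lp_op_add[OF N] mem NJ Nproj)
  \<comment> \<open>Only the embedded copy is rearranged by \<open>f1\<close>, so \<open>v\<close>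
    can be rebuilt from \<open>proj (f1 v)\<close> and \<open>N v\<close>.\<close>
  have projf1: "proj (f1 v) = proj v" if "v \<in> lp_space p" for v
    unfolding proj_def[of "f1 v"] Nf1[OF that] by (simp add: f1_def)
  have Hg1: "H (g1 y) = g1 y" if "y \<in> lp_space p" for y unfolding g1_def by (rule idem) (rule mem(4)[OF that])
  have Ng: "N (g y) = g2 y" if "y \<in> lp_space p" for y
    using that unfolding g_def by (simp add: lp_op_add[OF N] mem NJ Nproj)
  have Hg: "H (g y) = g y" if "y \<in> lp_space p" for y
    using that unfolding g_def by (simp add: lp_op_add[OF H] mem HJ Hproj Hg1)
  have projg: "proj (g y) = proj (g1 y)" if "y \<in> lp_space p" for y
    unfolding proj_def[of "g y"] Ng[OF that] by (simp add: g_def)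
  have gf: "g (f v) = v" if v: "v \<in> lp_space p" "H v = v" for v
  proof -
    have "g1 (f v) = f1 v"
      unfolding g1_def f_def by (rule blk_0_absorb[OF H p idem mem(7)[OF v(1)] Hf1[OF v] mem(8)[OF v(1)]])
    moreover have "unabsorb H (f v) = f2 v"
      unfolding f_def by (rule unabsorb_absorb[OF H p idem mem(7)[OF v(1)] Hf1[OF v] mem(8)[OF v(1)]])
    ultimately have "g2 (f v) = N v"
      unfolding g2_def by (simp add: Nf1[OF v(1)] f2_def push_pop)
    then show ?thesis unfolding g_def using \<open>g1 (f v) = f1 v\<close> projf1[OF v(1)] by (simp add: proj_def)
  qed
  have fg: "f (g y) = y" if y: "y \<in> lp_space p" for y
  proof -
    have "f1 (g y) = g1 y"
      unfolding f1_def Ng[OF y] projg[OF y] by (simp add: g2_def pop_push proj_def)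
    moreover have "f2 (g y) = unabsorb H y"
      unfolding f2_def Ng[OF y] by (simp add: g2_def blk_push)
    ultimately show ?thesis
      unfolding f_def g1_def using absorb_unabsorb[OF H p idem y] by simp
  qed
  have V: "v \<in> lp_space p \<and> H v = v" if "v \<in> H ` lp_space p" for v
    using that idem mem(6) by auto
  obtain Kf Kg where K: "lp_op p f Kf" "lp_op p g Kg" using f g by blast
  have bound: "lp_norm p (S y) \<le> K * lp_norm p y" if "lp_op p S K" "y \<in> lp_space p" for S K y
    using lp_op_le[OF that(1) lp_leI[OF p that(2)]] lp_le_iff[OF p] by blast
  show ?thesis
    unfolding lp_isomorphic_def
  proof (rule exI[of _ f], rule exI[of _ g], intro conjI ballI allI)
    fix y assume y: "y \<in> H ` lp_space p"
    note y' = V[OF y, THEN conjunct1] V[OF y, THEN conjunct2]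
    show "f y \<in> lp_space p" using mem(9)[OF y'(1)] .
    show "g (f y) = y" by (rule gf[OF y'])
    show "f (\<lambda>n. c *\<^sub>R y n) = (\<lambda>n. c *\<^sub>R f y n)" for c by (rule lp_op_scaleR[OF K(1) y'(1)])
    show "f (\<lambda>n. y n + z n) = (\<lambda>n. f y n + f z n)" if "z \<in> H ` lp_space p" for z
      by (rule lp_op_add[OF K(1) y'(1) V[OF that, THEN conjunct1]])
  next
    fix y :: "nat \<Rightarrow> 'a" assume y: "y \<in> lp_space p"
    show "g y \<in> H ` lp_space p" using Hg[OF y] mem(12)[OF y] by (metis imageI)
    show "f (g y) = y" by (rule fg[OF y])
  next
    show "\<exists>K. \<forall>y\<in>H ` lp_space p. lp_norm p (f y) \<le> K * lp_norm p y"
      using bound[OF K(1)] V by blast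
    show "\<exists>K. \<forall>y\<in>lp_space p. lp_norm p (g y) \<le> K * lp_norm p y"
      using bound[OF K(2)] by blast
  qed
qed

theorem theorem1p2:
  fixes s :: "nat \<Rightarrow> 'a::banach"
    and sstar :: "nat \<Rightarrow> ('a \<Rightarrow>\<^sub>L real)"
    and p :: ereal
  assumes basis: "schauder_basis s"
    and s_norm: "\<And>j. norm (s j) = 1"
    and biorth: "biorthogonal s sstar"
    and sstar_norm: "\<And>j. norm (sstar j) = 1"
    and wstar_basis: "wstar_schauder_basis s sstar"
    and subsym: "wstar_subsymmetric sstar"
    and condC: "condition_C s sstar"
    and p_ge: "1 \<le> p"
  shows "(\<forall>T :: (nat \<Rightarrow> ('a \<Rightarrow>\<^sub>L real)) \<Rightarrow> (nat \<Rightarrow> ('a \<Rightarrow>\<^sub>L real)).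
            lp_bounded_linear p T \<longrightarrow>
            (\<exists>M N. lp_bounded_linear p M \<and> lp_bounded_linear p N \<and>
               (\<exists>H \<in> {T, \<lambda>y n. y n - T y n}. \<forall>y \<in> lp_space p. N (H (M y)) = y) \<and>
               lp_opnorm p M * lp_opnorm p N \<le> 48 * Ku sstar ^ 7 * Ks sstar ^ 4))
       \<and> (\<forall>Q :: (nat \<Rightarrow> ('a \<Rightarrow>\<^sub>L real)) \<Rightarrow> (nat \<Rightarrow> ('a \<Rightarrow>\<^sub>L real)).
            lp_bounded_linear p Q \<longrightarrow> (\<forall>y \<in> lp_space p. Q (Q y) = Q y) \<longrightarrow>
            lp_isomorphic p (Q ` lp_space p) (lp_space p) \<or>
            lp_isomorphic p ((\<lambda>y n. y n - Q y n) ` lp_space p) (lp_space p))"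
proof -
  obtain C1 where C1: "uncond_const sstar C1"
    using subsym unfolding wstar_subsymmetric_def wstar_unconditional_def by blast
  obtain C2 where C2: "subsym_const sstar C2" using subsym unfolding wstar_subsymmetric_def by blast
  have loc: "subsymmetric_wstar_basis s sstar Cu Cs" if "uncond_const sstar Cu" "subsym_const sstar Cs" for Cu Cs
    using that biorth s_norm sstar_norm wstar_basis by unfold_locales
  have Ku: "1 \<le> Ku sstar" unfolding Ku_def
    using C1 by (intro cInf_greatest) (auto simp: uncond_const_def)
  have Ks: "1 \<le> Ks sstar" unfolding Ks_def
    using C2 subsymmetric_wstar_basis.Cs_ge_1[OF loc[OF C1]] by (intro cInf_greatest) auto
  \<comment> \<open>The infima need not be attained. The factor \<open>11/10\<close> in each
    constant is harmless, because \<open>(11/10)^4 \<le> 3\<close> and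
    \<open>16 * 3 = 48\<close>.\<close>
  obtain Cu where Cu: "uncond_const sstar Cu" "Cu < 11/10 * Ku sstar"
    using cInf_lessD[of "{C. uncond_const sstar C}" "11/10 * Ku sstar"] C1 Ku unfolding Ku_def by auto
  obtain Cs where Cs: "subsym_const sstar Cs" "Cs < 11/10 * Ks sstar"
    using cInf_lessD[of "{C. subsym_const sstar C}" "11/10 * Ks sstar"] C2 Ks unfolding Ks_def by auto
  interpret subsymmetric_wstar_basis s sstar Cu Cs by (rule loc[OF Cu(1) Cs(1)])
  have const: "Cs * (16 * Cu^2 * Cs) \<le> 48 * Ku sstar ^ 7 * Ks sstar ^ 4"
  proof -
    have "Cu^2 \<le> (11/10 * Ku sstar)^2" "Cs^2 \<le> (11/10 * Ks sstar)^2"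
      using Cu(2) Cs(2) Cu_ge_1 Cs_ge_1 by (auto intro: power_mono)
    then have "Cu^2 * Cs^2 \<le> (11/10 * Ku sstar)^2 * (11/10 * Ks sstar)^2" by (intro mult_mono) auto
    also have "\<dots> \<le> 3 * (Ku sstar ^ 2 * Ks sstar ^ 2)" 
      using Ku Ks by (simp add: power_mult_distrib power2_eq_square)
    \<comment> \<open>Both constants are at least 1, so raising the exponents only enlarges the
      bound.\<close>
    also have "\<dots> \<le> 3 * (Ku sstar ^ 7 * Ks sstar ^ 4)"
      using Ku Ks by (intro mult_left_mono mult_mono power_increasing) auto
    finally show ?thesis by (simp add: power2_eq_square algebra_simps)
  qed
  have fact: "\<exists>H\<in>{T, \<lambda>y n. y n - T y n}. \<exists>M N. lp_op p M Cs \<and> lp_op p N (16 * Cu^2 * Cs) \<and>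
    (\<forall>y\<in>lp_space p. N (H (M y)) = y)" if T: "lp_bounded_linear p T"
    for T :: "(nat \<Rightarrow> ('a \<Rightarrow>\<^sub>L real)) \<Rightarrow> (nat \<Rightarrow> ('a \<Rightarrow>\<^sub>L real))"
  proof -
    obtain K where "lp_op p T K" using lp_bounded_linear_op[OF T p_ge] .
    then show ?thesis by (rule factorization_through_operator_or_complement[OF condC _ p_ge])
  qed
  show ?thesis
  proof (intro conjI allI impI)
    fix T :: "(nat \<Rightarrow> ('a \<Rightarrow>\<^sub>L real)) \<Rightarrow> (nat \<Rightarrow> ('a \<Rightarrow>\<^sub>L real))"
    assume "lp_bounded_linear p T"
    from fact[OF this] obtain H M N where H: "H \<in> {T, \<lambda>y n. y n - T y n}"
      and M: "lp_op p M Cs" and N: "lp_op p N (16 * Cu^2 * Cs)" and NHM: "\<forall>y\<in>lp_space p. N (H (M y)) = y"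
      by (elim bexE exE conjE)
    have "lp_opnorm p M * lp_opnorm p N \<le> Cs * (16 * Cu^2 * Cs)"
      using lp_opnorm_bounds[OF M p_ge] lp_opnorm_bounds[OF N p_ge] Cs_ge_1 by (intro mult_mono) auto
    then have le: "lp_opnorm p M * lp_opnorm p N \<le> 48 * Ku sstar ^ 7 * Ks sstar ^ 4" using const by linarith
    show "\<exists>M N. lp_bounded_linear p M \<and> lp_bounded_linear p N \<and>
               (\<exists>H \<in> {T, \<lambda>y n. y n - T y n}. \<forall>y \<in> lp_space p. N (H (M y)) = y) \<and>
               lp_opnorm p M * lp_opnorm p N \<le> 48 * Ku sstar ^ 7 * Ks sstar ^ 4"
      by (rule exI[of _ M], rule exI[of _ N])
         (intro conjI bexI[of _ H] H NHM le lp_op_bounded_linear[OF M p_ge] lp_op_bounded_linear[OF N p_ge])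
  next
    fix Q :: "(nat \<Rightarrow> ('a \<Rightarrow>\<^sub>L real)) \<Rightarrow> (nat \<Rightarrow> ('a \<Rightarrow>\<^sub>L real))"
    assume Q: "lp_bounded_linear p Q" and idem: "\<forall>y\<in>lp_space p. Q (Q y) = Q y"
    obtain K where K: "lp_op p Q K" using lp_bounded_linear_op[OF Q p_ge] .
    let ?R = "\<lambda>y n. y n - Q y n"
    have R: "lp_op p ?R (1 + K)" by (rule lp_op_minus[OF lp_op_id[OF p_ge] K p_ge])
    have idemR: "?R (?R y) = ?R y" if "y \<in> lp_space p" for y
      using that idem by (simp add: lp_op_diff[OF K p_ge] lp_op_mem[OF K p_ge])
    from fact[OF Q] obtain H M N where H: "H \<in> {Q, ?R}"
      and M: "lp_op p M Cs" and N: "lp_op p N (16 * Cu^2 * Cs)" and NHM: "\<forall>y\<in>lp_space p. N (H (M y)) = y"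
      by (elim bexE exE conjE)
    \<comment> \<open>A projection and its complement are both idempotent, so the decomposition
      applies to whichever of them factors the identity.\<close>
    from H consider "H = Q" | "H = ?R" by blast
    then show "lp_isomorphic p (Q ` lp_space p) (lp_space p) \<or> lp_isomorphic p (?R ` lp_space p) (lp_space p)"
    proof cases
      case 1
      have "lp_isomorphic p (Q ` lp_space p) (lp_space p)"
        by (rule idempotent_range_isomorphic[OF K M N p_ge]) (use idem NHM 1 in auto)
      then show ?thesis ..
    next
      case 2
      have "lp_isomorphic p (?R ` lp_space p) (lp_space p)"
        by (rule idempotent_range_isomorphic[OF R M N p_ge idemR]) (use NHM 2 in auto)
      then show ?thesis ..
    qed
  qed
qed

end
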